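(* Let $\mathcal T$ be a fractal spray in $\mathbb R^d$ given by the fractal string $\mathcal L=\{\ell_j\}_{j=1}^\infty$ (with $\ell_1=1$) and a single generator $G\subseteq\mathbb R^d$ with inradius $g$. Fix a Steiner-like representation $V(G,\varepsilon)=\sum_{k=0}^d\kappa_k(G,\varepsilon)\varepsilon^{d-k}$ ($0<\varepsilon\le g$) for $G$, and assume that the abscissa of convergence $D$ of the scaling zeta function $\zeta_{\mathcal L}$ is strictly smaller than $d$. Let $\zeta_{\mathcal T}(\varepsilon,s)$ be the tubular zeta function of $\mathcal T$. (Tube formula with error term.) If $\zeta_{\mathcal L}$ is languid of order $\varkappa<1$ for some screen $S$ with $S(0)<0$ (so that the window $W$ contains the integers $\{0,1,\dots,d\}$), then for all $\varepsilon>0$, $$V(\mathcal T,\varepsilon)=\sum_{\omega\in\mathcal D_{\mathcal T}(W)}\operatorname{Res}_{s=\omega}\zeta_{\mathcal T}(\varepsilon,s)+\lambda_d(G)\,\zeta_{\mathcal L}(d)+\mathcal R(\varepsilon),$$ where the error term is $$\mathcal R(\varepsilon)=\frac1{2\pi i}\int_S\frac{\varepsilon^{d-s}\zeta_{\mathcal L}(s)}{d-s}\left(\sum_{k=0}^{d-1}\frac{g^{s-k}}{s-k}(d-k)\kappa_k(G)\right)ds$$ and satisfies $\mathcal R(\varepsilon)=O(\varepsilon^{d-\sup S})$ as $\varepsilon\to0^+$. (Tube formula without error term.) If $\zeta_{\mathcal L}$ is strongly languid of order $\varkappa<2$ and with constant $A>0$, then the choice $W=\mathbb C$ is possible and the error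 term vanishes identically for $0<\varepsilon<\min\{g,A^{-1}g\}$; that is, for all such $\varepsilon$, $$V(\mathcal T,\varepsilon)=\sum_{\omega\in\mathcal D_{\mathcal T}}\operatorname{Res}_{s=\omega}\zeta_{\mathcal T}(\varepsilon,s)+\lambda_d(G)\,\zeta_{\mathcal L}(d).$$
   Context: Fractal strings and sprays. A fractal string is a nonincreasing sequence $\mathcal L=\{\ell_j\}_{j=1}^\infty$ of positive reals with $\ell_j\to0$; throughout $\ell_1=1$. A fractal spray $\mathcal T$ on a (single) generator $G\subseteq\mathbb R^d$ (a nonempty bounded connected open set) scaled by $\mathcal L$ is a collection of pairwise disjoint bounded open sets $\{G^j\}_{j\ge1}$ in $\mathbb R^d$ such that for each $j$, $G^j=\Psi_j(G)$ for a similarity transformation $\Psi_j$ of $\mathbb R^d$ with scaling ratio $\ell_j$. Inner parallel volumes. $\lambda_d$ is Lebesgue measure on $\mathbb R^d$. For bounded open $A\subseteq\mathbb R^d$ and $\varepsilon>0$, $A_{-\varepsilon}:=\{x\in A:\operatorname{dist}(x,A^c)\le\varepsilon\}$ and $V(A,\varepsilon):=\lambda_d(A_{-\varepsilon})$. Also $V(\mathcal T,\varepsilon):=\lambda_d(T_{-\varepsilon})=\sum_jV(G^j,\varepsilon)$ with $T=\bigcup_jG^j$. The inradius $g$ of $G$ is the radius of the largest open ball contained in $G$. Steiner-like representation. This is an expression $V(G,\varepsilon)=\sum_{k=0}^d\kappa_k(G,\varepsilon)\varepsilon^{d-k}$ for $0<\varepsilon\le g$, where each $\kappa_k(G,\cdot)$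 is a real-valued function on $(0,g]$ that is bounded on $[\varepsilon_0,g]$ for every $\varepsilon_0\in(0,g]$. Put $\kappa_k(G):=\kappa_k(G,g)$ and extend by $\kappa_k(G,\varepsilon):=\kappa_k(G)$ for $\varepsilon\ge g$. Zeta functions. $\zeta_{\mathcal L}(s)=\sum_j\ell_j^s$ for $\Re s>D$, where $D$ is the abscissa of convergence of this series; $\zeta_{\mathcal L}$ also denotes its meromorphic continuation. The tubular zeta function is (the meromorphic extension in $s$ of) $$\zeta_{\mathcal T}(\varepsilon,s)=\varepsilon^{d-s}\sum_{j=1}^\infty\ell_j^s\left(\sum_{k=0}^d\frac{g^{s-k}}{s-k}\kappa_k(G,\ell_j^{-1}\varepsilon)-\frac{g^{s-d}}{s-d}\lambda_d(G)\right).$$ Screens. A screen is the contour $S=\{S(t)+it:t\in\mathbb R\}$, where $S:\mathbb R\to(-\infty,D]$ is a bounded Lipschitz function; $\sup S:=\sup_tS(t)$. The window is $W=\{z:\Re z\ge S(\Im z)\}$. A screen is always chosen so that $\zeta_{\mathcal L}$ is meromorphic in a connected open neighborhood of $W$ and no pole of $\zeta_{\mathcal L}$ lies on $S$. $\int_S$ is taken upwards: $\int_Sf(s)\,ds=\int_{\mathbb R}f(S(t)+it)(S'(t)+i)\,dt$. Complex dimensions. $\mathcal D_{\mathcal L}(W)$ is the set of poles of $\zeta_{\mathcal L}$ in $W$ and $\mathcal D_{\mathcal T}(W):=\mathcal D_{\mathcal L}(W)\cup(\{0,1,\dots,d\}\cap W)$; $\mathcal D_{\mathcal T}:=\mathcal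 D_{\mathcal T}(\mathbb C)$. Languidness. Let $\{T_n\}_{n\in\mathbb Z}\subset\mathbb R$ with $T_{-n}<0<T_n$ for $n\ge1$, $T_n\to\infty$, $T_{-n}\to-\infty$, $T_n/|T_{-n}|\to1$ as $n\to\infty$. $\zeta_{\mathcal L}$ is languid of order $\varkappa\in\mathbb R$ (for $S$) if for some such sequence and some $c>0$: (L1) $|\zeta_{\mathcal L}(\alpha+iT_n)|\le c(|T_n|+1)^\varkappa$ for all $n\in\mathbb Z$ and all $\alpha\ge S(T_n)$; (L2) $|\zeta_{\mathcal L}(S(t)+it)|\le c|t|^\varkappa$ for all $|t|\ge1$. It is strongly languid of order $\varkappa$ with constant $A>0$ if there are screens $S_m$, $m\ge1$, with $\sup S_m\to-\infty$ and a uniform Lipschitz bound, such that (L1) holds for each $S_m$ with constants independent of $m$ and (L2$'$) $|\zeta_{\mathcal L}(S_m(t)+it)|\le c\,A^{|S_m(t)|}(|t|+1)^\varkappa$ for all $t\in\mathbb R$, $m\ge1$. Convention. An infinite sum over complex dimensions is understood as $\lim_{n\to\infty}$ of the sums over those $\omega$ with $T_{-n}<\Im\omega<T_n$, where $\{T_n\}$ is the sequence from the languidness condition. *)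

theory Defs
  imports "HOL-Complex_Analysis.Complex_Analysis" "HOL-Library.Landau_Symbols"
begin

subsection \<open>Fractal strings and sprays\<close>

text \<open>Sequences are indexed from 0, so the first (largest) length of a string is \<open>l 0\<close>.\<close>

definition fractal_string :: "(nat \<Rightarrow> real) \<Rightarrow> bool" where
  "fractal_string l \<longleftrightarrow> decseq l \<and> (\<forall>j. 0 < l j) \<and> l \<longlonglongrightarrow> 0"

definition similarity :: "real \<Rightarrow> ('a::euclidean_space \<Rightarrow> 'a) \<Rightarrow> bool" where
  "similarity r \<Psi> \<longleftrightarrow> 0 < r \<and> (\<forall>x y. dist (\<Psi> x) (\<Psi> y) = r * dist x y)"

definition generator :: "'a::euclidean_space set \<Rightarrow> bool" where
  "generator G \<longleftrightarrow> G \<noteq> {} \<and> open G \<and> connected G \<and> bounded G"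

definition fractal_spray ::
    "(nat \<Rightarrow> real) \<Rightarrow> 'a::euclidean_space set \<Rightarrow> (nat \<Rightarrow> 'a set) \<Rightarrow> bool" where
  "fractal_spray l G Gs \<longleftrightarrow>
     fractal_string l \<and> generator G \<and> disjoint_family Gs \<and>
     (\<forall>j. open (Gs j) \<and> bounded (Gs j) \<and> (\<exists>\<Psi>. similarity (l j) \<Psi> \<and> Gs j = \<Psi> ` G))"

subsection \<open>Inner parallel volumes and Steiner-like representations\<close>

definition inner_parallel :: "'a::euclidean_space set \<Rightarrow> real \<Rightarrow> 'a set" where
  "inner_parallel A \<epsilon> = {x \<in> A. infdist x (- A) \<le> \<epsilon>}"

definition parallel_volume :: "'a::euclidean_space set \<Rightarrow> real \<Rightarrow> real" where
  "parallel_volume A \<epsilon> = measure lebesgue (inner_parallel A \<epsilon>)"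

definition inradius :: "'a::euclidean_space set \<Rightarrow> real" where
  "inradius G = Sup {r. 0 < r \<and> (\<exists>x. ball x r \<subseteq> G)}"

definition steiner_like :: "'a::euclidean_space set \<Rightarrow> (nat \<Rightarrow> real \<Rightarrow> real) \<Rightarrow> bool" where
  "steiner_like G \<kappa> \<longleftrightarrow>
     (\<forall>\<epsilon>. 0 < \<epsilon> \<and> \<epsilon> \<le> inradius G \<longrightarrow>
        parallel_volume G \<epsilon> = (\<Sum>k\<le>DIM('a). \<kappa> k \<epsilon> * \<epsilon> ^ (DIM('a) - k))) \<and>
     (\<forall>k\<le>DIM('a). \<forall>\<epsilon>\<^sub>0. 0 < \<epsilon>\<^sub>0 \<and> \<epsilon>\<^sub>0 \<le> inradius G \<longrightarrow> bounded (\<kappa> k ` {\<epsilon>\<^sub>0..inradius G}))"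

text \<open>
  A coefficient function \<open>\<kappa> k\<close> only matters on \<open>(0, g]\<close>, \<open>g\<close> the inradius; beyond \<open>g\<close> it is
  continued by its value at \<open>g\<close>.
\<close>

definition steiner_coeff ::
    "'a::euclidean_space set \<Rightarrow> (nat \<Rightarrow> real \<Rightarrow> real) \<Rightarrow> nat \<Rightarrow> real \<Rightarrow> real" where
  "steiner_coeff G \<kappa> k \<epsilon> = (if \<epsilon> \<le> inradius G then \<kappa> k \<epsilon> else \<kappa> k (inradius G))"

subsection \<open>Meromorphic continuation\<close>

text \<open>
  \<open>is_continuation f A W F\<close>: \<open>F\<close> extends \<open>f\<close>, given on \<open>A\<close>, meromorphically to a connected open
  neighbourhood of \<open>W\<close>. Asking for nice meromorphy pins down the values of \<open>F\<close> at
  removable singularities. If \<open>W\<close> is connected and \<open>A\<close> is a nonempty open subset of it, \<open>F\<close> is unique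
  near every point of \<open>W\<close>; values of the chosen \<open>continuation\<close> off \<open>W\<close> have no meaning.
\<close>

definition is_continuation ::
    "(complex \<Rightarrow> complex) \<Rightarrow> complex set \<Rightarrow> complex set \<Rightarrow> (complex \<Rightarrow> complex) \<Rightarrow> bool" where
  "is_continuation f A W F \<longleftrightarrow>
     (\<exists>U. open U \<and> connected U \<and> W \<subseteq> U \<and> F nicely_meromorphic_on U) \<and> (\<forall>s\<in>A. F s = f s)"

definition continuation ::
    "(complex \<Rightarrow> complex) \<Rightarrow> complex set \<Rightarrow> complex set \<Rightarrow> complex \<Rightarrow> complex" where
  "continuation f A W = (SOME F. is_continuation f A W F)"

subsection \<open>Zeta functions\<close>

definition scaling_series :: "(nat \<Rightarrow> real) \<Rightarrow> complex \<Rightarrow> complex" where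
  "scaling_series l s = (\<Sum>j. of_real (l j) powr s)"

text \<open>Extended-real valued, so that a series converging nowhere has abscissa \<open>\<infinity>\<close>.\<close>

definition abscissa :: "(nat \<Rightarrow> real) \<Rightarrow> ereal" where
  "abscissa l = (INF s\<in>{s::complex. summable (\<lambda>j. of_real (l j) powr s)}. ereal (Re s))"

definition scaling_halfplane :: "(nat \<Rightarrow> real) \<Rightarrow> complex set" where
  "scaling_halfplane l = {s. abscissa l < ereal (Re s)}"

definition scaling_zeta_extends :: "(nat \<Rightarrow> real) \<Rightarrow> complex set \<Rightarrow> bool" where
  "scaling_zeta_extends l W \<longleftrightarrow>
     (\<exists>F. is_continuation (scaling_series l) (scaling_halfplane l) W F)"

definition scaling_zeta :: "(nat \<Rightarrow> real) \<Rightarrow> complex set \<Rightarrow> complex \<Rightarrow> complex" where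
  "scaling_zeta l W = continuation (scaling_series l) (scaling_halfplane l) W"

definition tubular_series ::
    "(nat \<Rightarrow> real) \<Rightarrow> 'a::euclidean_space set \<Rightarrow> (nat \<Rightarrow> real \<Rightarrow> real) \<Rightarrow> real \<Rightarrow> complex \<Rightarrow> complex"
  where
  "tubular_series l G \<kappa> \<epsilon> s =
     of_real \<epsilon> powr (of_nat DIM('a) - s) *
     (\<Sum>j. of_real (l j) powr s *
        ((\<Sum>k\<le>DIM('a). of_real (inradius G) powr (s - of_nat k) / (s - of_nat k) *
             of_real (steiner_coeff G \<kappa> k (\<epsilon> / l j)))
         - of_real (inradius G) powr (s - of_nat DIM('a)) / (s - of_nat DIM('a)) *
             of_real (measure lebesgue G)))"

definition tubular_zeta ::
    "(nat \<Rightarrow> real) \<Rightarrow> 'a::euclidean_space set \<Rightarrow> (nat \<Rightarrow> real \<Rightarrow> real) \<Rightarrow> complex set \<Rightarrow>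
     real \<Rightarrow> complex \<Rightarrow> complex" where
  "tubular_zeta l G \<kappa> W \<epsilon> =
     continuation (tubular_series l G \<kappa> \<epsilon>) (scaling_halfplane l - of_nat ` {..DIM('a)}) W"

subsection \<open>Screens, windows and complex dimensions\<close>

definition window :: "(real \<Rightarrow> real) \<Rightarrow> complex set" where
  "window S = {z. S (Im z) \<le> Re z}"

definition screen :: "(nat \<Rightarrow> real) \<Rightarrow> (real \<Rightarrow> real) \<Rightarrow> bool" where
  "screen l S \<longleftrightarrow>
     bounded (range S) \<and> (\<exists>K. K-lipschitz_on UNIV S) \<and> (\<forall>t. ereal (S t) \<le> abscissa l) \<and>
     scaling_zeta_extends l (window S) \<and>
     (\<forall>t. \<not> is_pole (scaling_zeta l (window S)) (Complex (S t) t))"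

text \<open>
  The derivative of the Lipschitz function \<open>S\<close> exists almost everywhere; \<open>deriv\<close> is unspecified
  at the remaining points, which do not contribute to the integral.
\<close>

definition screen_integrand ::
    "(real \<Rightarrow> real) \<Rightarrow> (complex \<Rightarrow> complex) \<Rightarrow> real \<Rightarrow> complex" where
  "screen_integrand S f t = f (Complex (S t) t) * (of_real (deriv S t) + \<i>)"

definition screen_integral :: "(real \<Rightarrow> real) \<Rightarrow> (complex \<Rightarrow> complex) \<Rightarrow> complex" where
  "screen_integral S f = (LINT t|lebesgue. screen_integrand S f t)"

definition scaling_dims :: "(nat \<Rightarrow> real) \<Rightarrow> complex set \<Rightarrow> complex set" where
  "scaling_dims l W = {\<omega> \<in> W. is_pole (scaling_zeta l W) \<omega>}"

definition tubular_dims :: "(nat \<Rightarrow> real) \<Rightarrow> nat \<Rightarrow> complex set \<Rightarrow> complex set" where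
  "tubular_dims l d W = scaling_dims l W \<union> (of_nat ` {..d} \<inter> W)"

subsection \<open>Languidness\<close>

text \<open>
  The heights \<open>T\<close> (and the screens \<open>S m\<close> in the strong case) are parameters of the predicates,
  because they also govern the order of summation over the complex dimensions.
\<close>

definition languid_heights :: "(int \<Rightarrow> real) \<Rightarrow> bool" where
  "languid_heights T \<longleftrightarrow>
     (\<forall>n\<ge>1. T (- n) < 0 \<and> 0 < T n) \<and>
     filterlim (\<lambda>n. T (int n)) at_top sequentially \<and>
     filterlim (\<lambda>n. T (- int n)) at_bot sequentially \<and>
     (\<lambda>n. T (int n) / \<bar>T (- int n)\<bar>) \<longlonglongrightarrow> 1"

definition languid_L1 ::
    "(nat \<Rightarrow> real) \<Rightarrow> (real \<Rightarrow> real) \<Rightarrow> (int \<Rightarrow> real) \<Rightarrow> real \<Rightarrow> real \<Rightarrow> bool" where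
  "languid_L1 l S T q c \<longleftrightarrow>
     (\<forall>n \<alpha>. S (T n) \<le> \<alpha> \<longrightarrow>
        norm (scaling_zeta l (window S) (Complex \<alpha> (T n))) \<le> c * (\<bar>T n\<bar> + 1) powr q)"

definition languid :: "(nat \<Rightarrow> real) \<Rightarrow> (real \<Rightarrow> real) \<Rightarrow> (int \<Rightarrow> real) \<Rightarrow> real \<Rightarrow> bool" where
  "languid l S T q \<longleftrightarrow>
     languid_heights T \<and>
     (\<exists>c>0. languid_L1 l S T q c \<and>
        (\<forall>t. 1 \<le> \<bar>t\<bar> \<longrightarrow>
           norm (scaling_zeta l (window S) (Complex (S t) t)) \<le> c * \<bar>t\<bar> powr q))"

definition strongly_languid ::
    "(nat \<Rightarrow> real) \<Rightarrow> (nat \<Rightarrow> real \<Rightarrow> real) \<Rightarrow> (int \<Rightarrow> real) \<Rightarrow> real \<Rightarrow> real \<Rightarrow> bool" where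
  "strongly_languid l S T q A \<longleftrightarrow>
     languid_heights T \<and>
     (\<forall>m. screen l (S m)) \<and>
     filterlim (\<lambda>m. SUP t. S m t) at_bot sequentially \<and>
     (\<exists>K. \<forall>m. K-lipschitz_on UNIV (S m)) \<and>
     (\<exists>c>0. \<forall>m. languid_L1 l (S m) T q c \<and>
        (\<forall>t. norm (scaling_zeta l (window (S m)) (Complex (S m t) t))
               \<le> c * A powr \<bar>S m t\<bar> * (\<bar>t\<bar> + 1) powr q))"

subsection \<open>Sums over complex dimensions\<close>

definition dims_between :: "(int \<Rightarrow> real) \<Rightarrow> complex set \<Rightarrow> nat \<Rightarrow> complex set" where
  "dims_between T \<Omega> n = {\<omega> \<in> \<Omega>. T (- int n) < Im \<omega> \<and> Im \<omega> < T (int n)}"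

text \<open>
  In a single window every \<open>dims_between T \<Omega> n\<close> is finite, since the screen is bounded.
\<close>

definition has_dims_sum ::
    "(int \<Rightarrow> real) \<Rightarrow> complex set \<Rightarrow> (complex \<Rightarrow> complex) \<Rightarrow> complex \<Rightarrow> bool" where
  "has_dims_sum T \<Omega> f L \<longleftrightarrow> (\<lambda>n. \<Sum>\<omega>\<in>dims_between T \<Omega> n. f \<omega>) \<longlonglongrightarrow> L"

text \<open>
  When the window is the whole plane, a horizontal strip may contain infinitely many complex
  dimensions, whose real parts then tend to \<open>- \<infinity>\<close>. The sum over such a strip is the limit
  of its (finite) sums over the windows \<open>W m\<close> of the screens exhausting the plane.
\<close>

definition has_strip_sum ::
    "(nat \<Rightarrow> complex set) \<Rightarrow> complex set \<Rightarrow> (complex \<Rightarrow> complex) \<Rightarrow> complex \<Rightarrow> bool" where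
  "has_strip_sum W \<Omega> f P \<longleftrightarrow>
     (if finite \<Omega> then P = (\<Sum>\<omega>\<in>\<Omega>. f \<omega>) else (\<lambda>m. \<Sum>\<omega>\<in>\<Omega> \<inter> W m. f \<omega>) \<longlonglongrightarrow> P)"

definition has_full_dims_sum ::
    "(nat \<Rightarrow> complex set) \<Rightarrow> (int \<Rightarrow> real) \<Rightarrow> complex set \<Rightarrow> (complex \<Rightarrow> complex) \<Rightarrow> complex \<Rightarrow> bool"
  where
  "has_full_dims_sum W T \<Omega> f L \<longleftrightarrow>
     (\<exists>P. (\<forall>n\<ge>1. has_strip_sum W (dims_between T \<Omega> n) f (P n)) \<and> P \<longlonglongrightarrow> L)"

subsection \<open>The error term\<close>

definition error_density ::
    "(nat \<Rightarrow> real) \<Rightarrow> 'a::euclidean_space set \<Rightarrow> (nat \<Rightarrow> real \<Rightarrow> real) \<Rightarrow> complex set \<Rightarrow>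
     real \<Rightarrow> complex \<Rightarrow> complex" where
  "error_density l G \<kappa> W \<epsilon> s =
     of_real \<epsilon> powr (of_nat DIM('a) - s) * scaling_zeta l W s / (of_nat DIM('a) - s) *
     (\<Sum>k<DIM('a). of_real (inradius G) powr (s - of_nat k) / (s - of_nat k) *
        of_nat (DIM('a) - k) * of_real (steiner_coeff G \<kappa> k (inradius G)))"

definition error_term ::
    "(nat \<Rightarrow> real) \<Rightarrow> 'a::euclidean_space set \<Rightarrow> (nat \<Rightarrow> real \<Rightarrow> real) \<Rightarrow> (real \<Rightarrow> real) \<Rightarrow>
     real \<Rightarrow> complex" where
  "error_term l G \<kappa> S \<epsilon> =
     1 / (2 * of_real pi * \<i>) * screen_integral S (error_density l G \<kappa> (window S) \<epsilon>)"

end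

theory Submission
  imports Defs
begin

text \<open>
  Write \<open>d\<close> for the dimension, \<open>g\<close> for the inradius of \<open>G\<close>, \<open>\<zeta>\<close> for the scaling zeta function and
  call the piece with index \<open>j\<close> large if \<open>\<epsilon> < l j * g\<close>. Only finitely many pieces are large, and every
  other piece is swallowed completely by its inner parallel set. Since \<open>g\<close> is the inradius, the
  Steiner-like representation at \<open>g\<close> gives \<open>\<lambda>(G) = (\<Sum>k\<le>d. \<kappa> k g * g ^ (d - k))\<close>, and therefore the series that
  defines the tubular zeta function collapses to \<open>tkernel * \<zeta> + correction\<close>, where
  \<open>tkernel s = \<epsilon> powr (d - s) * (\<Sum>k\<le>d. \<kappa> k g * g powr (s - k) * (1 / (s - k) - 1 / (s - d)))\<close> is \<open>O(1 / s^2)\<close> at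
  infinity on vertical lines and \<open>correction\<close> is an explicit function with at most simple poles at \<open>0, ..., d\<close> that
  only sees the large pieces (\<open>residue_tubular_zeta\<close>). On the geometric side, the volume of the
  spray is \<open>main_part + (residues of the correction) + \<lambda>(G) * \<zeta>(d)\<close> (\<open>volume_eq\<close>).

  It remains to express \<open>main_part\<close> by the residues of \<open>tkernel * \<zeta>\<close>. First, \<open>2 * pi * \<i> * main_part\<close> is the
  integral of \<open>tkernel * \<zeta>\<close> over the line \<open>Re s = d + 1\<close> (\<open>line_limit_heights\<close>): split \<open>\<zeta>\<close> into the terms of
  the large pieces and the others. The integrand contains the powers \<open>(l j * g / \<epsilon>) powr s\<close>, whose base
  is at most \<open>1\<close> for the small pieces, so that their line can be moved to the far right
  and contributes nothing; for the large pieces the base exceeds \<open>1\<close>, and moving the line to the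
  far left picks up the residues at \<open>0, ..., d\<close>. Secondly, the residue theorem between the screen
  and that line (\<open>residue_theorem_strip\<close>) expresses the same integral by the residues in the
  window, the integral over the screen and two horizontal integrals at the heights \<open>T n\<close>. The latter
  vanish in the limit because \<open>tkernel * \<zeta>\<close> is \<open>O(\<bar>T n\<bar> powr (q - 2))\<close> there. Divided by \<open>2 * pi * \<i>\<close>, the
  integral over the screen is the error term. For strongly languid strings the screens are first pushed to \<open>- \<infinity>\<close> between
  two fixed heights; the integral over them is bounded by a multiple of
  \<open>(A * \<epsilon> / g) powr (- (SUP t. S m t))\<close> and disappears, and then the heights tend to infinity.

  Two points need preparation. A screen is merely Lipschitz. Its almost everywhere
  differentiability follows from the Vitali covering theorem
  (\<open>negligible_not_differentiable_lipschitz\<close>) and yields the fundamental theorem of calculus along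
  it; the residue theorem then follows by removing principal parts, because a holomorphic function
  has a primitive on the simply connected region to the right of a slightly shifted screen.
  Moreover, zeta functions are chosen continuations; by the identity theorem on a connected
  neighbourhood of the window, residues do not depend on the choice (\<open>continuation_unique\<close>).
\<close>

section \<open>Similarities and the inner parallel volume of a spray\<close>

lemma similarity_surj:
  assumes "similarity r (\<Psi> :: 'a::euclidean_space \<Rightarrow> 'a)"
  shows "surj \<Psi>"
proof -
  have r: "r > 0" and d: "\<And>x y. dist (\<Psi> x) (\<Psi> y) = r * dist x y" using assms by (auto simp: similarity_def)
  define L where "L = (\<lambda>x. (1 / r) *\<^sub>R (\<Psi> x - \<Psi> 0))"
  have "dist (L x) (L y) = dist x y" for x y
  proof -
    have "L x - L y = (1 / r) *\<^sub>R (\<Psi> x - \<Psi> y)" by (simp add: L_def scaleR_right_diff_distrib)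
    then show ?thesis using d[of x y] r by (simp add: dist_norm)
  qed
  then have "orthogonal_transformation L" unfolding orthogonal_transformation_isometry by (simp add: L_def)
  then have L: "surj L" by (rule orthogonal_transformation_surj)
  have "\<exists>x. \<Psi> x = y" for y
  proof -
    obtain x where "L x = (1 / r) *\<^sub>R (y - \<Psi> 0)" using L by (metis surjD)
    then show ?thesis using r by (auto simp: L_def)
  qed
  then show ?thesis by (metis surj_def)
qed

lemma similarity_inj: "similarity r \<Psi> \<Longrightarrow> inj \<Psi>"
proof (rule injI)
  fix x y assume "similarity r \<Psi>" "\<Psi> x = \<Psi> y"
  then have "r * dist x y = 0" "r > 0" by (metis dist_self similarity_def) (simp add: \<open>similarity r \<Psi>\<close>[unfolded similarity_def])
  then show "x = y" by simp
qed

lemma similarity_ball: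
  assumes "similarity r (\<Psi> :: 'a::euclidean_space \<Rightarrow> 'a)"
  shows "\<Psi> ` ball x \<rho> = ball (\<Psi> x) (r * \<rho>)"
proof -
  have r: "r > 0" and d: "\<And>x y. dist (\<Psi> x) (\<Psi> y) = r * dist x y" using assms by (auto simp: similarity_def)
  show ?thesis
  proof (intro equalityI subsetI)
    fix y assume y: "y \<in> ball (\<Psi> x) (r * \<rho>)"
    obtain z where "y = \<Psi> z" using similarity_surj[OF assms] by (metis surjD)
    then show "y \<in> \<Psi> ` ball x \<rho>" using y r d by auto
  qed (use r d in auto)
qed

lemma similarity_open:
  assumes "similarity r (\<Psi> :: 'a::euclidean_space \<Rightarrow> 'a)" "open U"
  shows "open (\<Psi> ` U)"
  unfolding open_contains_ball
proof
  fix y assume "y \<in> \<Psi> ` U"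
  then obtain x where x: "x \<in> U" "y = \<Psi> x" by auto
  then obtain e where e: "e > 0" "ball x e \<subseteq> U" using assms(2) open_contains_ball by blast
  then have "ball y (r * e) \<subseteq> \<Psi> ` U" using similarity_ball[OF assms(1), of x e] x image_mono[OF e(2), of \<Psi>] by simp
  moreover have "r * e > 0" using e assms(1) by (auto simp: similarity_def)
  ultimately show "\<exists>e>0. ball y e \<subseteq> \<Psi> ` U" by blast
qed

text \<open>
  By the Vitali covering theorem an open set is a disjoint union of balls up to a null set. A
  similarity maps balls to balls, and it preserves null sets because it is Lipschitz.
\<close>

lemma emeasure_similarity_open:
  assumes sim: "similarity r (\<Psi> :: 'a::euclidean_space \<Rightarrow> 'a)" and U: "open U"
  shows "emeasure lebesgue (\<Psi> ` U) = ennreal (r ^ DIM('a)) * emeasure lebesgue U"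
proof -
  have r: "r > 0" and d: "\<And>x y. dist (\<Psi> x) (\<Psi> y) = r * dist x y" using sim by (auto simp: similarity_def)
  define K where "K = {(x,\<rho>). 0 < \<rho> \<and> ball x \<rho> \<subseteq> U}"
  have cov: "\<exists>i. i \<in> K \<and> x \<in> ball (fst i) (snd i) \<and> snd i < e" if xe: "x \<in> U" "0 < e" for x e
  proof -
    obtain \<delta> where \<delta>: "\<delta> > 0" "ball x \<delta> \<subseteq> U" using openE[OF U xe(1)] by metis
    then show ?thesis using that by (intro exI[of _ "(x, min \<delta> (e/2))"]) (auto simp: K_def)
  qed
  obtain C where C: "countable C" "C \<subseteq> K"
     "pairwise (\<lambda>i j. disjnt (ball (fst i) (snd i)) (ball (fst j) (snd j))) C"
     "negligible (U - (\<Union>i\<in>C. ball (fst i) (snd i)))"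
    by (rule Vitali_covering_theorem_balls[of U K fst snd, OF cov])
  define B where "B = (\<lambda>i::'a \<times> real. ball (fst i) (snd i))"
  define N where "N = U - (\<Union>i\<in>C. B i)"
  have neg: "negligible N" using C(4) by (simp add: N_def B_def)
  have negI: "negligible (\<Psi> ` N)"
  proof (rule negligible_locally_Lipschitz_image[OF _ neg])
    show "\<exists>T Ba. open T \<and> x \<in> T \<and> (\<forall>y\<in>N \<inter> T. norm (\<Psi> y - \<Psi> x) \<le> Ba * norm (y - x))" for x
      using d by (intro exI[of _ UNIV] exI[of _ r]) (auto simp: dist_norm)
  qed simp
  have disj: "disjoint_family_on B C"
    using C(3) by (auto simp: disjoint_family_on_def pairwise_def disjnt_def B_def)
  have disjI: "disjoint_family_on (\<lambda>i. \<Psi> ` B i) C"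
    using disj by (simp add: disjoint_family_on_def flip: image_Int[OF similarity_inj[OF sim]])
  have opB: "open (\<Psi> ` B i)" for i using similarity_open[OF sim] by (simp add: B_def)
  have "B i \<subseteq> U" if "i \<in> C" for i using C(2) that unfolding K_def B_def by (cases i) auto
  then have U_eq: "U = (\<Union>i\<in>C. B i) \<union> N" by (auto simp: N_def)
  have "emeasure lebesgue U = emeasure lebesgue (\<Union>i\<in>C. B i)"
  proof -
    have "open (\<Union>i\<in>C. B i)" by (auto simp: B_def)
    then have "(\<Union>i\<in>C. B i) \<in> sets borel" by (rule borel_open)
    then have 1: "(\<Union>i\<in>C. B i) \<in> sets lebesgue" by auto
    have 2: "N \<in> null_sets lebesgue" using neg by (simp only: negligible_iff_null_sets)
    show ?thesis using emeasure_Un_null_set[OF 1 2] by (simp only: U_eq[symmetric])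
  qed
  also have "\<dots> = (\<integral>\<^sup>+i. emeasure lebesgue (B i) \<partial>count_space C)"
    by (rule emeasure_UN_countable) (use C(1) disj in \<open>auto simp: B_def\<close>)
  finally have 1: "emeasure lebesgue U = (\<integral>\<^sup>+i. emeasure lebesgue (B i) \<partial>count_space C)" .
  have "\<Psi> ` U = \<Psi> ` ((\<Union>i\<in>C. B i) \<union> N)" by (simp only: U_eq[symmetric])
  also have "\<dots> = (\<Union>i\<in>C. \<Psi> ` B i) \<union> \<Psi> ` N" by blast
  finally have "emeasure lebesgue (\<Psi> ` U) = emeasure lebesgue (\<Union>i\<in>C. \<Psi> ` B i)"
  proof -
    assume *: "\<Psi> ` U = (\<Union>i\<in>C. \<Psi> ` B i) \<union> \<Psi> ` N"
    have "open (\<Union>i\<in>C. \<Psi> ` B i)" using opB by auto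
    then have "(\<Union>i\<in>C. \<Psi> ` B i) \<in> sets borel" by (rule borel_open)
    then have 1: "(\<Union>i\<in>C. \<Psi> ` B i) \<in> sets lebesgue" by auto
    have 2: "\<Psi> ` N \<in> null_sets lebesgue" using negI by (simp only: negligible_iff_null_sets)
    show ?thesis using emeasure_Un_null_set[OF 1 2] by (simp only: *)
  qed
  also have "\<dots> = (\<integral>\<^sup>+i. emeasure lebesgue (\<Psi> ` B i) \<partial>count_space C)"
    by (rule emeasure_UN_countable) (use C(1) disjI opB in auto)
  also have "\<dots> = (\<integral>\<^sup>+i. ennreal (r ^ DIM('a)) * emeasure lebesgue (B i) \<partial>count_space C)"
  proof (rule nn_integral_cong)
    fix i assume "i \<in> space (count_space C)"
    then have i: "0 < snd i" using C(2) by (auto simp: K_def)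
    have "emeasure lebesgue (\<Psi> ` B i) = emeasure lborel (ball (\<Psi> (fst i)) (r * snd i))"
      by (simp add: B_def similarity_ball[OF sim])
    also have "\<dots> = ennreal (unit_ball_vol (real DIM('a)) * (r * snd i) ^ DIM('a))"
      using i r by (simp add: emeasure_ball)
    also have "\<dots> = ennreal (r ^ DIM('a)) * ennreal (unit_ball_vol (real DIM('a)) * snd i ^ DIM('a))"
      using i r by (simp add: power_mult_distrib mult_ac flip: ennreal_mult)
    also have "ennreal (unit_ball_vol (real DIM('a)) * snd i ^ DIM('a)) = emeasure lebesgue (B i)"
      using i by (simp add: emeasure_ball B_def)
    finally show "emeasure lebesgue (\<Psi> ` B i) = ennreal (r ^ DIM('a)) * emeasure lebesgue (B i)" .
  qed
  also have "\<dots> = ennreal (r ^ DIM('a)) * emeasure lebesgue U"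
    unfolding 1 by (rule nn_integral_cmult) auto
  finally show ?thesis .
qed

lemma infdist_greatest: "A \<noteq> {} \<Longrightarrow> (\<And>a. a \<in> A \<Longrightarrow> c \<le> dist x a) \<Longrightarrow> c \<le> infdist x A"
  by (simp add: infdist_notempty cINF_greatest)

lemma infdist_similarity:
  assumes sim: "similarity r (\<Psi> :: 'a::euclidean_space \<Rightarrow> 'a)" and A: "A \<noteq> {}"
  shows "infdist (\<Psi> x) (\<Psi> ` A) = r * infdist x A"
proof (rule antisym)
  have r: "r > 0" and d: "\<And>x y. dist (\<Psi> x) (\<Psi> y) = r * dist x y" using sim by (auto simp: similarity_def)
  show "r * infdist x A \<le> infdist (\<Psi> x) (\<Psi> ` A)"
  proof (rule infdist_greatest)
    fix b assume "b \<in> \<Psi> ` A"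
    then obtain a where "a \<in> A" "b = \<Psi> a" by auto
    then show "r * infdist x A \<le> dist (\<Psi> x) b" using infdist_le[of a A x] r d by simp
  qed (use A in simp)
  have "infdist (\<Psi> x) (\<Psi> ` A) / r \<le> infdist x A"
  proof (rule infdist_greatest[OF A])
    fix a assume "a \<in> A"
    then have "infdist (\<Psi> x) (\<Psi> ` A) \<le> dist (\<Psi> x) (\<Psi> a)" by (intro infdist_le) auto
    then show "infdist (\<Psi> x) (\<Psi> ` A) / r \<le> dist x a" using r d by (simp add: field_simps)
  qed
  then show "infdist (\<Psi> x) (\<Psi> ` A) \<le> r * infdist x A" using r by (simp add: field_simps)
qed

lemma Compl_bounded_nonempty: "bounded (A::'a::euclidean_space set) \<Longrightarrow> - A \<noteq> {}"
  by (metis compl_bot_eq double_compl not_bounded_UNIV)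

lemma open_infdist_gt: "open A \<Longrightarrow> open {x \<in> A. \<epsilon> < infdist x B}"
proof -
  assume "open A"
  moreover have "{x \<in> A. \<epsilon> < infdist x B} = A \<inter> {x. \<epsilon> < infdist x B}" by auto
  ultimately show ?thesis by (auto intro!: open_Int open_Collect_less continuous_intros)
qed

lemma inner_parallel_lmeasurable:
  assumes "open A" "bounded A"
  shows "inner_parallel A \<epsilon> \<in> lmeasurable"
proof -
  have "inner_parallel A \<epsilon> = A - {x \<in> A. \<epsilon> < infdist x (- A)}" by (auto simp: inner_parallel_def)
  moreover have "A - {x \<in> A. \<epsilon> < infdist x (- A)} \<in> sets lebesgue"
    using assms open_infdist_gt[OF assms(1), of \<epsilon> "- A"] by auto
  ultimately show ?thesis using assms
    by (intro bounded_set_imp_lmeasurable) (auto simp: inner_parallel_def intro: bounded_subset)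
qed

text \<open>
  The inner parallel set is a difference of two open sets, so that its volume only requires the
  behaviour of the measure of open sets under similarities.
\<close>

lemma parallel_volume_diff:
  assumes "open A" "bounded A"
  shows "parallel_volume A \<epsilon> = measure lebesgue A - measure lebesgue {x \<in> A. \<epsilon> < infdist x (- A)}"
proof -
  have "inner_parallel A \<epsilon> = A - {x \<in> A. \<epsilon> < infdist x (- A)}" by (auto simp: inner_parallel_def)
  then show ?thesis unfolding parallel_volume_def using assms open_infdist_gt[OF assms(1), of \<epsilon> "- A"]
    by (simp add: measurable_measure_Diff lmeasurable_open)
qed

lemma parallel_volume_similarity:
  assumes sim: "similarity r (\<Psi> :: 'a::euclidean_space \<Rightarrow> 'a)" and A: "open A" "bounded A" "bounded (\<Psi> ` A)"
  shows "parallel_volume (\<Psi> ` A) \<epsilon> = r ^ DIM('a) * parallel_volume A (\<epsilon> / r)"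
proof -
  have r: "r > 0" using sim by (auto simp: similarity_def)
  have m: "measure lebesgue (\<Psi> ` U) = r ^ DIM('a) * measure lebesgue U" if "open U" for U
    unfolding measure_def emeasure_similarity_open[OF sim that] using r by (simp add: enn2real_mult)
  have "bij \<Psi>" using similarity_inj[OF sim] similarity_surj[OF sim] by (simp add: bij_def)
  then have "infdist (\<Psi> x) (- (\<Psi> ` A)) = r * infdist x (- A)" for x
    using infdist_similarity[OF sim, of "- A" x] Compl_bounded_nonempty[OF A(2)] bij_image_Compl_eq[of \<Psi> A] by simp
  then have "{y \<in> \<Psi> ` A. \<epsilon> < infdist y (- (\<Psi> ` A))} = \<Psi> ` {x \<in> A. \<epsilon> / r < infdist x (- A)}"
    using r by (auto simp: field_simps)
  then show ?thesis
    using parallel_volume_diff[OF A(1,2), of "\<epsilon> / r"] parallel_volume_diff[OF similarity_open[OF sim A(1)] A(3), of \<epsilon>]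
      m[OF A(1)] m[OF open_infdist_gt[OF A(1)]] by (simp add: right_diff_distrib)
qed

text \<open>
  A point of one piece is not farther from the complement of the union than from the complement of
  its own piece: a segment that leaves \<open>Gs j\<close> meets its frontier, and frontier points of \<open>Gs j\<close> lie
  in no piece, since the pieces are open and disjoint.
\<close>

lemma infdist_Compl_UN:
  fixes Gs :: "'i \<Rightarrow> 'a::euclidean_space set"
  assumes op: "\<And>j. open (Gs j)" and bd: "bounded (Gs j)" and disj: "disjoint_family Gs" and x: "x \<in> Gs j"
  shows "infdist x (- (\<Union>j. Gs j)) = infdist x (- Gs j)"
proof -
  have *: "\<exists>z\<in>- (\<Union>j. Gs j). dist x z \<le> dist x y" if y: "y \<in> - Gs j" for y
  proof -
    have "closed_segment x y \<inter> frontier (Gs j) \<noteq> {}"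
      by (rule connected_Int_frontier) (use x y in \<open>auto\<close>)
    then obtain z where z: "z \<in> closed_segment x y" "z \<in> frontier (Gs j)" by auto
    have "z \<notin> Gs i" for i
    proof
      assume zi: "z \<in> Gs i"
      have zc: "z \<in> closure (Gs j)" "z \<notin> Gs j" using z(2) op by (auto simp: frontier_def interior_open)
      then have "i \<noteq> j" using zi by auto
      then have "Gs i \<inter> Gs j = {}" using disj by (auto simp: disjoint_family_on_def)
      then show False using op[of i] zi zc open_Int_closure_eq_empty by blast
    qed
    moreover have "dist x z \<le> dist x y" using z(1) by (metis dist_commute segment_bound(1) dist_norm)
    ultimately show ?thesis by blast
  qed
  have ne: "- Gs j \<noteq> {}" by (rule Compl_bounded_nonempty[OF bd])
  then have neU: "- (\<Union>j. Gs j) \<noteq> {}" using * by blast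
  show ?thesis
  proof (rule antisym)
    show "infdist x (- (\<Union>j. Gs j)) \<le> infdist x (- Gs j)"
      by (rule infdist_greatest[OF ne]) (use * in \<open>meson infdist_le2\<close>)
    show "infdist x (- Gs j) \<le> infdist x (- (\<Union>j. Gs j))"
      using neU by (intro infdist_mono) auto
  qed
qed

lemma inner_parallel_UN:
  fixes Gs :: "'i \<Rightarrow> 'a::euclidean_space set"
  assumes op: "\<And>j. open (Gs j)" and bd: "\<And>j. bounded (Gs j)" and disj: "disjoint_family Gs"
  shows "inner_parallel (\<Union>j. Gs j) \<epsilon> = (\<Union>j. inner_parallel (Gs j) \<epsilon>)"
  using infdist_Compl_UN[OF op bd disj] unfolding inner_parallel_def by auto

lemma inradius_properties:
  assumes "generator (G::'a::euclidean_space set)"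
  shows inradius_pos: "inradius G > 0" and infdist_le_inradius: "infdist x (- G) \<le> inradius G"
proof -
  have G: "G \<noteq> {}" "open G" "bounded G" using assms by (auto simp: generator_def)
  define R where "R = {r. 0 < r \<and> (\<exists>x. ball x r \<subseteq> G)}"
  obtain B where "\<And>x. x \<in> G \<Longrightarrow> norm x \<le> B" using G(3) unfolding bounded_iff by blast
  then have B: "G \<subseteq> cball 0 B" by auto
  have bdd: "bdd_above R"
  proof (rule bdd_aboveI)
    fix r assume "r \<in> R"
    then obtain x where "0 < r" "ball x r \<subseteq> G" unfolding R_def by blast
    then have "0 < r" "ball x r \<subseteq> cball 0 B" using B by auto
    then have "dist x 0 + r \<le> B" by (auto simp: ball_subset_cball_iff)
    then show "r \<le> B" using zero_le_dist[of x 0] by linarith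
  qed
  obtain y where "y \<in> G" using G(1) by auto
  then obtain e where e: "e > 0" "ball y e \<subseteq> G" using G(2) open_contains_ball by blast
  then have "e \<in> R" by (auto simp: R_def)
  then have "e \<le> Sup R" using bdd by (rule cSup_upper)
  then show pos: "inradius G > 0" using e by (simp add: inradius_def R_def)
  show "infdist x (- G) \<le> inradius G"
  proof (cases "infdist x (- G) > 0")
    case True
    have "ball x (infdist x (- G)) \<subseteq> G"
    proof
      fix z assume "z \<in> ball x (infdist x (- G))"
      then show "z \<in> G" using infdist_le[of z "- G" x] by force
    qed
    then have "infdist x (- G) \<in> R" using True by (auto simp: R_def)
    then show ?thesis unfolding inradius_def R_def[symmetric] using bdd by (rule cSup_upper)
  qed (use pos in simp)
qed

lemma parallel_volume_ge_inradius:
  assumes "generator G" "inradius G \<le> \<epsilon>"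
  shows "parallel_volume G \<epsilon> = measure lebesgue G"
proof -
  have "inner_parallel G \<epsilon> = G" using infdist_le_inradius[OF assms(1)] assms(2) unfolding inner_parallel_def
    by (auto intro: order_trans)
  then show ?thesis by (simp add: parallel_volume_def)
qed

lemma parallel_volume_spray:
  fixes G :: "'a::euclidean_space set"
  assumes spray: "fractal_spray l G Gs" and summ: "summable (\<lambda>j. l j ^ DIM('a))"
  shows "(\<lambda>j. l j ^ DIM('a) * parallel_volume G (\<epsilon> / l j)) sums parallel_volume (\<Union>j. Gs j) \<epsilon>"
proof -
  have generator_G: "generator G" and disj: "disjoint_family Gs" and op: "\<And>j. open (Gs j)" and bd: "\<And>j. bounded (Gs j)"
    and ex: "\<And>j. \<exists>\<Psi>. similarity (l j) \<Psi> \<and> Gs j = \<Psi> ` G" and l_pos: "\<And>j. l j > 0"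
    using spray by (auto simp: fractal_spray_def fractal_string_def)
  have G: "open G" "bounded G" using generator_G by (auto simp: generator_def)
  have pv: "parallel_volume (Gs j) \<epsilon> = l j ^ DIM('a) * parallel_volume G (\<epsilon> / l j)" for j
    using ex[of j] parallel_volume_similarity[OF _ G, of "l j" _ \<epsilon>] bd[of j] by auto
  have le: "parallel_volume G \<delta> \<le> measure lebesgue G" for \<delta>
    unfolding parallel_volume_def using inner_parallel_lmeasurable[OF G] G
    by (intro measure_mono_fmeasurable) (auto simp: inner_parallel_def lmeasurable_open)
  have disj': "inner_parallel (Gs i) \<epsilon> \<inter> inner_parallel (Gs j) \<epsilon> = {}" if "i \<noteq> j" for i j
    using disj that by (auto simp: inner_parallel_def disjoint_family_on_def)
  have "(\<lambda>j. measure lebesgue (inner_parallel (Gs j) \<epsilon>)) sums measure lebesgue (\<Union>j. inner_parallel (Gs j) \<epsilon>)"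
  proof (rule measure_countable_negligible_Union)
    show "inner_parallel (Gs n) \<epsilon> \<in> lmeasurable" for n by (rule inner_parallel_lmeasurable[OF op bd])
    show "pairwise (\<lambda>m n. negligible (inner_parallel (Gs m) \<epsilon> \<inter> inner_parallel (Gs n) \<epsilon>)) UNIV"
      using disj' by (auto simp: pairwise_def)
    fix n
    have "(\<Sum>k\<le>n. measure lebesgue (inner_parallel (Gs k) \<epsilon>)) = (\<Sum>k\<le>n. l k ^ DIM('a) * parallel_volume G (\<epsilon> / l k))"
      using pv by (simp add: parallel_volume_def)
    also have "\<dots> \<le> (\<Sum>k\<le>n. l k ^ DIM('a) * measure lebesgue G)"
      using le l_pos by (intro sum_mono mult_left_mono) (auto simp: less_imp_le)
    also have "\<dots> \<le> (\<Sum>k. l k ^ DIM('a) * measure lebesgue G)"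
      using l_pos by (intro sum_le_suminf summable_mult2 summ) (auto simp: less_imp_le)
    finally show "(\<Sum>k\<le>n. measure lebesgue (inner_parallel (Gs k) \<epsilon>)) \<le> (\<Sum>k. l k ^ DIM('a) * measure lebesgue G)" .
  qed
  then show ?thesis
    using inner_parallel_UN[OF op bd disj, of \<epsilon>] pv by (simp add: parallel_volume_def)
qed

section \<open>Differentiability of Lipschitz functions\<close>

text \<open>
  If every point of \<open>E\<close> lies in arbitrarily short intervals on which \<open>F\<close> grows with slope at most \<open>p\<close>,
  then \<open>F\<close> enlarges the measure of \<open>E\<close> at most by the factor \<open>p\<close>.
\<close>

lemma emeasure_image_slow:
  fixes F :: "real \<Rightarrow> real"
  assumes mono: "strict_mono F" and lip: "L-lipschitz_on UNIV F"
    and E: "E \<in> sets lebesgue"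
    and slow: "\<And>x d. x \<in> E \<Longrightarrow> 0 < d \<Longrightarrow> \<exists>u v. u < v \<and> u \<le> x \<and> x \<le> v \<and> v - u < d \<and> F v - F u \<le> p * (v - u)"
  shows "emeasure lebesgue (F ` E) \<le> ennreal p * emeasure lebesgue E"
proof -
  have "emeasure lebesgue (F ` E) \<le> ennreal p * emeasure lebesgue E + ennreal p * ennreal e" if "e > 0" for e
  proof -
    obtain U where U: "open U" "E \<subseteq> U" "U - E \<in> lmeasurable" "emeasure lebesgue (U - E) < ennreal e"
      using sets_lebesgue_outer_open[OF E \<open>e > 0\<close>] by blast
    \<comment> \<open>the index of an interval is the pair of its endpoints; the covering theorem asks for closed balls\<close>
    define K where "K = {(u,v). u < v \<and> {u..v} \<subseteq> U \<and> F v - F u \<le> p * (v - u)}"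
    define a :: "real \<times> real \<Rightarrow> real" where "a = (\<lambda>i. (fst i + snd i) / 2)"
    define r :: "real \<times> real \<Rightarrow> real" where "r = (\<lambda>i. (snd i - fst i) / 2)"
    have cb: "cball (a i) (r i) = {fst i..snd i}" for i
      by (auto simp: a_def r_def cball_eq_atLeastAtMost field_simps)
    have cov: "\<exists>i. i \<in> K \<and> x \<in> cball (a i) (r i) \<and> r i < d" if x: "x \<in> E" "0 < d" for x d
    proof -
      obtain \<delta> where \<delta>: "\<delta> > 0" "ball x \<delta> \<subseteq> U" using openE[OF U(1), of x] U(2) x(1) by (metis subsetD)
      then obtain u v where uv: "u < v" "u \<le> x" "x \<le> v" "v - u < min \<delta> d" "F v - F u \<le> p * (v - u)"
        using slow[OF x(1), of "min \<delta> d"] x(2) by auto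
      have "{u..v} \<subseteq> ball x \<delta>" using uv by (auto simp: dist_real_def)
      then have "(u,v) \<in> K" using uv \<delta> by (auto simp: K_def)
      moreover have "x \<in> cball (a (u,v)) (r (u,v))" using uv by (simp add: cb)
      moreover have "r (u,v) < d" using uv by (auto simp: r_def)
      ultimately show ?thesis by blast
    qed
    have rpos: "0 < r i" if "i \<in> K" for i using that by (auto simp: K_def r_def)
    obtain C where C: "countable C" "C \<subseteq> K"
       "pairwise (\<lambda>i j. disjnt (cball (a i) (r i)) (cball (a j) (r j))) C"
       "negligible (E - (\<Union>i\<in>C. cball (a i) (r i)))"
      by (rule Vitali_covering_theorem_cballs[of K r E a, OF rpos cov])
    define I where "I = (\<lambda>i::real\<times>real. {fst i..snd i})"
    have disj: "disjoint_family_on I C"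
      using C(3) by (auto simp: disjoint_family_on_def pairwise_def disjnt_def cb I_def)
    have FI: "F ` I i \<subseteq> {F (fst i)..F (snd i)}" for i
      using strict_mono_mono[OF mono] by (auto simp: I_def mono_def)
    have cont: "continuous_on A F" for A
      using lipschitz_on_continuous_on[OF lip] continuous_on_subset by blast
    have Iset: "F ` I i \<in> sets lebesgue" for i
      using compact_continuous_image[OF cont, of "I i"] unfolding I_def
      by (intro lmeasurable_compact fmeasurableD) auto
    have disjF: "disjoint_family_on (\<lambda>i. F ` I i) C"
      using disj by (simp add: disjoint_family_on_def flip: image_Int[OF strict_mono_imp_inj_on[OF mono]])
    have neg: "negligible (F ` (E - (\<Union>i\<in>C. I i)))"
    proof (rule negligible_locally_Lipschitz_image)
      show "negligible (E - (\<Union>i\<in>C. I i))" using C(4) by (simp add: cb I_def)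
      show "\<exists>T B. open T \<and> x \<in> T \<and> (\<forall>y\<in>(E - (\<Union>i\<in>C. I i)) \<inter> T. norm (F y - F x) \<le> B * norm (y - x))" for x
        using lipschitz_onD[OF lip] by (intro exI[of _ UNIV] exI[of _ L]) (auto simp: dist_norm)
    qed simp
    have setU: "(\<Union>i\<in>C. F ` I i) \<in> sets lebesgue"
      using Iset by (intro sets.countable_UN''[OF C(1)]) auto
    have setN: "F ` (E - (\<Union>i\<in>C. I i)) \<in> sets lebesgue"
      using neg by (rule negligible_imp_sets)
    have "emeasure lebesgue (F ` E) \<le> emeasure lebesgue ((\<Union>i\<in>C. F ` I i) \<union> F ` (E - (\<Union>i\<in>C. I i)))"
      by (rule emeasure_mono) (blast, use setU setN in blast)
    also have "\<dots> \<le> emeasure lebesgue (\<Union>i\<in>C. F ` I i) + emeasure lebesgue (F ` (E - (\<Union>i\<in>C. I i)))"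
      by (rule emeasure_subadditive[OF setU setN])
    also have "emeasure lebesgue (F ` (E - (\<Union>i\<in>C. I i))) = 0"
      using neg setN negligible_iff_emeasure0 by blast
    also have "emeasure lebesgue (\<Union>i\<in>C. F ` I i) = (\<integral>\<^sup>+i. emeasure lebesgue (F ` I i) \<partial>count_space C)"
      by (rule emeasure_UN_countable) (use Iset C(1) disjF in auto)
    also have "\<dots> \<le> (\<integral>\<^sup>+i. ennreal p * emeasure lebesgue (I i) \<partial>count_space C)"
    proof (rule nn_integral_mono)
      fix i assume "i \<in> space (count_space C)"
      then have i: "fst i < snd i" "F (snd i) - F (fst i) \<le> p * (snd i - fst i)"
        using C(2) by (auto simp: K_def)
      have "emeasure lebesgue (F ` I i) \<le> emeasure lebesgue {F (fst i)..F (snd i)}"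
        by (rule emeasure_mono[OF FI]) auto
      also have "\<dots> = ennreal (F (snd i) - F (fst i))" 
        using strict_monoD[OF mono i(1)] by simp
      also have "\<dots> \<le> ennreal (p * (snd i - fst i))" using i by (intro ennreal_leI)
      also have "\<dots> = ennreal p * emeasure lebesgue (I i)" using i
        by (simp add: I_def ennreal_mult'')
      finally show "emeasure lebesgue (F ` I i) \<le> ennreal p * emeasure lebesgue (I i)" .
    qed
    also have "\<dots> = ennreal p * (\<integral>\<^sup>+i. emeasure lebesgue (I i) \<partial>count_space C)"
      by (rule nn_integral_cmult) auto
    also have "(\<integral>\<^sup>+i. emeasure lebesgue (I i) \<partial>count_space C) = emeasure lebesgue (\<Union>i\<in>C. I i)"
      by (rule emeasure_UN_countable[symmetric]) (use C(1) disj in \<open>auto simp: I_def\<close>)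
    also have "emeasure lebesgue (\<Union>i\<in>C. I i) \<le> emeasure lebesgue U"
      by (rule emeasure_mono) (use C(2) U(1) in \<open>auto simp: K_def I_def subset_iff\<close>)
    also have "emeasure lebesgue U \<le> emeasure lebesgue E + emeasure lebesgue (U - E)"
      using emeasure_subadditive[of E lebesgue "U - E"] E U by (simp add: Un_absorb1)
    also have "\<dots> \<le> emeasure lebesgue E + ennreal e" using U(4) by (intro add_left_mono) auto
    finally show ?thesis by (simp add: distrib_left mult_left_mono)
  qed
  note * = this
  show ?thesis
  proof (cases "p \<le> 0")
    case True
    then show ?thesis using *[of 1] by (simp add: ennreal_neg)
  next
    case False
    show ?thesis
    proof (rule ennreal_le_epsilon)
      fix e :: real assume "e > 0"
      then show "emeasure lebesgue (F ` E) \<le> ennreal p * emeasure lebesgue E + ennreal e"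
        using *[of "e / p"] False by (simp add: ennreal_mult'[symmetric])
    qed
  qed
qed

text \<open>
  A bounded function without limit at \<open>0\<close> oscillates across some interval with rational endpoints.
\<close>

lemma no_limit_oscillates:
  fixes D :: "real \<Rightarrow> real"
  assumes bd: "\<And>h. \<bar>D h\<bar> \<le> B" and nc: "\<not> (\<exists>l. (D \<longlongrightarrow> l) (at 0))"
  obtains p q where "p \<in> \<rat>" "q \<in> \<rat>" "p < q" "\<exists>\<^sub>F h in at 0. D h < p" "\<exists>\<^sub>F h in at 0. q < D h"
proof -
  let ?d = "\<lambda>h. ereal (D h)"
  have "Liminf (at 0) ?d \<le> Limsup (at 0) ?d" by (rule Liminf_le_Limsup) simp
  moreover have "Liminf (at 0) ?d \<noteq> Limsup (at 0) ?d"
  proof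
    assume eq: "Liminf (at 0) ?d = Limsup (at 0) ?d"
    have "ereal (-B) \<le> Liminf (at 0) ?d"
      by (rule Liminf_bounded) (use bd in \<open>auto intro!: always_eventually simp: abs_le_iff minus_le_iff\<close>)
    moreover have "Limsup (at 0) ?d \<le> ereal B"
      by (rule Limsup_bounded) (use bd in \<open>auto intro!: always_eventually simp: abs_le_iff\<close>)
    ultimately obtain l where "Limsup (at 0) ?d = ereal l" using eq by (cases "Limsup (at 0) ?d") auto
    then have "(?d \<longlongrightarrow> ereal l) (at 0)" using eq by (subst tendsto_iff_Liminf_eq_Limsup) auto
    then show False using nc by (auto simp: lim_ereal)
  qed
  ultimately have lt: "Liminf (at 0) ?d < Limsup (at 0) ?d" by simp
  then obtain p' where p': "Liminf (at 0) ?d < ereal p'" "ereal p' < Limsup (at 0) ?d"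
    using ereal_dense2 by blast
  obtain q' where q': "ereal p' < ereal q'" "ereal q' < Limsup (at 0) ?d"
    using ereal_dense2[OF p'(2)] by blast
  obtain m where m: "p' < m" "m < q'" using q' dense by auto
  obtain p where p: "p \<in> \<rat>" "p' < p" "p < m" using Rats_dense_in_real[OF m(1)] by auto
  obtain q where q: "q \<in> \<rat>" "m < q" "q < q'" using Rats_dense_in_real[OF m(2)] by auto
  show thesis
  proof (rule that[of p q])
    show "\<exists>\<^sub>F h in at 0. D h < p"
    proof (rule ccontr)
      assume "\<not> ?thesis"
      then have "\<forall>\<^sub>F h in at 0. ereal p \<le> ?d h" by (simp add: not_frequently not_less)
      then have "ereal p \<le> Liminf (at 0) ?d" by (rule Liminf_bounded)
      then show False using p' p by (metis ereal_less_eq(3) leD less_eq_real_def order.strict_trans1)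
    qed
    show "\<exists>\<^sub>F h in at 0. q < D h"
    proof (rule ccontr)
      assume "\<not> ?thesis"
      then have "\<forall>\<^sub>F h in at 0. ?d h \<le> ereal q" by (simp add: not_frequently not_less)
      then have "Limsup (at 0) ?d \<le> ereal q" by (rule Limsup_bounded)
      then show False using q' q by (metis ereal_less_eq(3) leD less_eq_real_def order.strict_trans1)
    qed
  qed (use p q in auto)
qed

text \<open>
  Adding a linear function turns \<open>S\<close> into a strictly increasing bi-Lipschitz function \<open>F\<close>. Where it is not
  differentiable, its difference quotients are frequently below \<open>p\<close> and frequently above \<open>q\<close> for some
  rational \<open>0 < p < q\<close>. On a bounded set \<open>E\<close> of such points, \<open>emeasure_image_slow\<close> applied to \<open>F\<close> bounds the
  measure of \<open>F ` E\<close> by \<open>p\<close> times the measure of \<open>E\<close>, and applied to the inverse of \<open>F\<close> it bounds the measure of \<open>E\<close> by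
  \<open>1 / q\<close> times the measure of \<open>F ` E\<close>. Hence \<open>E\<close> is a null set.
\<close>

lemma negligible_not_differentiable_lipschitz:
  fixes S :: "real \<Rightarrow> real"
  assumes S: "K-lipschitz_on UNIV S"
  shows "negligible {x. \<not> S differentiable at x}"
proof -
  have K0: "K \<ge> 0" using lipschitz_on_nonneg[OF S] .
  define F where "F = (\<lambda>x. S x + (K + 1) * x)"
  define D where "D = (\<lambda>x h. (F (x + h) - F x) / h)"
  have Sd: "\<bar>S u - S v\<bar> \<le> K * \<bar>u - v\<bar>" for u v
    using lipschitz_onD[OF S, of u v] by (simp add: dist_real_def)
  have F1: "v - u \<le> F v - F u" and F2: "F v - F u \<le> (2*K+1) * (v - u)" if "u \<le> v" for u v
    using Sd[of u v] that by (auto simp: F_def algebra_simps abs_if split: if_splits)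
  have mono: "strict_mono F"
  proof (rule strict_monoI)
    fix x y :: real assume "x < y"
    then show "F x < F y" using F1[of x y] by simp
  qed
  have Flip: "(2*K+1)-lipschitz_on UNIV F"
  proof (rule lipschitz_onI)
    fix x y show "dist (F x) (F y) \<le> (2*K+1) * dist x y"
      using F1[of x y] F2[of x y] F1[of y x] F2[of y x] by (cases "x \<le> y") (auto simp: dist_real_def)
  qed (use K0 in auto)
  have Fcont: "continuous_on UNIV F" by (rule lipschitz_on_continuous_on[OF Flip])
  have "\<exists>x. F x = y" for y
  proof -
    define R where "R = \<bar>y - F 0\<bar>"
    have R: "0 \<le> R" "F (-R) \<le> y" "y \<le> F R"
      using F1[of 0 R] F1[of "-R" 0] by (auto simp: R_def)
    show ?thesis using IVT'[of F "-R" y R] R continuous_on_subset[OF Fcont] by auto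
  qed
  then have surj: "surj F" by (metis surj_def)
  define G where "G = inv F"
  have GF: "G (F x) = x" and FG: "F (G y) = y" for x y
    using strict_mono_imp_inj_on[OF mono] surj by (auto simp: G_def surj_f_inv_f)
  have G1: "G v - G u \<le> v - u" and G0: "G u \<le> G v" if "u \<le> v" for u v
  proof -
    show "G u \<le> G v" using strict_mono_less_eq[OF mono, of "G u" "G v"] that by (simp add: FG)
    from F1[OF this] show "G v - G u \<le> v - u" by (simp add: FG)
  qed
  have Gmono: "strict_mono G"
    by (rule strict_monoI) (use G0 in \<open>metis FG less_eq_real_def order_less_irrefl\<close>)
  have Glip: "1-lipschitz_on UNIV G"
  proof (rule lipschitz_onI)
    fix x y show "dist (G x) (G y) \<le> 1 * dist x y"
      using G1[of x y] G0[of x y] G1[of y x] G0[of y x] by (cases "x \<le> y") (auto simp: dist_real_def)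
  qed auto
  have Gborel: "G \<in> borel_measurable borel"
    using lipschitz_on_continuous_on[OF Glip] by (simp add: borel_measurable_continuous_onI)
  have D1: "1 \<le> D x h" and D2: "D x h \<le> 2*K+1" if "h \<noteq> 0" for x h
    using F1[of x "x+h"] F2[of x "x+h"] F1[of "x+h" x] F2[of "x+h" x] that
    by (auto simp: D_def field_simps split: if_splits; cases "h > 0"; force simp: field_simps)+
  have freqd: "\<exists>h. h \<noteq> 0 \<and> \<bar>h\<bar> < d \<and> P h" if "\<exists>\<^sub>F h in at 0. P h" "d > 0" for P :: "real \<Rightarrow> bool" and d
    using that unfolding frequently_def eventually_at by (auto simp: dist_real_def)
  have freq: "(\<exists>\<^sub>F h in at 0. P h) \<longleftrightarrow> (\<forall>n::nat. \<exists>h. h \<noteq> 0 \<and> \<bar>h\<bar> < 1 / Suc n \<and> P h)" for P :: "real \<Rightarrow> bool"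
  proof
    assume *: "\<forall>n::nat. \<exists>h. h \<noteq> 0 \<and> \<bar>h\<bar> < 1 / Suc n \<and> P h"
    show "\<exists>\<^sub>F h in at 0. P h" unfolding frequently_def
    proof
      assume "\<forall>\<^sub>F h in at 0. \<not> P h"
      then obtain d where d: "d > 0" "\<And>h. h \<noteq> 0 \<Longrightarrow> \<bar>h\<bar> < d \<Longrightarrow> \<not> P h"
        unfolding eventually_at by (auto simp: dist_real_def)
      obtain n where "1 / Suc n < d" using nat_approx_posE[OF d(1)] by metis
      then show False using * d(2) by (meson order_less_trans)
    qed
  qed (use freqd in simp)
  \<comment> \<open>for a fixed increment the quotient is continuous, which makes the exceptional sets Borel\<close>
  have cont1: "continuous_on UNIV (\<lambda>x. D x h)" for h
    by (cases "h = 0") (auto simp: D_def intro!: continuous_intros continuous_on_compose2[OF Fcont])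
  have borel1: "{x. \<exists>\<^sub>F h in at 0. D x h < p} \<in> sets borel" for p
  proof -
    have "{x. \<exists>\<^sub>F h in at 0. D x h < p} = (\<Inter>n::nat. \<Union>h\<in>{h. h \<noteq> 0 \<and> \<bar>h\<bar> < 1 / Suc n}. {x. D x h < p})"
      unfolding freq by auto
    moreover have "open (\<Union>h\<in>{h. h \<noteq> 0 \<and> \<bar>h\<bar> < 1 / Suc n}. {x. D x h < p})" for n
      by (intro open_UN ballI open_Collect_less cont1 continuous_intros)
    ultimately show ?thesis by auto
  qed
  have borel2: "{x. \<exists>\<^sub>F h in at 0. q < D x h} \<in> sets borel" for q
  proof -
    have "{x. \<exists>\<^sub>F h in at 0. q < D x h} = (\<Inter>n::nat. \<Union>h\<in>{h. h \<noteq> 0 \<and> \<bar>h\<bar> < 1 / Suc n}. {x. q < D x h})"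
      unfolding freq by auto
    moreover have "open (\<Union>h\<in>{h. h \<noteq> 0 \<and> \<bar>h\<bar> < 1 / Suc n}. {x. q < D x h})" for n
      by (intro open_UN ballI open_Collect_less cont1 continuous_intros)
    ultimately show ?thesis by auto
  qed
  define E where "E = (\<lambda>p q (n::nat). {x. \<exists>\<^sub>F h in at 0. D x h < p} \<inter> {x. \<exists>\<^sub>F h in at 0. q < D x h} \<inter> ball 0 (real n))"
  have E: "negligible (E p q n)" if pq: "0 < p" "p < q" for p q n
  proof -
    have Eb: "E p q n \<in> sets borel" unfolding E_def by (intro sets.Int borel1 borel2) auto
    then have El: "E p q n \<in> sets lebesgue" by auto
    have "F ` E p q n = G -` E p q n \<inter> space borel" using GF FG by (auto simp: image_iff) metis
    then have FEl: "F ` E p q n \<in> sets lebesgue" using measurable_sets[OF Gborel Eb] by auto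
    have m1: "emeasure lebesgue (F ` E p q n) \<le> ennreal p * emeasure lebesgue (E p q n)"
    proof (rule emeasure_image_slow[OF mono Flip El])
      fix x d :: real assume x: "x \<in> E p q n" "d > 0"
      then obtain h where h: "h \<noteq> 0" "\<bar>h\<bar> < d" "D x h < p" using freqd[of "\<lambda>h. D x h < p" d] by (auto simp: E_def)
      show "\<exists>u v. u < v \<and> u \<le> x \<and> x \<le> v \<and> v - u < d \<and> F v - F u \<le> p * (v - u)"
      proof (cases "h > 0")
        case True then show ?thesis using h
          by (intro exI[of _ x] exI[of _ "x+h"]) (auto simp: D_def field_simps)
      next
        case False then show ?thesis using h
          by (intro exI[of _ "x+h"] exI[of _ x]) (auto simp: D_def field_simps)
      qed
    qed
    have m2: "emeasure lebesgue (G ` (F ` E p q n)) \<le> ennreal (1/q) * emeasure lebesgue (F ` E p q n)"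
    proof (rule emeasure_image_slow[OF Gmono Glip FEl])
      fix y d :: real assume y: "y \<in> F ` E p q n" "d > 0"
      then obtain x where x: "y = F x" "x \<in> E p q n" by auto
      define d' where "d' = d / (2*K+1)"
      have d': "d' > 0" using y K0 by (simp add: d'_def)
      obtain h where h: "h \<noteq> 0" "\<bar>h\<bar> < d'" "q < D x h"
        using freqd[of "\<lambda>h. q < D x h" d'] x d' by (auto simp: E_def)
      obtain u v where uv: "u < v" "u \<le> x" "x \<le> v" "v - u < d'" "q * (v - u) \<le> F v - F u"
      proof (cases "h > 0")
        case True then show ?thesis using h
          by (intro that[of x "x+h"]) (auto simp: D_def field_simps)
      next
        case False then show ?thesis using h
          by (intro that[of "x+h" x]) (auto simp: D_def field_simps)
      qed
      have "F v - F u \<le> (2*K+1) * (v - u)" using F2 uv by auto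
      also have "\<dots> < (2*K+1) * d'" using uv K0 by (intro mult_strict_left_mono) auto
      also have "\<dots> = d" using K0 by (simp add: d'_def)
      finally have "F v - F u < d" .
      moreover have "v - u \<le> (1/q) * (F v - F u)" using uv pq by (simp add: field_simps)
      ultimately show "\<exists>u v. u < v \<and> u \<le> y \<and> y \<le> v \<and> v - u < d \<and> G v - G u \<le> 1 / q * (v - u)"
        using uv x(1) strict_mono_less[OF mono] strict_mono_less_eq[OF mono]
        by (intro exI[of _ "F u"] exI[of _ "F v"]) (auto simp: GF)
    qed
    have GFE: "G ` (F ` E p q n) = E p q n" by (auto simp: GF image_iff)
    have m3: "emeasure lebesgue (E p q n) \<le> ennreal (1/q) * (ennreal p * emeasure lebesgue (E p q n))"
      using order_trans[OF m2[unfolded GFE] mult_left_mono[OF m1 zero_le]] .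
    have fin: "E p q n \<in> lmeasurable"
      by (rule bounded_set_imp_lmeasurable) (use El in \<open>auto simp: E_def intro: bounded_subset[of "ball 0 (real n)"]\<close>)
    have "ennreal (measure lebesgue (E p q n)) \<le> ennreal ((1/q) * (p * measure lebesgue (E p q n)))"
      using m3 pq ennreal_mult''[of "p * measure lebesgue (E p q n)" "1/q"] ennreal_mult''[of "measure lebesgue (E p q n)" p]
      unfolding emeasure_eq_measure2[OF fin] by (simp del: times_divide_eq_left)
    then have "measure lebesgue (E p q n) \<le> (1/q) * (p * measure lebesgue (E p q n))"
      using pq by (subst (asm) ennreal_le_iff) auto
    then have "measure lebesgue (E p q n) * (q - p) \<le> 0" using pq by (simp add: field_simps)
    then have "measure lebesgue (E p q n) = 0"
      using pq measure_nonneg[of lebesgue "E p q n"] by (simp add: mult_le_0_iff)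
    then show ?thesis using fin by (simp add: negligible_iff_measure)
  qed
  \<comment> \<open>every point of non-differentiability lies in one of countably many such sets\<close>
  define I where "I = {(p,q). p \<in> \<rat> \<and> q \<in> \<rat> \<and> 0 < p \<and> (p::real) < q}"
  have "I \<subseteq> \<rat> \<times> \<rat>" by (auto simp: I_def)
  then have cI: "countable I" by (rule countable_subset) (intro countable_SIGMA countable_rat)
  have "{x. \<not> S differentiable at x} \<subseteq> (\<Union>i\<in>I. \<Union>n. E (fst i) (snd i) n)"
  proof
    fix x assume "x \<in> {x. \<not> S differentiable at x}"
    then have nd: "\<not> S differentiable at x" by simp
    have "\<not> (\<exists>l. ((D x) \<longlongrightarrow> l) (at 0))"
    proof
      assume "\<exists>l. ((D x) \<longlongrightarrow> l) (at 0)"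
      then obtain l where "(D x \<longlongrightarrow> l) (at 0)" by blast
      then have "(F has_field_derivative l) (at x)" by (simp add: DERIV_def D_def)
      then have "((\<lambda>x. F x - (K+1)*x) has_field_derivative (l - (K+1)*1)) (at x)"
        by (intro DERIV_diff DERIV_cmult DERIV_ident)
      then have "(S has_field_derivative (l - (K+1))) (at x)" by (simp add: F_def)
      then show False using nd real_differentiable_def by blast
    qed
    moreover have "\<bar>D x h\<bar> \<le> 2*K+1" for h
      using D1[of h x] D2[of h x] K0 by (cases "h = 0") (auto simp: D_def)
    ultimately obtain p q where pq: "p \<in> \<rat>" "q \<in> \<rat>" "p < q" "\<exists>\<^sub>F h in at 0. D x h < p" "\<exists>\<^sub>F h in at 0. q < D x h"
      using no_limit_oscillates[of "D x" "2*K+1"] by metis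
    obtain h where "h \<noteq> 0" "D x h < p" using freqd[OF pq(4), of 1] by auto
    then have "p > 0" using D1[of h x] by simp
    moreover obtain n :: nat where "\<bar>x\<bar> < real n" using reals_Archimedean2 by blast
    ultimately show "x \<in> (\<Union>i\<in>I. \<Union>n. E (fst i) (snd i) n)"
      using pq by (auto simp: I_def E_def intro!: bexI[of _ "(p,q)"] exI[of _ n])
  qed
  moreover have "negligible (\<Union>i\<in>I. \<Union>n. E (fst i) (snd i) n)"
    by (intro negligible_countable_Union countable_image cI) (auto simp: I_def intro!: negligible_Union_nat E)
  ultimately show ?thesis using negligible_subset by blast
qed

lemma deriv_lipschitz_bound:
  assumes S: "K-lipschitz_on UNIV S" and d: "S differentiable (at t :: real filter)"
  shows "\<bar>deriv S t :: real\<bar> \<le> K"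
proof -
  have "((\<lambda>h. (S (t + h) - S t) / h) \<longlongrightarrow> deriv S t) (at 0)"
    using d DERIV_deriv_iff_real_differentiable[of S t] by (simp add: DERIV_def)
  then have "((\<lambda>h. \<bar>(S (t + h) - S t) / h\<bar>) \<longlongrightarrow> \<bar>deriv S t\<bar>) (at 0)" by (rule tendsto_rabs)
  moreover have "\<forall>\<^sub>F h in at 0. \<bar>(S (t + h) - S t) / h\<bar> \<le> K"
    using eventually_neq_at_within[of 0 0 UNIV]
  proof eventually_elim
    case (elim h)
    then show ?case using lipschitz_onD[OF S, of "t + h" t] by (simp add: dist_real_def field_simps)
  qed
  ultimately show ?thesis by (intro tendsto_upperbound[of _ _ "at 0"]) auto
qed

lemma has_vector_derivative_seq:
  fixes f :: "real \<Rightarrow> 'a::real_normed_vector"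
  assumes "(f has_vector_derivative f') (at x)"
  shows "(\<lambda>k. (real k + 1) *\<^sub>R (f (x + 1 / (real k + 1)) - f x)) \<longlonglongrightarrow> f'"
proof -
  have "(\<lambda>h. norm (f (x + h) - f x - h *\<^sub>R f') / norm h) \<midarrow>0\<rightarrow> 0"
    using assms unfolding has_vector_derivative_def has_derivative_at by simp
  moreover have "filterlim (\<lambda>k. 1 / (real k + 1)) (at 0) sequentially"
    unfolding filterlim_at using lim_inverse_n' 
    by (auto intro!: always_eventually real_tendsto_divide_at_top filterlim_tendsto_add_at_top filterlim_real_sequentially
       simp: add.commute[of _ 1] filterlim_at_top_mono)
  ultimately have "(\<lambda>k. norm (f (x + 1 / (real k + 1)) - f x - (1 / (real k + 1)) *\<^sub>R f') / norm (1 / (real k + 1))) \<longlonglongrightarrow> 0"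
    by (rule filterlim_compose)
  moreover have "norm (f (x + 1 / (real k + 1)) - f x - (1 / (real k + 1)) *\<^sub>R f') / norm (1 / (real k + 1))
      = norm ((real k + 1) *\<^sub>R (f (x + 1 / (real k + 1)) - f x) - f')" for k
  proof -
    have "(real k + 1) *\<^sub>R (f (x + 1 / (real k + 1)) - f x) - f' = (real k + 1) *\<^sub>R (f (x + 1 / (real k + 1)) - f x - (1 / (real k + 1)) *\<^sub>R f')"
      by (simp add: scaleR_right_diff_distrib)
    then have "norm ((real k + 1) *\<^sub>R (f (x + 1 / (real k + 1)) - f x) - f') = (real k + 1) * norm (f (x + 1 / (real k + 1)) - f x - (1 / (real k + 1)) *\<^sub>R f')"
      by simp
    then show ?thesis by (simp add: field_simps)
  qed
  ultimately show ?thesis by (simp add: tendsto_norm_zero_iff LIM_zero_iff)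
qed

text \<open>
  The integrals of the difference quotients of \<open>\<phi>\<close> converge to \<open>\<phi> b - \<phi> a\<close> by continuity, and to the integral of the
  derivative by dominated convergence, because the quotients are bounded by the Lipschitz constant.
\<close>

lemma lipschitz_fundamental_theorem_of_calculus:
  fixes \<phi> :: "real \<Rightarrow> 'a::euclidean_space"
  assumes ab: "a \<le> b" and lip: "L-lipschitz_on {a..b} \<phi>" and N: "negligible N"
    and der: "\<And>t. t \<in> {a<..<b} - N \<Longrightarrow> (\<phi> has_vector_derivative g t) (at t)"
  shows "(g has_integral \<phi> b - \<phi> a) {a..b}"
proof -
  \<comment> \<open>constant continuation beyond the interval, so that difference quotients make sense at its ends\<close>
  define \<psi> where "\<psi> = (\<lambda>t. \<phi> (max a (min b t)))"
  have L0: "L \<ge> 0" using lipschitz_on_nonneg[OF lip] .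
  have \<psi>L: "norm (\<psi> s - \<psi> t) \<le> L * \<bar>s - t\<bar>" for s t
  proof -
    have "norm (\<psi> s - \<psi> t) \<le> L * \<bar>max a (min b s) - max a (min b t)\<bar>"
      using lipschitz_onD[OF lip, of "max a (min b s)" "max a (min b t)"] ab
      by (auto simp: \<psi>_def dist_norm)
    also have "\<dots> \<le> L * \<bar>s - t\<bar>" using L0 by (intro mult_left_mono) auto
    finally show ?thesis .
  qed
  have "L-lipschitz_on UNIV \<psi>" using \<psi>L L0 by (intro lipschitz_onI) (auto simp: dist_norm)
  then have cont: "continuous_on UNIV \<psi>" by (rule lipschitz_on_continuous_on)
  obtain P where P: "\<And>x. x \<in> {a-1..b+2} \<Longrightarrow> (P has_vector_derivative \<psi> x) (at x within {a-1..b+2})"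
    using antiderivative_continuous[OF continuous_on_subset[OF cont, of "{a-1..b+2}"]] by auto
  have P': "(P has_vector_derivative \<psi> x) (at x)" if "a - 1 < x" "x < b + 2" for x
    using P[of x] that at_within_Icc_at[of "a-1" x "b+2"] by simp
  define f where "f = (\<lambda>k t. (real k + 1) *\<^sub>R (\<psi> (t + 1 / (real k + 1)) - \<psi> t))"
  define y where "y = (\<lambda>k. (real k + 1) *\<^sub>R (P (b + 1 / (real k + 1)) - P b) - (real k + 1) *\<^sub>R (P (a + 1 / (real k + 1)) - P a))"
  have "(g has_integral \<psi> b - \<psi> a) ({a<..<b} - N)"
  proof (rule has_integral_dominated_convergence)
    fix k
    have h: "0 < 1 / (real k + 1)" "1 / (real k + 1) \<le> 1" by auto
    let ?Q = "\<lambda>t. (real k + 1) *\<^sub>R (P (t + 1 / (real k + 1)) - P t)"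
    have "(f k has_integral ?Q b - ?Q a) {a..b}"
    proof (rule fundamental_theorem_of_calculus[OF ab])
      fix x assume x: "x \<in> {a..b}"
      have "((\<lambda>t. P (t + 1 / (real k + 1))) has_vector_derivative \<psi> (x + 1 / (real k + 1))) (at x)"
      proof -
        have "((\<lambda>t. t + 1 / (real k + 1)) has_vector_derivative 1) (at x)"
          by (auto intro!: derivative_eq_intros)
        moreover have "(P has_vector_derivative \<psi> (x + 1 / (real k + 1))) (at (x + 1 / (real k + 1)))"
        proof (rule P')
          have "a \<le> x" "x \<le> b" using x by auto
          then show "a - 1 < x + 1 / (real k + 1)" "x + 1 / (real k + 1) < b + 2" using h by linarith+
        qed
        ultimately show ?thesis
          using vector_diff_chain_at[of "\<lambda>t. t + 1 / (real k + 1)" 1 x P "\<psi> (x + 1 / (real k + 1))"]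
          by (simp add: o_def)
      qed
      moreover have "(P has_vector_derivative \<psi> x) (at x)" using P' x by auto
      ultimately have "(?Q has_vector_derivative f k x) (at x)"
        unfolding f_def by (intro bounded_linear.has_vector_derivative[OF bounded_linear_scaleR_right] has_vector_derivative_diff)
      then show "(?Q has_vector_derivative f k x) (at x within {a..b})"
        by (rule has_vector_derivative_at_within)
    qed
    then have "(f k has_integral y k) {a..b}" by (simp add: y_def)
    then show "(f k has_integral y k) ({a<..<b} - N)"
      by (rule has_integral_spike_set_eq[THEN iffD1, rotated 2]) (rule negligible_subset[of "N \<union> {a,b}"], use N in auto)+
    show "\<forall>x\<in>{a<..<b} - N. norm (f k x) \<le> L"
    proof
      fix x
      have "norm (f k x) = (real k + 1) * norm (\<psi> (x + 1 / (real k + 1)) - \<psi> x)" by (simp add: f_def)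
      also have "\<dots> \<le> (real k + 1) * (L * \<bar>x + 1 / (real k + 1) - x\<bar>)" by (intro mult_left_mono \<psi>L) auto
      also have "\<dots> = L" by (simp add: field_simps)
      finally show "norm (f k x) \<le> L" .
    qed
  next
    have "(\<lambda>_. L) integrable_on {a..b}" by auto
    then show "(\<lambda>_. L) integrable_on ({a<..<b} - N)"
      by (rule integrable_spike_set) (rule negligible_subset[of "N \<union> {a,b}"], use N in auto)+
  next
    show "\<forall>x\<in>{a<..<b} - N. (\<lambda>k. f k x) \<longlonglongrightarrow> g x"
    proof
      fix x assume x: "x \<in> {a<..<b} - N"
      have "(\<psi> has_vector_derivative g x) (at x)"
        by (rule has_vector_derivative_transform_within_open[OF der[OF x], of "{a<..<b}"]) (use x in \<open>auto simp: \<psi>_def max_def min_def\<close>)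
      then show "(\<lambda>k. f k x) \<longlonglongrightarrow> g x" unfolding f_def by (rule has_vector_derivative_seq)
    qed
  next
    show "y \<longlonglongrightarrow> \<psi> b - \<psi> a"
      unfolding y_def by (intro tendsto_diff has_vector_derivative_seq P') (use ab in auto)
  qed
  then have "(g has_integral \<psi> b - \<psi> a) {a..b}"
    by (rule has_integral_spike_set_eq[THEN iffD1, rotated 2]) (rule negligible_subset[of "N \<union> {a,b}"], use N in auto)+
  then show ?thesis using ab by (simp add: \<psi>_def)
qed

section \<open>Integrals along a screen\<close>

text \<open>
  The parametrisation of the screen given by \<open>S\<close>.
\<close>

definition edge :: "(real \<Rightarrow> real) \<Rightarrow> real \<Rightarrow> complex" where
  "edge S t = Complex (S t) t"

lemma edge_lipschitz:
  assumes "K-lipschitz_on UNIV S"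
  shows "(K + 1)-lipschitz_on A (edge S)"
proof (rule lipschitz_onI)
  fix x y
  have "dist (edge S x) (edge S y) \<le> \<bar>S x - S y\<bar> + \<bar>x - y\<bar>"
    using cmod_le[of "edge S x - edge S y"] by (simp add: edge_def dist_norm)
  also have "\<dots> \<le> (K + 1) * dist x y"
    using lipschitz_onD[OF assms, of x y] by (simp add: dist_real_def algebra_simps)
  finally show "dist (edge S x) (edge S y) \<le> (K + 1) * dist x y" .
qed (use lipschitz_on_nonneg[OF assms] in simp)

lemma edge_has_vector_derivative:
  assumes "S differentiable at t"
  shows "(edge S has_vector_derivative (of_real (deriv S t) + \<i>)) (at t)"
proof -
  have "(S has_real_derivative deriv S t) (at t)"
    using assms DERIV_deriv_iff_real_differentiable by blast
  then have "((\<lambda>t. of_real (S t) + of_real t * \<i>) has_vector_derivative (of_real (deriv S t) + of_real 1 * \<i>)) (at t)"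
    by (intro has_vector_derivative_add has_vector_derivative_mult_left has_vector_derivative_of_real DERIV_ident)
  moreover have "edge S = (\<lambda>t. of_real (S t) + of_real t * \<i>)"
    by (auto simp: edge_def Complex_eq mult.commute)
  ultimately show ?thesis by simp
qed

text \<open>
  On the compact screen segment a holomorphic \<open>F\<close> is Lipschitz, so that \<open>F\<close> along the screen is again a
  Lipschitz function of the parameter.
\<close>

lemma screen_FTC:
  assumes S: "K-lipschitz_on UNIV S" and ab: "a \<le> b" and op: "open \<Omega>"
    and F: "\<And>z. z \<in> \<Omega> \<Longrightarrow> (F has_field_derivative f z) (at z)"
    and sub: "\<And>t. a \<le> t \<Longrightarrow> t \<le> b \<Longrightarrow> Complex (S t) t \<in> \<Omega>"
  shows "(screen_integrand S f has_integral F (Complex (S b) b) - F (Complex (S a) a)) {a..b}"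
proof -
  have holo: "F holomorphic_on \<Omega>" using F op holomorphic_on_open by blast
  have f_eq: "deriv F z = f z" if "z \<in> \<Omega>" for z using F[OF that] by (rule DERIV_imp_deriv)
  have fcont: "continuous_on \<Omega> f"
    using holomorphic_on_imp_continuous_on[OF holomorphic_deriv[OF holo op]] f_eq
    by (simp cong: continuous_on_cong)
  have "local_lipschitz (UNIV::real set) \<Omega> (\<lambda>_::real. F)"
  proof (rule c1_implies_local_lipschitz)
    show "(F has_derivative blinfun_apply (blinfun_mult_right (f (snd (t::real,x))))) (at x)" if "x \<in> \<Omega>" for t x
      using F[OF that] by (simp add: has_field_derivative_def)
    show "continuous_on (UNIV \<times> \<Omega>) (\<lambda>p::real\<times>complex. blinfun_mult_right (f (snd p)))"
      by (intro bounded_linear.continuous_on[OF bounded_linear_blinfun_mult_right] continuous_on_compose2[OF fcont] continuous_intros) auto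
  qed (use op in auto)
  then have ll: "local_lipschitz {0::real} (edge S ` {a..b}) (\<lambda>_. F)"
    by (rule local_lipschitz_subset) (use sub in \<open>auto simp: edge_def\<close>)
  have ec: "continuous_on {a..b} (edge S)" by (rule lipschitz_on_continuous_on[OF edge_lipschitz[OF S]])
  obtain L where L: "L-lipschitz_on (edge S ` {a..b}) F"
    using local_lipschitz_compact_implies_lipschitz[OF ll compact_continuous_image[OF ec]] by auto
  have lip: "(L * (K+1))-lipschitz_on {a..b} (\<lambda>t. F (edge S t))"
    by (rule lipschitz_on_compose2[OF edge_lipschitz[OF S] L])
  have "((\<lambda>t. F (edge S t)) has_vector_derivative screen_integrand S f t) (at t)"
    if t: "t \<in> {a<..<b} - {x. \<not> S differentiable at x}" for t
  proof -
    have "(edge S has_vector_derivative (of_real (deriv S t) + \<i>)) (at t)"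
      using t by (intro edge_has_vector_derivative) auto
    moreover have "(F has_field_derivative f (edge S t)) (at (edge S t))"
      using t sub[of t] by (intro F) (auto simp: edge_def)
    ultimately have "((F \<circ> edge S) has_vector_derivative (of_real (deriv S t) + \<i>) * f (edge S t)) (at t)"
      by (rule field_vector_diff_chain_at)
    then show ?thesis by (simp add: o_def screen_integrand_def edge_def mult.commute)
  qed
  from lipschitz_fundamental_theorem_of_calculus[OF ab lip negligible_not_differentiable_lipschitz[OF S] this]
  show ?thesis by (simp add: edge_def)
qed

lemma horizontal_FTC:
  assumes sc: "s \<le> c" 
    and F: "\<And>x. s \<le> x \<Longrightarrow> x \<le> c \<Longrightarrow> (F has_field_derivative f (Complex x y)) (at (Complex x y))"
  shows "((\<lambda>x. f (Complex x y)) has_integral F (Complex c y) - F (Complex s y)) {s..c}"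
proof (rule fundamental_theorem_of_calculus[OF sc])
  fix x assume x: "x \<in> {s..c}"
  have "((\<lambda>x. Complex x y) has_vector_derivative 1) (at x)"
    unfolding Complex_eq by (auto intro!: derivative_eq_intros)
  from field_vector_diff_chain_at[OF this F[of x]] x
  show "((\<lambda>x. F (Complex x y)) has_vector_derivative f (Complex x y)) (at x within {s..c})"
    by (auto simp: o_def intro: has_vector_derivative_at_within)
qed

lemma deriv_lipschitz_measurable:
  assumes S: "K-lipschitz_on UNIV S"
  shows "(\<lambda>t. complex_of_real (deriv S t) + \<i>) \<in> borel_measurable lebesgue"
proof -
  let ?g = "screen_integrand S (\<lambda>_. 1)"
  have "?g \<in> borel_measurable (lebesgue_on {- real n..real n})" for n
  proof (rule integrable_imp_measurable)
    have "(screen_integrand S (\<lambda>_. 1) has_integral (Complex (S (real n)) (real n) - Complex (S (- real n)) (- real n))) {- real n..real n}"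
      by (rule screen_FTC[OF S, of _ _ UNIV "\<lambda>z. z"]) auto
    then show "?g integrable_on {- real n..real n}" by blast
  qed
  then have m: "(\<lambda>t. indicator {- real n..real n} t *\<^sub>R ?g t) \<in> borel_measurable lebesgue" for n
    by (subst borel_measurable_restrict_space_iff[symmetric]) auto
  have "?g \<in> borel_measurable lebesgue"
  proof (rule borel_measurable_LIMSEQ_metric[OF m])
    fix t
    have "\<forall>\<^sub>F n in sequentially. \<bar>t\<bar> \<le> real n"
      using filterlim_real_sequentially by (simp add: filterlim_at_top)
    then have "\<forall>\<^sub>F n in sequentially. indicator {- real n..real n} t *\<^sub>R ?g t = ?g t"
      by eventually_elim (auto simp: indicator_def)
    then show "(\<lambda>n. indicator {- real n..real n} t *\<^sub>R ?g t) \<longlonglongrightarrow> ?g t" by (rule tendsto_eventually)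
  qed
  then show ?thesis by (simp add: screen_integrand_def[abs_def])
qed

lemma screen_integrand_measurable:
  assumes S: "K-lipschitz_on UNIV S" and f: "continuous_on (range (edge S)) f"
  shows "screen_integrand S f \<in> borel_measurable lebesgue"
proof -
  have "continuous_on UNIV (\<lambda>t. f (edge S t))"
    by (rule continuous_on_compose2[OF f lipschitz_on_continuous_on[OF edge_lipschitz[OF S]]]) auto
  then have "(\<lambda>t. f (edge S t)) \<in> borel_measurable borel" by (rule borel_measurable_continuous_onI)
  then have "(\<lambda>t. f (edge S t)) \<in> borel_measurable lebesgue" by (intro measurable_completion) simp
  then show ?thesis using borel_measurable_times[OF _ deriv_lipschitz_measurable[OF S]]
    by (auto simp: screen_integrand_def[abs_def] edge_def)
qed

lemma AE_norm_screen_integrand_le: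
  assumes S: "K-lipschitz_on UNIV S"
  shows "AE t in lebesgue. norm (screen_integrand S f t) \<le> norm (f (Complex (S t) t)) * (K + 1)"
proof (rule AE_I')
  show "{t. \<not> S differentiable at t} \<in> null_sets lebesgue"
    using negligible_not_differentiable_lipschitz[OF S] by (simp only: negligible_iff_null_sets)
  show "{t \<in> space lebesgue. \<not> norm (screen_integrand S f t) \<le> norm (f (Complex (S t) t)) * (K + 1)} \<subseteq> {t. \<not> S differentiable at t}"
  proof (rule subsetI, rule ccontr)
    fix t assume "t \<in> {t \<in> space lebesgue. \<not> norm (screen_integrand S f t) \<le> norm (f (Complex (S t) t)) * (K + 1)}"
      "t \<notin> {t. \<not> S differentiable at t}"
    then have *: "\<not> norm (screen_integrand S f t) \<le> norm (f (Complex (S t) t)) * (K + 1)" "S differentiable at t" by auto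
    have "norm (complex_of_real (deriv S t) + \<i>) \<le> \<bar>deriv S t\<bar> + 1"
      by (rule order_trans[OF norm_triangle_ineq]) simp
    also have "\<dots> \<le> K + 1" using deriv_lipschitz_bound[OF S] * by simp
    finally show False using * by (simp add: screen_integrand_def norm_mult mult_left_mono)
  qed
qed

lemma screen_integrand_const: "screen_integrand (\<lambda>_. c) f t = f (Complex c t) * \<i>"
  by (simp add: screen_integrand_def)

text \<open>
  The bound is only assumed almost everywhere, since nothing is known about \<open>deriv S\<close> at the points
  where \<open>S\<close> is not differentiable.
\<close>

lemma has_integral_norm_bound_AE:
  fixes g :: "real \<Rightarrow> complex"
  assumes i: "(g has_integral i) {a..b}" and ab: "a \<le> b" and B: "B \<ge> 0"
    and ae: "AE t in lebesgue. t \<in> {a..b} \<longrightarrow> norm (g t) \<le> B"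
  shows "norm i \<le> B * (b - a)"
proof -
  obtain N where N: "{t. \<not> (t \<in> {a..b} \<longrightarrow> norm (g t) \<le> B)} \<subseteq> N" "N \<in> null_sets lebesgue"
    using ae by (auto elim!: AE_E simp: null_sets_def)
  have "((\<lambda>t. if t \<in> N then 0 else g t) has_integral i) {a..b}"
    by (rule has_integral_spike[OF _ _ i, of N]) (use N(2) negligible_iff_null_sets in auto)
  then have "norm i \<le> B * measure lborel {a..b}"
    by (rule has_integral_bound_real[OF B finite.emptyI]) (use N(1) B in auto)
  then show ?thesis using ab by simp
qed

lemma integrable_powr_tails:
  fixes p :: real
  assumes p: "p < -1"
  shows "integrable lborel (\<lambda>t. (1 + \<bar>t\<bar>) powr p)"
proof -
  define h where "h = (\<lambda>t::real. (1 + t) powr p * indicator {0..} t)"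
  have "(\<integral>\<^sup>+t. ennreal ((1 + t) powr p) * indicator {0..} t \<partial>lborel) = ennreal (0 - (1 + 0) powr (p + 1) / (p + 1))"
  proof (rule nn_integral_FTC_atLeast)
    show "((\<lambda>t. (1 + t) powr (p + 1) / (p + 1)) has_real_derivative (1 + t) powr p) (at t)" if "0 \<le> t" for t
    proof -
      have "((\<lambda>t. 1 + t) has_real_derivative 1) (at t)" by (auto intro!: derivative_eq_intros)
      from DERIV_chain2[OF has_real_derivative_powr[of "1 + t" "p + 1"] this] that
      have "((\<lambda>t. (1 + t) powr (p + 1)) has_real_derivative (p + 1) * (1 + t) powr p) (at t)" by simp
      from DERIV_cdivide[OF this, of "p + 1"] show ?thesis using p by simp
    qed
    have "((\<lambda>t::real. (1 + t) powr (p + 1)) \<longlongrightarrow> 0) at_top"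
      using p by (intro tendsto_neg_powr filterlim_tendsto_add_at_top[of _ 1] filterlim_ident tendsto_const) auto
    then show "((\<lambda>t::real. (1 + t) powr (p + 1) / (p + 1)) \<longlongrightarrow> 0) at_top"
      using tendsto_divide_zero by blast
  qed auto
  moreover have "(\<integral>\<^sup>+t. ennreal (norm (h t)) \<partial>lborel) = (\<integral>\<^sup>+t. ennreal ((1 + t) powr p) * indicator {0..} t \<partial>lborel)"
    by (intro nn_integral_cong) (auto simp: h_def indicator_def)
  ultimately have h: "integrable lborel h"
    by (intro integrableI_bounded) (auto simp: h_def)
  then have "integrable lborel (\<lambda>t. h (0 + (-1) * t))" by (subst lborel_integrable_real_affine_iff) auto
  then have "integrable lborel (\<lambda>t. h t + h (0 + (-1) * t))" using h by (intro Bochner_Integration.integrable_add)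
  then show ?thesis
    by (rule Bochner_Integration.integrable_bound) (auto simp: h_def indicator_def)
qed

lemma integrable_lebesgue_powr_bound:
  fixes g :: "real \<Rightarrow> complex"
  assumes p: "p < -1" and m: "g \<in> borel_measurable lebesgue" and "AE t in lebesgue. norm (g t) \<le> C * (1 + \<bar>t\<bar>) powr p"
  shows "integrable lebesgue g"
proof (rule Bochner_Integration.integrable_bound[of lebesgue "\<lambda>t. C * (1 + \<bar>t\<bar>) powr p"])
  have "integrable lborel (\<lambda>t. C * (1 + \<bar>t\<bar>) powr p)" using integrable_powr_tails[OF p] by simp
  then show "integrable lebesgue (\<lambda>t. C * (1 + \<bar>t\<bar>) powr p)"
    by (subst integrable_completion) auto
  show "AE t in lebesgue. norm (g t) \<le> norm (C * (1 + \<bar>t\<bar>) powr p)"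
    using assms(3) by eventually_elim (auto intro: order_trans abs_ge_self)
qed (rule m)

lemma integral_exhaust_line:
  fixes g :: "real \<Rightarrow> complex"
  assumes g: "integrable lebesgue g"
    and a: "filterlim a at_bot sequentially" and b: "filterlim b at_top sequentially"
  shows "(\<lambda>n. integral {a n..b n} g) \<longlonglongrightarrow> (LINT t|lebesgue. g t)"
proof -
  have "(\<lambda>n. LINT t|lebesgue. indicator {a n..b n} t *\<^sub>R g t) \<longlonglongrightarrow> (LINT t|lebesgue. g t)"
  proof (rule integral_dominated_convergence[where w="\<lambda>t. norm (g t)"])
    show "AE t in lebesgue. (\<lambda>n. indicator {a n..b n} t *\<^sub>R g t) \<longlonglongrightarrow> g t"
    proof (rule AE_I2)
      fix t
      have "\<forall>\<^sub>F n in sequentially. a n \<le> t" "\<forall>\<^sub>F n in sequentially. t \<le> b n"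
        using a b by (simp_all add: filterlim_at_bot filterlim_at_top)
      then have "\<forall>\<^sub>F n in sequentially. indicator {a n..b n} t *\<^sub>R g t = g t"
        by eventually_elim auto
      then show "(\<lambda>n. indicator {a n..b n} t *\<^sub>R g t) \<longlonglongrightarrow> g t" by (rule tendsto_eventually)
    qed
    show "AE t in lebesgue. norm (indicator {a n..b n} t *\<^sub>R g t) \<le> norm (g t)" for n
      by (auto simp: indicator_def)
    show "(\<lambda>t. indicator {a n..b n} t *\<^sub>R g t) \<in> borel_measurable lebesgue" for n
      by (intro borel_measurable_scaleR borel_measurable_indicator borel_measurable_integrable[OF g]) auto
  qed (use g in auto)
  moreover have "(LINT t|lebesgue. indicator {a n..b n} t *\<^sub>R g t) = integral {a n..b n} g" for n
  proof -
    have "set_integrable lebesgue {a n..b n} g" unfolding set_integrable_def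
      by (rule integrable_mult_indicator) (use g in auto)
    from set_lebesgue_integral_eq_integral(2)[OF this] show ?thesis by (simp add: set_lebesgue_integral_def)
  qed
  ultimately show ?thesis by simp
qed

text \<open>
  Integrals over longer and longer segments of a left ray converge, and their limit is bounded, as
  soon as the integrand decays exponentially.
\<close>

lemma left_ray_limit:
  fixes h :: "real \<Rightarrow> complex"
  assumes \<gamma>: "\<gamma> > 0" and B: "B \<ge> 0" and u: "filterlim u at_bot sequentially"
    and int: "\<And>m. m \<ge> M \<Longrightarrow> u m \<le> c \<and> h integrable_on {u m..c}"
    and bd: "\<And>x. x \<le> c \<Longrightarrow> norm (h x) \<le> B * exp (\<gamma> * x)"
  obtains L where "(\<lambda>m. integral {u m..c} h) \<longlonglongrightarrow> L" "norm L \<le> B * exp (\<gamma> * c) / \<gamma>"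
proof -
  have seg: "norm (integral {s..t} h) \<le> B * exp (\<gamma> * t) / \<gamma>" if "s \<le> t" "t \<le> c" "h integrable_on {s..t}" for s t
  proof -
    have e: "((\<lambda>x. B * exp (\<gamma> * x)) has_integral (B / \<gamma> * exp (\<gamma> * t) - B / \<gamma> * exp (\<gamma> * s))) {s..t}"
    proof (rule fundamental_theorem_of_calculus[OF that(1)])
      fix x
      have "((\<lambda>x. B / \<gamma> * exp (\<gamma> * x)) has_real_derivative B * exp (\<gamma> * x)) (at x)"
        using \<gamma> by (auto intro!: derivative_eq_intros)
      then show "((\<lambda>x. B / \<gamma> * exp (\<gamma> * x)) has_vector_derivative B * exp (\<gamma> * x)) (at x within {s..t})"
        by (simp add: has_real_derivative_iff_has_vector_derivative has_vector_derivative_at_within)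
    qed
    have "norm (integral {s..t} h) \<le> integral {s..t} (\<lambda>x. B * exp (\<gamma> * x))"
      by (rule integral_norm_bound_integral) (use that bd e in auto)
    also have "\<dots> = B / \<gamma> * exp (\<gamma> * t) - B / \<gamma> * exp (\<gamma> * s)" by (rule integral_unique[OF e])
    also have "\<dots> \<le> B * exp (\<gamma> * t) / \<gamma>" using B \<gamma> by simp
    finally show ?thesis .
  qed
  define i where "i = (\<lambda>m. integral {u m..c} h)"
  have diff: "norm (i m - i m') \<le> B * exp (\<gamma> * u m') / \<gamma>" if m: "m \<ge> M" "m' \<ge> M" "u m \<le> u m'" for m m'
  proof -
    have "i m = integral {u m..u m'} h + i m'"
      unfolding i_def by (rule Henstock_Kurzweil_Integration.integral_combine[symmetric]) (use int m in auto)
    moreover have "h integrable_on {u m..u m'}"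
      by (rule integrable_on_subinterval[of h "{u m..c}"]) (use int m in auto)
    ultimately show ?thesis using seg[of "u m" "u m'"] int[OF m(2)] m(3) by simp
  qed
  have small: "(\<lambda>m. B * exp (\<gamma> * u m) / \<gamma>) \<longlonglongrightarrow> 0"
  proof -
    have "filterlim (\<lambda>m. \<gamma> * u m) at_bot sequentially"
      using u \<gamma> by (intro filterlim_tendsto_pos_mult_at_bot[OF tendsto_const])
    then have "(\<lambda>m. exp (\<gamma> * u m)) \<longlonglongrightarrow> 0" by (rule filterlim_compose[OF exp_at_bot])
    then have "(\<lambda>m. B * exp (\<gamma> * u m) / \<gamma>) \<longlonglongrightarrow> B * 0 / \<gamma>" by (intro tendsto_intros) (use \<gamma> in auto)
    then show ?thesis by simp
  qed
  have "Cauchy i"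
  proof (rule CauchyI)
    fix e :: real assume "e > 0"
    then have "\<forall>\<^sub>F m in sequentially. B * exp (\<gamma> * u m) / \<gamma> < e" using small by (rule order_tendstoD(2)[rotated])
    then obtain N where N: "\<And>m. m \<ge> N \<Longrightarrow> B * exp (\<gamma> * u m) / \<gamma> < e" by (auto simp: eventually_sequentially)
    show "\<exists>N. \<forall>m\<ge>N. \<forall>n\<ge>N. norm (i m - i n) < e"
    proof (intro exI[of _ "max M N"] allI impI)
      fix m n assume mn: "max M N \<le> m" "max M N \<le> n"
      show "norm (i m - i n) < e"
      proof (cases "u m \<le> u n")
        case True then show ?thesis using diff[of m n] N[of n] mn by auto
      next
        case False then show ?thesis using diff[of n m] N[of m] mn by (auto simp: norm_minus_commute)
      qed
    qed
  qed
  then obtain L where L: "i \<longlonglongrightarrow> L" using Cauchy_convergent_iff convergent_def by blast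
  have "norm L \<le> B * exp (\<gamma> * c) / \<gamma>"
  proof (rule Lim_bounded[OF tendsto_norm[OF L]])
    show "\<forall>m\<ge>M. norm (i m) \<le> B * exp (\<gamma> * c) / \<gamma>"
      using seg int unfolding i_def by blast
  qed
  with L show thesis by (intro that) (simp add: i_def)
qed

section \<open>The residue theorem to the right of a screen\<close>

lemma compact_screen_region:
  assumes S: "K-lipschitz_on UNIV S"
  shows "compact {z. a \<le> Im z \<and> Im z \<le> b \<and> S (Im z) \<le> Re z \<and> Re z \<le> c}" (is "compact ?R")
proof -
  have cS: "continuous_on A (\<lambda>z. S (Im z))" for A
    by (rule continuous_on_compose2[OF lipschitz_on_continuous_on[OF S]]) (auto intro!: continuous_intros)
  have "bounded (S ` {a..b})"
    by (intro compact_imp_bounded compact_continuous_image continuous_on_subset[OF lipschitz_on_continuous_on[OF S]]) auto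
  then obtain B where B: "\<And>t. t \<in> {a..b} \<Longrightarrow> \<bar>S t\<bar> \<le> B" unfolding bounded_iff real_norm_def by blast
  have "bounded ?R" unfolding bounded_iff
  proof (intro exI ballI)
    fix z assume "z \<in> ?R"
    then have "\<bar>Re z\<bar> \<le> B + \<bar>c\<bar>" "\<bar>Im z\<bar> \<le> \<bar>a\<bar> + \<bar>b\<bar>" using B[of "Im z"] by auto
    then show "norm z \<le> (B + \<bar>c\<bar>) + (\<bar>a\<bar> + \<bar>b\<bar>)" using cmod_le[of z] by linarith
  qed
  moreover have "closed ?R"
    by (intro closed_Collect_conj closed_Collect_le continuous_intros cS)
  ultimately show ?thesis by (simp add: compact_eq_bounded_closed)
qed

lemma simply_connected_right_of_graph:
  assumes cont: "continuous_on UNIV S"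
  shows "simply_connected {z. S (Im z) - \<delta> < Re z \<and> a < Im z \<and> Im z < b}"
proof -
  define f where "f = (\<lambda>z. z - of_real (S (Im z)))"
  define g where "g = (\<lambda>z. z + of_real (S (Im z)))"
  have cS: "continuous_on A (\<lambda>z. S (Im z))" for A
    by (rule continuous_on_compose2[OF cont]) (auto intro!: continuous_intros)
  have "homeomorphism {z. S (Im z) - \<delta> < Re z \<and> a < Im z \<and> Im z < b} {z. -\<delta> < Re z \<and> a < Im z \<and> Im z < b} f g"
    by (rule homeomorphismI) (auto simp: f_def g_def intro!: continuous_intros cS)
  moreover have "convex {z. -\<delta> < Re z \<and> a < Im z \<and> Im z < b}"
  proof -
    have eq: "{z. -\<delta> < Re z \<and> a < Im z \<and> Im z < b} = {z. Re z > -\<delta>} \<inter> ({z. Im z > a} \<inter> {z. Im z < b})" by auto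
    show ?thesis unfolding eq
      by (intro convex_Int convex_halfspace_Re_gt convex_halfspace_Im_gt convex_halfspace_Im_lt)
  qed
  ultimately show ?thesis
    using homeomorphic_simply_connected_eq[OF homeomorphicI] convex_imp_simply_connected
    by (metis (no_types, lifting) homeomorphic_def homeomorphic_simply_connected_eq)
qed

text \<open>
  An open set that contains the closed region to the right of a screen between two heights, and a
  right half-plane, also contains such a region with a slightly shifted screen and larger range of
  heights. The half-plane reduces the claim to a compact region.
\<close>

lemma right_of_screen_nhd:
  assumes S: "K-lipschitz_on UNIV S" and ab: "a < b" and U: "open U"
    and sub: "{z. a \<le> Im z \<and> Im z \<le> b \<and> S (Im z) \<le> Re z} \<subseteq> U" and right: "{z. c \<le> Re z} \<subseteq> U"
  obtains \<delta> where "\<delta> > 0" "{z. S (Im z) - \<delta> < Re z \<and> a - \<delta> < Im z \<and> Im z < b + \<delta>} \<subseteq> U"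
proof -
  have K0: "K \<ge> 0" using lipschitz_on_nonneg[OF S] .
  have "\<exists>\<delta>>0. \<delta> \<le> 1 \<and> {z. S (Im z) - \<delta> < Re z \<and> a - \<delta> < Im z \<and> Im z < b + \<delta>} \<subseteq> U"
  proof (cases "U = UNIV")
    case False
    have "bounded (S ` {a..b})"
      by (intro compact_imp_bounded compact_continuous_image continuous_on_subset[OF lipschitz_on_continuous_on[OF S]]) auto
    then obtain B where B: "\<And>t. t \<in> {a..b} \<Longrightarrow> \<bar>S t\<bar> \<le> B" unfolding bounded_iff real_norm_def by blast
    define c' where "c' = max c B"
    define R where "R = {z. a \<le> Im z \<and> Im z \<le> b \<and> S (Im z) \<le> Re z \<and> Re z \<le> c'}"
    have "compact R" unfolding R_def by (rule compact_screen_region[OF S])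
    moreover have "R \<inter> - U = {}" using sub by (auto simp: R_def)
    ultimately obtain d where d: "d > 0" "\<And>x y. x \<in> R \<Longrightarrow> y \<in> -U \<Longrightarrow> d \<le> dist x y"
      using separate_compact_closed[of R "-U"] U unfolding closed_def double_complement by blast
    define \<delta> where "\<delta> = min 1 (d / (2 * (K + 3)))"
    have \<delta>: "\<delta> > 0" "\<delta> \<le> 1" using d K0 by (auto simp: \<delta>_def)
    have "\<delta> * (K + 3) \<le> d / (2 * (K + 3)) * (K + 3)" using K0 by (intro mult_right_mono) (auto simp: \<delta>_def)
    also have "\<dots> < d" using d(1) K0 mult_nonneg_nonneg[of K d] by (simp add: field_simps add_nonneg_pos)
    finally have \<delta>d: "\<delta> * (K + 3) < d" .
    have "z \<in> U" if z: "S (Im z) - \<delta> < Re z" "a - \<delta> < Im z" "Im z < b + \<delta>" for z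
    proof (rule ccontr)
      assume zU: "z \<notin> U"
      then have zc: "Re z < c" using right by (meson mem_Collect_eq not_less subsetD)
      \<comment> \<open>the point of the compact region next to \<open>z\<close>: first clamp the height, then the real part\<close>
      define y where "y = max a (min b (Im z))"
      define x where "x = max (S y) (Re z)"
      have y: "a \<le> y" "y \<le> b" "\<bar>y - Im z\<bar> < \<delta>" using z ab \<delta> by (auto simp: y_def)
      have "\<bar>S y - S (Im z)\<bar> \<le> K * \<bar>y - Im z\<bar>" using lipschitz_onD[OF S, of y "Im z"] by (simp add: dist_real_def)
      also have "\<dots> \<le> K * \<delta>" using y K0 by (intro mult_left_mono) auto
      finally have Sy: "\<bar>S y - S (Im z)\<bar> \<le> K * \<delta>" .
      have x: "\<bar>x - Re z\<bar> \<le> K * \<delta> + \<delta>" using Sy z \<delta> K0 by (auto simp: x_def max_def)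
      have "S y \<le> c'" "Re z \<le> c'" using B[of y] y zc by (auto simp: c'_def)
      then have "Complex x y \<in> R" using y by (auto simp: R_def x_def)
      then have "d \<le> dist (Complex x y) z" using d zU by auto
      also have "\<dots> \<le> \<bar>x - Re z\<bar> + \<bar>y - Im z\<bar>" using cmod_le[of "Complex x y - z"] by (simp add: dist_norm)
      also have "\<dots> \<le> \<delta> * (K + 3)" using x y \<delta> by (simp add: algebra_simps)
      finally show False using \<delta>d by simp
    qed
    then show ?thesis using \<delta> by (intro exI[of _ \<delta>]) auto
  qed (auto intro!: exI[of _ 1])
  then show thesis using that by blast
qed

text \<open>
  \<open>v\<close> is the integral of \<open>f\<close> over the positively oriented boundary of the region between the screen
  \<open>S\<close> and the line \<open>Re s = c\<close>, and between the heights \<open>a\<close> and \<open>b\<close>. The vertical line is treated as a screen with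
  constant \<open>S\<close>.
\<close>

definition has_boundary_integral ::
    "real \<Rightarrow> real \<Rightarrow> real \<Rightarrow> (real \<Rightarrow> real) \<Rightarrow> (complex \<Rightarrow> complex) \<Rightarrow> complex \<Rightarrow> bool" where
  "has_boundary_integral a b c S f v \<longleftrightarrow> (\<exists>i1 i2 i3 i4.
     ((\<lambda>x. f (Complex x a)) has_integral i1) {S a..c} \<and>
     (screen_integrand (\<lambda>_. c) f has_integral i2) {a..b} \<and>
     ((\<lambda>x. f (Complex x b)) has_integral i3) {S b..c} \<and>
     (screen_integrand S f has_integral i4) {a..b} \<and> v = i1 + i2 - i3 - i4)"

lemma has_boundary_integralI:
  assumes "((\<lambda>x. f (Complex x a)) has_integral i1) {S a..c}"
     "(screen_integrand (\<lambda>_. c) f has_integral i2) {a..b}"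
     "((\<lambda>x. f (Complex x b)) has_integral i3) {S b..c}"
     "(screen_integrand S f has_integral i4) {a..b}" "v = i1 + i2 - i3 - i4"
  shows "has_boundary_integral a b c S f v"
  using assms unfolding has_boundary_integral_def by blast

lemma has_boundary_integral_add:
  assumes "has_boundary_integral a b c S f v" "has_boundary_integral a b c S g w"
  shows "has_boundary_integral a b c S (\<lambda>z. f z + g z) (v + w)"
proof -
  obtain i1 i2 i3 i4 where i: "((\<lambda>x. f (Complex x a)) has_integral i1) {S a..c}"
     "(screen_integrand (\<lambda>_. c) f has_integral i2) {a..b}"
     "((\<lambda>x. f (Complex x b)) has_integral i3) {S b..c}"
     "(screen_integrand S f has_integral i4) {a..b}" "v = i1 + i2 - i3 - i4"
    using assms(1) unfolding has_boundary_integral_def by blast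
  obtain j1 j2 j3 j4 where j: "((\<lambda>x. g (Complex x a)) has_integral j1) {S a..c}"
     "(screen_integrand (\<lambda>_. c) g has_integral j2) {a..b}"
     "((\<lambda>x. g (Complex x b)) has_integral j3) {S b..c}"
     "(screen_integrand S g has_integral j4) {a..b}" "w = j1 + j2 - j3 - j4"
    using assms(2) unfolding has_boundary_integral_def by blast
  have e: "screen_integrand S (\<lambda>z. f z + g z) = (\<lambda>t. screen_integrand S f t + screen_integrand S g t)" for S
    by (auto simp: screen_integrand_def algebra_simps)
  show ?thesis
    by (rule has_boundary_integralI[of _ _ "i1+j1" _ _ "i2+j2" _ "i3+j3" "i4+j4"])
       (use i j in \<open>auto simp: e intro!: has_integral_add\<close>)
qed

lemma has_boundary_integral_cmult:
  assumes "has_boundary_integral a b c S f v"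
  shows "has_boundary_integral a b c S (\<lambda>z. k * f z) (k * v)"
proof -
  obtain i1 i2 i3 i4 where i: "((\<lambda>x. f (Complex x a)) has_integral i1) {S a..c}"
     "(screen_integrand (\<lambda>_. c) f has_integral i2) {a..b}"
     "((\<lambda>x. f (Complex x b)) has_integral i3) {S b..c}"
     "(screen_integrand S f has_integral i4) {a..b}" "v = i1 + i2 - i3 - i4"
    using assms(1) unfolding has_boundary_integral_def by blast
  have e: "screen_integrand S (\<lambda>z. k * f z) = (\<lambda>t. k * screen_integrand S f t)" for S
    by (auto simp: screen_integrand_def algebra_simps)
  show ?thesis
    by (rule has_boundary_integralI[of _ _ "k*i1" _ _ "k*i2" _ "k*i3" "k*i4"])
       (use i in \<open>auto simp: e right_diff_distrib distrib_left intro!: has_integral_mult_right\<close>)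
qed

lemma has_boundary_integral_sum:
  assumes "finite A" "\<And>k. k \<in> A \<Longrightarrow> has_boundary_integral a b c S (f k) (v k)"
  shows "has_boundary_integral a b c S (\<lambda>z. \<Sum>k\<in>A. f k z) (\<Sum>k\<in>A. v k)"
  using assms
proof (induction A rule: finite_induct)
  case empty
  show ?case by (rule has_boundary_integralI[where ?i1.0=0 and ?i2.0=0 and ?i3.0=0 and ?i4.0=0]) (auto simp: screen_integrand_def[abs_def])
next
  case (insert x F)
  then show ?case by (auto intro: has_boundary_integral_add)
qed

lemma has_boundary_integral_cong:
  assumes "has_boundary_integral a b c S f v"
    and "\<And>x. S a \<le> x \<Longrightarrow> x \<le> c \<Longrightarrow> f (Complex x a) = g (Complex x a)"
    and "\<And>x. S b \<le> x \<Longrightarrow> x \<le> c \<Longrightarrow> f (Complex x b) = g (Complex x b)"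
    and "\<And>t. a \<le> t \<Longrightarrow> t \<le> b \<Longrightarrow> f (Complex (S t) t) = g (Complex (S t) t)"
    and "\<And>t. a \<le> t \<Longrightarrow> t \<le> b \<Longrightarrow> f (Complex c t) = g (Complex c t)"
  shows "has_boundary_integral a b c S g v"
proof -
  obtain i1 i2 i3 i4 where i: "((\<lambda>x. f (Complex x a)) has_integral i1) {S a..c}"
     "(screen_integrand (\<lambda>_. c) f has_integral i2) {a..b}"
     "((\<lambda>x. f (Complex x b)) has_integral i3) {S b..c}"
     "(screen_integrand S f has_integral i4) {a..b}" "v = i1 + i2 - i3 - i4"
    using assms(1) unfolding has_boundary_integral_def by blast
  show ?thesis
    by (rule has_boundary_integralI[of _ _ i1 _ _ i2 _ i3 i4];
        (rule has_integral_eq[rotated, OF i(1)] has_integral_eq[rotated, OF i(2)] 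
          has_integral_eq[rotated, OF i(3)] has_integral_eq[rotated, OF i(4)] i(5)))
       (use assms(2-) in \<open>auto simp: screen_integrand_def\<close>)
qed

lemma has_boundary_integral_primitive:
  assumes S: "K-lipschitz_on UNIV S" and ab: "a \<le> b" and "S a \<le> c" "S b \<le> c" and op: "open \<Omega>"
    and F: "\<And>z. z \<in> \<Omega> \<Longrightarrow> (F has_field_derivative f z) (at z)"
    and sub1: "\<And>x. S a \<le> x \<Longrightarrow> x \<le> c \<Longrightarrow> Complex x a \<in> \<Omega>"
    and sub2: "\<And>x. S b \<le> x \<Longrightarrow> x \<le> c \<Longrightarrow> Complex x b \<in> \<Omega>"
    and sub3: "\<And>t. a \<le> t \<Longrightarrow> t \<le> b \<Longrightarrow> Complex (S t) t \<in> \<Omega> \<and> Complex c t \<in> \<Omega>"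
  shows "has_boundary_integral a b c S f 0"
  by (rule has_boundary_integralI[OF horizontal_FTC screen_FTC[OF _ ab op] horizontal_FTC screen_FTC[OF S ab op]])
     (use assms in \<open>auto intro: F lipschitz_on_constant\<close>)

text \<open>
  On the screen \<open>Ln (p - z)\<close> is a primitive, on the other three edges \<open>Ln (z - p)\<close> is. The two branches
  differ by \<open>\<i> * pi\<close> at the upper left corner and by \<open>- \<i> * pi\<close> at the lower left corner.
\<close>

lemma has_boundary_integral_inverse:
  assumes S: "K-lipschitz_on UNIV S" and p: "a < Im p" "Im p < b" "S (Im p) < Re p" "Re p < c" and "S a \<le> c" "S b \<le> c"
  shows "has_boundary_integral a b c S (\<lambda>z. 1 / (z - p)) (2 * of_real pi * \<i>)"
proof -
  define \<Omega>1 where "\<Omega>1 = {z. z - p \<notin> \<real>\<^sub>\<le>\<^sub>0}"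
  define \<Omega>2 where "\<Omega>2 = {z. p - z \<notin> \<real>\<^sub>\<le>\<^sub>0}"
  define F1 where "F1 = (\<lambda>z. Ln (z - p))"
  define F2 where "F2 = (\<lambda>z. Ln (p - z))"
  have "\<Omega>1 = (\<lambda>z. z - p) -` (- \<real>\<^sub>\<le>\<^sub>0)" "\<Omega>2 = (\<lambda>z. p - z) -` (- \<real>\<^sub>\<le>\<^sub>0)" by (auto simp: \<Omega>1_def \<Omega>2_def)
  then have op: "open \<Omega>1" "open \<Omega>2"
    by (auto intro!: open_vimage continuous_intros simp: closed_nonpos_Reals_complex)
  have F1: "(F1 has_field_derivative 1 / (z - p)) (at z)" if "z \<in> \<Omega>1" for z
    using that unfolding F1_def \<Omega>1_def by (auto intro!: derivative_eq_intros simp: inverse_eq_divide)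
  have F2: "(F2 has_field_derivative 1 / (z - p)) (at z)" if "z \<in> \<Omega>2" for z
    using that unfolding F2_def \<Omega>2_def 
    by (auto intro!: derivative_eq_intros simp: divide_simps)
  have h: "Complex x y \<in> \<Omega>1" if "y \<noteq> Im p \<or> x > Re p" for x y
    using that by (auto simp: \<Omega>1_def complex_nonpos_Reals_iff)
  have s: "Complex (S t) t \<in> \<Omega>2" for t
    using p by (auto simp: \<Omega>2_def complex_nonpos_Reals_iff)
  have ab: "a \<le> b" using p by simp
  have L1: "F1 (Complex (S b) b) = F2 (Complex (S b) b) + \<i> * pi"
  proof -
    have "Im (p - Complex (S b) b) < 0" using p by simp
    moreover have "p \<noteq> Complex (S b) b" using p by (metis complex.sel(2) less_irrefl)
    ultimately show ?thesis using Ln_minus[of "p - Complex (S b) b"] by (auto simp: F1_def F2_def)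
  qed
  have L2: "F1 (Complex (S a) a) = F2 (Complex (S a) a) - \<i> * pi"
  proof -
    have "Im (p - Complex (S a) a) > 0" using p by simp
    moreover have "p \<noteq> Complex (S a) a" using p by (metis complex.sel(2) less_irrefl)
    ultimately show ?thesis using Ln_minus[of "p - Complex (S a) a"] by (auto simp: F1_def F2_def)
  qed
  show ?thesis
    by (rule has_boundary_integralI[OF horizontal_FTC[of _ _ F1] screen_FTC[OF _ ab op(1)] horizontal_FTC[of _ _ F1] screen_FTC[OF S ab op(2)]])
       (use assms F1 F2 h s L1 L2 in \<open>auto intro!: lipschitz_on_constant simp: algebra_simps\<close>)
qed

lemma has_boundary_integral_inverse_power:
  assumes S: "K-lipschitz_on UNIV S" and p: "a < Im p" "Im p < b" "S (Im p) < Re p" "Re p < c" and "S a \<le> c" "S b \<le> c"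
  shows "has_boundary_integral a b c S (\<lambda>z. 1 / (z - p) ^ Suc (Suc n)) 0"
proof (rule has_boundary_integral_primitive[OF S, of _ _ _ "- {p}" "\<lambda>z. - (1 / (of_nat (Suc n) * (z - p) ^ Suc n))"])
  fix z assume "z \<in> - {p}"
  then have "z - p \<noteq> 0" by auto
  have "((\<lambda>z. inverse ((z - p) ^ Suc n)) has_field_derivative - (of_nat (Suc n) * (z - p) ^ n) / ((z - p) ^ Suc n * (z - p) ^ Suc n)) (at z)"
  proof -
    have "((\<lambda>z. (z - p) ^ Suc n) has_field_derivative of_nat (Suc n) * (z - p) ^ n) (at z)"
    proof -
      have "((\<lambda>z. z - p) has_field_derivative 1) (at z)" by (auto intro!: derivative_eq_intros)
      from DERIV_power[OF this, of "Suc n"] show ?thesis by (simp add: mult_ac)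
    qed
    have "(z - p) ^ Suc n \<noteq> 0" using \<open>z - p \<noteq> 0\<close> by simp
    from DERIV_inverse'[OF \<open>((\<lambda>z. (z - p) ^ Suc n) has_field_derivative of_nat (Suc n) * (z - p) ^ n) (at z)\<close> this]
    show ?thesis
      by (rule DERIV_cong) (simp only: divide_inverse inverse_mult_distrib mult_ac minus_mult_left)
  qed
  then have "((\<lambda>z. inverse ((z - p) ^ Suc n) * (- 1 / of_nat (Suc n))) has_field_derivative - (of_nat (Suc n) * (z - p) ^ n) / ((z - p) ^ Suc n * (z - p) ^ Suc n) * (- 1 / of_nat (Suc n))) (at z)"
    by (rule DERIV_cmult_right)
  moreover have "- (of_nat (Suc n) * (z - p) ^ n) / ((z - p) ^ Suc n * (z - p) ^ Suc n) * (- 1 / of_nat (Suc n)) = 1 / (z - p) ^ Suc (Suc n)"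
  proof -
    have "- (m * w ^ n) / (w ^ Suc n * w ^ Suc n) * (- 1 / m) = 1 / w ^ Suc (Suc n)" if "w \<noteq> 0" "m \<noteq> 0" for w m :: complex
      using that by (simp add: field_simps)
    then show ?thesis using \<open>z - p \<noteq> 0\<close> of_nat_neq_0[of n] by blast
  qed
  moreover have "(\<lambda>z. inverse ((z - p) ^ Suc n) * (- 1 / of_nat (Suc n))) = (\<lambda>z. - (1 / (of_nat (Suc n) * (z - p) ^ Suc n)))"
    by (auto simp: field_simps simp del: of_nat_Suc)
  ultimately show "((\<lambda>z. - (1 / (of_nat (Suc n) * (z - p) ^ Suc n))) has_field_derivative 1 / (z - p) ^ Suc (Suc n)) (at z)"
    by simp
qed (use assms in \<open>auto simp: complex_eq_iff\<close>)

lemma principal_part_analytic: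
  assumes "g analytic_on {p}"
  shows "\<exists>coef h. h analytic_on {p} \<and> (\<forall>\<^sub>F z in at p. g z / (z - p) ^ N = h z + (\<Sum>k<N. coef k / (z - p) ^ Suc k))"
  using assms
proof (induction N arbitrary: g)
  case 0
  then show ?case by (intro exI[of _ "\<lambda>_. 0"] exI[of _ g]) auto
next
  case (Suc N)
  obtain A where A: "open A" "p \<in> A" "g holomorphic_on A" using Suc.prems analytic_at by blast
  define g1 where "g1 = (\<lambda>z. if z = p then deriv g p else (g z - g p) / (z - p))"
  have "g1 analytic_on {p}"
    using pole_lemma_open[OF A(3,1), of p] A unfolding g1_def analytic_at by blast
  from Suc.IH[OF this] obtain coef h where h: "h analytic_on {p}" 
    "\<forall>\<^sub>F z in at p. g1 z / (z - p) ^ N = h z + (\<Sum>k<N. coef k / (z - p) ^ Suc k)" by blast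
  have "\<forall>\<^sub>F z in at p. g z / (z - p) ^ Suc N = h z + (\<Sum>k<Suc N. (coef(N := g p)) k / (z - p) ^ Suc k)"
    using h(2) eventually_neq_at_within[of p p UNIV]
  proof eventually_elim
    case (elim z)
    have "(\<Sum>k<Suc N. (coef(N := g p)) k / (z - p) ^ Suc k) = (\<Sum>k<N. coef k / (z - p) ^ Suc k) + g p / (z - p) ^ Suc N"
      by simp
    moreover have "g z / (z - p) ^ Suc N = g1 z / (z - p) ^ N + g p / (z - p) ^ Suc N"
      using elim(2) by (simp add: g1_def divide_simps)
    ultimately show ?case using elim(1) by simp
  qed
  then show ?case using h(1) by blast
qed

lemma principal_part:
  assumes "isolated_singularity_at f p" "not_essential f p"
  obtains N coef h where "h analytic_on {p}" "\<forall>\<^sub>F z in at p. f z = h z + (\<Sum>k<N. coef k / (z - p) ^ Suc k)"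
proof (cases "\<exists>\<^sub>F z in at p. f z \<noteq> 0")
  case False
  then show ?thesis using that[where h="\<lambda>_. 0" and N=0] by (auto simp: frequently_def)
next
  case True
  obtain r g where g: "r > 0" "g holomorphic_on cball p r" "\<And>w. w \<in> cball p r - {p} \<Longrightarrow> f w = g w * (w - p) powi zorder f p"
    using zorder_exist[OF assms True] by blast
  have ga: "g analytic_on {p}" using g(1,2)
    by (metis analytic_at ball_subset_cball centre_in_ball holomorphic_on_subset open_ball)
  have ev: "\<forall>\<^sub>F z in at p. f z = g z * (z - p) powi zorder f p"
    using g(1,3) unfolding eventually_at by (intro exI[of _ r]) (auto simp: dist_commute)
  show ?thesis
  proof (cases "zorder f p \<ge> 0")
    case True
    define h where "h = (\<lambda>z. g z * (z - p) ^ nat (zorder f p))"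
    have "h analytic_on {p}" unfolding h_def by (intro analytic_intros ga)
    moreover have "\<forall>\<^sub>F z in at p. f z = h z" using ev True by (simp add: h_def power_int_def)
    ultimately show ?thesis using that[where h=h and N=0] by simp
  next
    case False
    have ev2: "\<forall>\<^sub>F z in at p. f z = g z / (z - p) ^ nat (- zorder f p)"
      using ev False by (simp add: power_int_def field_simps)
    obtain coef h where h: "h analytic_on {p}" 
      "\<forall>\<^sub>F z in at p. g z / (z - p) ^ nat (- zorder f p) = h z + (\<Sum>k<nat (- zorder f p). coef k / (z - p) ^ Suc k)"
      using principal_part_analytic[OF ga] by blast
    from ev2 h(2) have "\<forall>\<^sub>F z in at p. f z = h z + (\<Sum>k<nat (- zorder f p). coef k / (z - p) ^ Suc k)"
      by eventually_elim simp
    with h(1) show ?thesis by (rule that)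
  qed
qed

text \<open>
  Induction on the number of poles: removing the principal part at a pole leaves a function that is
  holomorphic there, and the boundary integral of the principal part is known.
\<close>

lemma screen_residue_theorem:
  assumes "finite P" and S: "K-lipschitz_on UNIV S" and ab: "a < b" and U: "open U"
    and sub: "{z. a \<le> Im z \<and> Im z \<le> b \<and> S (Im z) \<le> Re z} \<subseteq> U" and right: "{z. c \<le> Re z} \<subseteq> U"
    and Sc: "\<And>t. a \<le> t \<Longrightarrow> t \<le> b \<Longrightarrow> S t \<le> c"
    and P: "\<And>p. p \<in> P \<Longrightarrow> a < Im p \<and> Im p < b \<and> S (Im p) < Re p \<and> Re p < c"
    and f: "f holomorphic_on U - P" "\<And>p. p \<in> P \<Longrightarrow> not_essential f p"
  shows "has_boundary_integral a b c S f (2 * of_real pi * \<i> * (\<Sum>p\<in>P. residue f p))"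
  using assms(1) P f
proof (induction P arbitrary: f rule: finite_induct)
  case empty
  obtain \<delta> where \<delta>: "\<delta> > 0" "{z. S (Im z) - \<delta> < Re z \<and> a - \<delta> < Im z \<and> Im z < b + \<delta>} \<subseteq> U"
    using right_of_screen_nhd[OF S ab U sub right] by blast
  define \<Omega> where "\<Omega> = {z. S (Im z) - \<delta> < Re z \<and> a - \<delta> < Im z \<and> Im z < b + \<delta>}"
  have cont: "continuous_on UNIV S" by (rule lipschitz_on_continuous_on[OF S])
  have cS: "continuous_on UNIV (\<lambda>z. S (Im z))"
    by (rule continuous_on_compose2[OF cont]) (auto intro!: continuous_intros)
  have op: "open \<Omega>" unfolding \<Omega>_def
    by (intro open_Collect_conj open_Collect_less continuous_intros cS)
  have "simply_connected \<Omega>" unfolding \<Omega>_def by (rule simply_connected_right_of_graph[OF cont])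
  moreover have "f holomorphic_on \<Omega>" using empty(2) \<delta>(2) by (auto simp: \<Omega>_def intro: holomorphic_on_subset)
  ultimately obtain F where F: "\<And>z. z \<in> \<Omega> \<Longrightarrow> (F has_field_derivative f z) (at z)"
    using simply_connected_eq_global_primitive[OF op] by blast
  have "has_boundary_integral a b c S f 0"
  proof (rule has_boundary_integral_primitive[OF S less_imp_le[OF ab] Sc Sc op F])
    fix t assume "a \<le> t" "t \<le> b"
    then show "Complex (S t) t \<in> \<Omega> \<and> Complex c t \<in> \<Omega>"
      using Sc[of t] \<delta>(1) by (auto simp: \<Omega>_def)
  qed (use ab \<delta>(1) in \<open>auto simp: \<Omega>_def\<close>)
  then show ?case by simp
next
  case (insert p P)
  have p: "a < Im p" "Im p < b" "S (Im p) < Re p" "Re p < c" using insert.prems(1) by auto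
  have Sab: "S a \<le> c" "S b \<le> c" using Sc ab by auto
  have pU: "p \<in> U" using sub p by auto
  have cP: "closed P" using insert.hyps by (simp add: finite_imp_closed)
  have op: "open (U - P)" using U cP by blast
  have pUP: "p \<in> U - P" using pU insert.hyps by auto
  have eq: "U - insert p P = U - P - {p}" by auto
  have "isolated_singularity_at f p"
    using isolated_singularity_at_holomorphic[OF _ op pUP] insert.prems(2) by (simp add: eq)
  then obtain N coef h where h: "h analytic_on {p}" "\<forall>\<^sub>F z in at p. f z = h z + (\<Sum>k<N. coef k / (z - p) ^ Suc k)"
    by (rule principal_part[OF _ insert.prems(3)[of p]]) auto
  define Q where "Q = (\<lambda>z. \<Sum>k<N. coef k / (z - p) ^ Suc k)"
  define r where "r = (if N = 0 then 0 else coef 0)"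
  have Qholo: "Q holomorphic_on A" if "p \<notin> A" for A
    unfolding Q_def
    by (intro holomorphic_on_sum holomorphic_on_divide holomorphic_on_power holomorphic_on_diff holomorphic_on_const holomorphic_on_ident)
       (use that in auto)
  \<comment> \<open>the function without its principal part at \<open>p\<close>\<close>
  define g where "g = (\<lambda>z. if z = p then h p else f z - Q z)"
  have gholo: "g holomorphic_on U - P"
  proof -
    have "(\<lambda>z. f z - Q z) holomorphic_on U - P - {p}"
      using insert.prems(2) by (intro holomorphic_on_diff Qholo) (auto simp: eq)
    then have 1: "g holomorphic_on U - P - {p}"
      by (rule holomorphic_transform) (auto simp: g_def)
    obtain A where A: "open A" "p \<in> A" "h holomorphic_on A" using h(1) analytic_at by blast
    have "\<forall>\<^sub>F z in at p. g z = h z" using h(2) eventually_neq_at_within[of p p UNIV]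
      by eventually_elim (simp add: g_def Q_def)
    then obtain B where B: "open B" "p \<in> B" "\<And>z. z \<in> B \<Longrightarrow> z \<noteq> p \<Longrightarrow> g z = h z" unfolding eventually_at_topological by auto
    have "g z = h z" if "z \<in> A \<inter> B" for z using B(3)[of z] that by (cases "z = p") (auto simp: g_def)
    then have 2: "g holomorphic_on A \<inter> B"
      using holomorphic_transform[OF holomorphic_on_subset[OF A(3)], of "A \<inter> B" g] by auto
    have "g holomorphic_on (U - P - {p}) \<union> (A \<inter> B)"
      using op A B by (intro holomorphic_on_Un[OF 1 2]) auto
    then show ?thesis by (rule holomorphic_on_subset) (use A B in auto)
  qed
  have geq: "\<forall>\<^sub>F z in at p'. g z = f z - Q z" for p'
    by (rule eventually_mono[OF eventually_neq_at_within[of p p' UNIV]]) (simp add: g_def)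
  have res: "residue g p' = residue f p' \<and> not_essential g p'" if p': "p' \<in> P" for p'
  proof -
    define A where "A = U - (P - {p'}) - {p}"
    have A: "open A" "p' \<in> A" using U insert.hyps p' insert.prems(1)[of p'] sub
      by (auto simp: A_def finite_imp_closed open_Diff)
    have f1: "f holomorphic_on A - {p'}" by (rule holomorphic_on_subset[OF insert.prems(2)]) (auto simp: A_def)
    have Q1: "Q holomorphic_on A" by (rule Qholo) (auto simp: A_def)
    have "residue g p' = residue (\<lambda>z. f z - Q z) p'" by (rule residue_cong[OF geq refl])
    also have "\<dots> = residue f p' - residue Q p'"
      using A f1 Q1 by (intro residue_diff[of A]) (auto intro: holomorphic_on_subset)
    also have "residue Q p' = 0" using residue_holo[OF A Q1] .
    finally have "residue g p' = residue f p'" by simp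
    moreover have "not_essential (\<lambda>z. f z - Q z) p'"
    proof -
      have "f meromorphic_on {p'}" unfolding meromorphic_at_iff
        using insert.prems(3) p' isolated_singularity_at_holomorphic[OF f1 A] by simp
      moreover have "Q analytic_on {p'}" using Q1 A analytic_at by blast
      ultimately have "(\<lambda>z. f z - Q z) meromorphic_on {p'}"
        by (intro meromorphic_on_diff) (auto intro: analytic_on_imp_meromorphic_on)
      then show ?thesis unfolding meromorphic_at_iff by simp
    qed
    ultimately show ?thesis using not_essential_cong[OF geq refl] by simp
  qed
  have IH: "has_boundary_integral a b c S g (2 * of_real pi * \<i> * (\<Sum>p\<in>P. residue g p))"
    by (rule insert.IH) (use insert.prems(1) gholo res in auto)
  have pole_term: "has_boundary_integral a b c S (\<lambda>z. coef k / (z - p) ^ Suc k) (coef k * (if k = 0 then 2 * of_real pi * \<i> else 0))" for k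
  proof -
    have "has_boundary_integral a b c S (\<lambda>z. 1 / (z - p) ^ Suc k) (if k = 0 then 2 * of_real pi * \<i> else 0)"
      using has_boundary_integral_inverse[OF S p Sab] has_boundary_integral_inverse_power[OF S p Sab, of "k-1"]
      by (cases k) auto
    from has_boundary_integral_cmult[OF this, of "coef k"] show ?thesis by simp
  qed
  have "has_boundary_integral a b c S Q (\<Sum>k<N. coef k * (if k = 0 then 2 * of_real pi * \<i> else 0))"
    unfolding Q_def by (intro has_boundary_integral_sum pole_term) auto
  also have "(\<Sum>k<N. coef k * (if k = 0 then 2 * of_real pi * \<i> else 0)) = 2 * of_real pi * \<i> * r"
    by (cases N) (auto simp: r_def if_distrib[of "\<lambda>x. _ * x"] sum.If_cases lessThan_Suc_eq_insert_0 cong: if_cong)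
  finally have Qint: "has_boundary_integral a b c S Q (2 * of_real pi * \<i> * r)" .
  have "residue f p = r"
  proof -
    obtain A where A: "open A" "p \<in> A" "h holomorphic_on A" using h(1) analytic_at by blast
    have t: "residue (\<lambda>z. coef k / (z - p) ^ Suc k) p = (if k = 0 then coef 0 else 0)" for k
      using residue_holomorphic_over_power[of UNIV p "\<lambda>_. coef k" k] by (auto simp: higher_deriv_const)
    have rQ: "residue (\<lambda>z. \<Sum>k<n. coef k / (z - p) ^ Suc k) p = (\<Sum>k<n. if k = 0 then coef 0 else 0)" for n
    proof (induction n)
      case 0 then show ?case using residue_holo[of UNIV p "\<lambda>_. 0"] by simp
    next
      case (Suc n)
      have h1: "(\<lambda>z. \<Sum>k<n. coef k / (z - p) ^ Suc k) holomorphic_on UNIV - {p}"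
        and h2: "(\<lambda>z. coef n / (z - p) ^ Suc n) holomorphic_on UNIV - {p}"
        by (intro holomorphic_on_sum holomorphic_on_divide holomorphic_on_power holomorphic_on_diff
              holomorphic_on_const holomorphic_on_ident; simp)+
      show ?case unfolding sum.lessThan_Suc
        by (subst residue_add[OF open_UNIV UNIV_I h1 h2]) (simp only: Suc t)
    qed
    have "residue f p = residue (\<lambda>z. h z + Q z) p" unfolding Q_def by (rule residue_cong[OF h(2) refl])
    also have "\<dots> = residue h p + residue Q p"
      using A by (intro residue_add[of A] Qholo) (auto intro: holomorphic_on_subset)
    also have "residue h p = 0" using residue_holo[OF A] .
    also have "residue Q p = r" unfolding Q_def rQ r_def by (cases N) (auto simp: lessThan_Suc_eq_insert_0)
    finally show ?thesis by simp
  qed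
  have "has_boundary_integral a b c S (\<lambda>z. g z + Q z) (2 * of_real pi * \<i> * (\<Sum>p\<in>P. residue g p) + 2 * of_real pi * \<i> * r)"
    by (rule has_boundary_integral_add[OF IH Qint])
  moreover have "2 * of_real pi * \<i> * (\<Sum>p\<in>P. residue g p) + 2 * of_real pi * \<i> * r = 2 * of_real pi * \<i> * (\<Sum>p\<in>insert p P. residue f p)"
    using insert.hyps \<open>residue f p = r\<close> res by (simp add: algebra_simps)
  ultimately show ?case
    by (auto elim!: has_boundary_integral_cong simp: g_def) (use p in auto)
qed

section \<open>Shifting a vertical line of integration\<close>

text \<open>
  The form in which integrals of functions of size \<open>C / m^2\<close> over edges of length proportional to \<open>m\<close> appear.
\<close>

lemma tendsto_square_error:
  fixes x :: "nat \<Rightarrow> complex"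
  assumes "\<And>m. m \<ge> M \<Longrightarrow> norm (x m - v) \<le> C * (real m + c) / (real m)\<^sup>2"
  shows "x \<longlonglongrightarrow> v"
proof -
  have "(\<lambda>m. 1 / real m) \<longlonglongrightarrow> 0" by (rule lim_1_over_n)
  then have "(\<lambda>m. C * (1 / real m) + C * c * (1 / real m * (1 / real m))) \<longlonglongrightarrow> C * 0 + C * c * (0 * 0)"
    by (intro tendsto_intros)
  moreover have "C * (1 / real m) + C * c * (1 / real m * (1 / real m)) = C * (real m + c) / (real m)\<^sup>2" for m
    by (cases "m = 0") (auto simp: field_simps power2_eq_square)
  ultimately have "(\<lambda>m. C * (real m + c) / (real m)\<^sup>2) \<longlonglongrightarrow> 0" by simp
  then have "(\<lambda>m. x m - v) \<longlonglongrightarrow> 0"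
    by (rule Lim_null_comparison[rotated]) (use assms in \<open>auto simp: eventually_sequentially\<close>)
  then show ?thesis by (simp add: LIM_zero_iff)
qed

text \<open>
  Apply the residue theorem to the square with vertices at heights \<open>- m\<close> and \<open>m\<close> and left edge on
  \<open>Re s = - m\<close>.
\<close>

lemma line_integral_shift_left:
  fixes f :: "complex \<Rightarrow> complex"
  assumes "finite P" "f holomorphic_on UNIV - P" "\<And>p. p \<in> P \<Longrightarrow> not_essential f p" "\<And>p. p \<in> P \<Longrightarrow> Re p < c"
    and c: "c > 0" and C: "C \<ge> 0"
    and bound: "\<And>s m. m \<ge> M \<Longrightarrow> Re s \<le> c \<Longrightarrow> m \<le> \<bar>Im s\<bar> \<or> Re s \<le> - m \<Longrightarrow> norm (f s) \<le> C / m\<^sup>2"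
  shows "(\<lambda>m::nat. integral {- real m..real m} (screen_integrand (\<lambda>_. c) f)) \<longlonglongrightarrow> 2 * of_real pi * \<i> * (\<Sum>p\<in>P. residue f p)"
proof -
  obtain N where N: "\<And>p. p \<in> P \<Longrightarrow> norm p \<le> N" using finite_imp_bounded[OF assms(1)] bounded_iff by blast
  define M' where "M' = nat \<lceil>max (max M (N + 1)) 1\<rceil>"
  show ?thesis
  proof (rule tendsto_square_error[where M=M' and C="4 * C" and c=c])
    fix m :: nat assume "m \<ge> M'"
    then have m: "real m \<ge> M" "real m \<ge> N + 1" "real m \<ge> 1" unfolding M'_def by linarith+
    have "has_boundary_integral (- real m) (real m) c (\<lambda>_. - real m) f (2 * of_real pi * \<i> * (\<Sum>p\<in>P. residue f p))"
    proof (rule screen_residue_theorem[where U=UNIV and K=0])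
      show "- real m < Im p \<and> Im p < real m \<and> - real m < Re p \<and> Re p < c" if "p \<in> P" for p
        using N[OF that] assms(4)[OF that] m abs_Re_le_cmod[of p] abs_Im_le_cmod[of p] by linarith
    qed (use assms m in \<open>auto intro: lipschitz_on_constant\<close>)
    then obtain i1 i2 i3 i4 where i: "((\<lambda>x. f (Complex x (- real m))) has_integral i1) {- real m..c}"
       "(screen_integrand (\<lambda>_. c) f has_integral i2) {- real m..real m}"
       "((\<lambda>x. f (Complex x (real m))) has_integral i3) {- real m..c}"
       "(screen_integrand (\<lambda>_. - real m) f has_integral i4) {- real m..real m}"
       "2 * of_real pi * \<i> * (\<Sum>p\<in>P. residue f p) = i1 + i2 - i3 - i4"
      unfolding has_boundary_integral_def by auto
    define q where "q = C / (real m)\<^sup>2"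
    have B: "q \<ge> 0" using C by (simp add: q_def)
    have mc: "- real m \<le> c" "- real m \<le> real m" using c by auto
    have 1: "norm i1 \<le> q * (c - (- real m))"
      by (rule has_integral_norm_bound_AE[OF i(1) mc(1) B]) (use bound[OF m(1)] in \<open>auto simp: q_def\<close>)
    have 3: "norm i3 \<le> q * (c - (- real m))"
      by (rule has_integral_norm_bound_AE[OF i(3) mc(1) B]) (use bound[OF m(1)] in \<open>auto simp: q_def\<close>)
    have 4: "norm i4 \<le> q * (real m - (- real m))"
      by (rule has_integral_norm_bound_AE[OF i(4) mc(2) B])
         (use bound[OF m(1)] mc in \<open>auto simp: screen_integrand_const norm_mult q_def\<close>)
    have "norm (i2 - 2 * of_real pi * \<i> * (\<Sum>p\<in>P. residue f p)) = norm (i3 + i4 - i1)"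
      unfolding i(5) by (rule arg_cong[where f=norm]) simp
    also have "\<dots> \<le> norm i3 + norm i4 + norm i1"
      by (rule order_trans[OF norm_triangle_ineq4]) (intro add_mono norm_triangle_ineq order_refl)
    also have "\<dots> \<le> q * (2 * (c + real m) + 2 * real m)" using 1 3 4 by (simp add: algebra_simps)
    also have "\<dots> \<le> q * (4 * (real m + c))" by (intro mult_left_mono B) (use c in auto)
    finally show "norm (integral {- real m..real m} (screen_integrand (\<lambda>_. c) f) - 2 * of_real pi * \<i> * (\<Sum>p\<in>P. residue f p)) \<le> 4 * C * (real m + c) / (real m)\<^sup>2"
      using integral_unique[OF i(2)] by (simp add: q_def algebra_simps add_divide_distrib)
  qed
qed

lemma line_integral_shift_right:
  fixes f :: "complex \<Rightarrow> complex"
  assumes f: "f holomorphic_on {s. c - \<delta> < Re s}" and \<delta>: "\<delta> > 0" and C: "C \<ge> 0"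
    and bound: "\<And>s m. m \<ge> M \<Longrightarrow> c \<le> Re s \<Longrightarrow> m \<le> \<bar>Im s\<bar> \<or> c + m \<le> Re s \<Longrightarrow> norm (f s) \<le> C / m\<^sup>2"
  shows "(\<lambda>m::nat. integral {- real m..real m} (screen_integrand (\<lambda>_. c) f)) \<longlonglongrightarrow> 0"
proof -
  define M' where "M' = nat \<lceil>max M 1\<rceil>"
  show ?thesis
  proof (rule tendsto_square_error[where M=M' and C="4 * C" and c=0])
    fix m :: nat assume "m \<ge> M'"
    then have m: "real m \<ge> M" "real m \<ge> 1" unfolding M'_def by linarith+
    have "has_boundary_integral (- real m) (real m) (c + real m) (\<lambda>_. c) f (2 * of_real pi * \<i> * (\<Sum>p\<in>{}. residue f p))"
      by (rule screen_residue_theorem[where U="{s. c - \<delta> < Re s}" and K=0])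
         (use f \<delta> m in \<open>auto intro: lipschitz_on_constant open_halfspace_Re_gt\<close>)
    then obtain i1 i2 i3 i4 where i: "((\<lambda>x. f (Complex x (- real m))) has_integral i1) {c..c + real m}"
       "(screen_integrand (\<lambda>_. c + real m) f has_integral i2) {- real m..real m}"
       "((\<lambda>x. f (Complex x (real m))) has_integral i3) {c..c + real m}"
       "(screen_integrand (\<lambda>_. c) f has_integral i4) {- real m..real m}"
       "0 = i1 + i2 - i3 - i4"
      unfolding has_boundary_integral_def by auto
    define q where "q = C / (real m)\<^sup>2"
    have B: "q \<ge> 0" using C by (simp add: q_def)
    have mc: "c \<le> c + real m" "- real m \<le> real m" by auto
    have 1: "norm i1 \<le> q * (c + real m - c)"
      by (rule has_integral_norm_bound_AE[OF i(1) mc(1) B]) (use bound[OF m(1)] in \<open>auto simp: q_def\<close>)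
    have 3: "norm i3 \<le> q * (c + real m - c)"
      by (rule has_integral_norm_bound_AE[OF i(3) mc(1) B]) (use bound[OF m(1)] in \<open>auto simp: q_def\<close>)
    have 2: "norm i2 \<le> q * (real m - (- real m))"
      by (rule has_integral_norm_bound_AE[OF i(2) mc(2) B])
         (use bound[OF m(1)] mc in \<open>auto simp: screen_integrand_const norm_mult q_def\<close>)
    have "i4 = i1 + i2 - i3" using i(5) by algebra
    then have "norm i4 = norm (i1 + i2 - i3)" by simp
    also have "\<dots> \<le> norm i1 + norm i2 + norm i3"
      by (rule order_trans[OF norm_triangle_ineq4]) (intro add_mono norm_triangle_ineq order_refl)
    also have "\<dots> \<le> q * (4 * real m)" using 1 2 3 by (simp add: algebra_simps)
    finally show "norm (integral {- real m..real m} (screen_integrand (\<lambda>_. c) f) - 0) \<le> 4 * C * (real m + 0) / (real m)\<^sup>2"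
      using integral_unique[OF i(4)] by (simp add: q_def mult_ac)
  qed
qed

section \<open>Meromorphic continuation\<close>

lemma is_continuation_subset:
  "is_continuation f A W F \<Longrightarrow> W' \<subseteq> W \<Longrightarrow> is_continuation f A W' F"
  unfolding is_continuation_def by blast

lemma is_continuation_nicely:
  "is_continuation f A W F \<Longrightarrow> F nicely_meromorphic_on W"
  unfolding is_continuation_def using nicely_meromorphic_on_subset by blast

lemma continuation_analytic_at:
  assumes F: "is_continuation f A W F" and "w \<in> W" "\<not> is_pole F w"
  shows "F analytic_on {w}"
  using nicely_meromorphic_on_imp_analytic_at[OF is_continuation_nicely[OF F]] assms by blast

lemma nicely_meromorphic_eq_at:
  assumes "F1 nicely_meromorphic_on {w}" "F2 nicely_meromorphic_on {w}" "\<forall>\<^sub>F z in at w. F1 z = F2 z"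
  shows "F1 w = F2 w"
proof -
  have 1: "is_pole F1 w \<and> F1 w = 0 \<or> F1 \<midarrow>w\<rightarrow> F1 w" and 2: "is_pole F2 w \<and> F2 w = 0 \<or> F2 \<midarrow>w\<rightarrow> F2 w"
    using assms unfolding nicely_meromorphic_on_def by auto
  have p: "is_pole F1 w \<longleftrightarrow> is_pole F2 w" by (rule is_pole_cong[OF assms(3) refl])
  show ?thesis
  proof (cases "is_pole F1 w")
    case True
    have "F1 w = 0" using is_pole_zero_at_nicely_mero[OF assms(1) True] by simp
    moreover have "F2 w = 0" using is_pole_zero_at_nicely_mero[OF assms(2)] True p by simp
    ultimately show ?thesis by simp
  next
    case False
    then have "F1 \<midarrow>w\<rightarrow> F1 w" "F2 \<midarrow>w\<rightarrow> F2 w" using 1 2 p by auto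
    moreover have "F1 \<midarrow>w\<rightarrow> F2 w" using calculation(2) tendsto_cong[OF assms(3)] by simp
    ultimately show ?thesis using LIM_unique by blast
  qed
qed

text \<open>
  The connected component of the common domain that contains \<open>W\<close> also contains \<open>B\<close>, where both
  continuations equal \<open>f\<close>.
\<close>

lemma continuation_unique:
  assumes F1: "is_continuation f A W F1" and F2: "is_continuation f A W F2"
    and W: "connected W" and B: "open B" "b \<in> B" "B \<subseteq> A" "B \<subseteq> W" and w: "w \<in> W"
  shows "\<forall>\<^sub>F z in nhds w. F1 z = F2 z"
proof -
  obtain U1 where U1: "open U1" "W \<subseteq> U1" "F1 nicely_meromorphic_on U1" "\<And>s. s \<in> A \<Longrightarrow> F1 s = f s"
    using F1 unfolding is_continuation_def by blast
  obtain U2 where U2: "open U2" "W \<subseteq> U2" "F2 nicely_meromorphic_on U2" "\<And>s. s \<in> A \<Longrightarrow> F2 s = f s"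
    using F2 unfolding is_continuation_def by blast
  define C where "C = connected_component_set (U1 \<inter> U2) w"
  have C: "open C" "connected C" "C \<subseteq> U1 \<inter> U2"
    using U1(1) U2(1) connected_component_subset by (auto simp: C_def intro: open_connected_component)
  have WC: "W \<subseteq> C" unfolding C_def using w W U1(2) U2(2) by (intro connected_component_maximal) auto
  define D where "D = (\<lambda>z. F1 z - F2 z)"
  have "F1 meromorphic_on C" "F2 meromorphic_on C"
    using U1(3) U2(3) C(3) by (auto simp: nicely_meromorphic_on_def intro: meromorphic_on_subset)
  then have D: "D meromorphic_on C" unfolding D_def by (rule meromorphic_on_diff)
  then have rD: "remove_sings D nicely_meromorphic_on C" by (rule remove_sings_nicely_meromorphic)
  have isoD: "isolated_singularity_at D z" if "z \<in> C" for z
    using meromorphic_on_isolated_singularity[OF meromorphic_on_subset[OF D]] that by simp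
  have bC: "b \<in> C" using B WC by auto
  have "\<forall>\<^sub>F z in at b. z \<in> B" using B(1,2) by (simp add: eventually_at_in_open')
  moreover have "\<forall>\<^sub>F z in at b. remove_sings D z = D z"
    by (rule eventually_remove_sings_eq_at[OF isoD[OF bC]])
  ultimately have "\<forall>\<^sub>F z in at b. remove_sings D z = 0"
    by eventually_elim (use B(3) U1(4) U2(4) in \<open>auto simp: D_def subset_iff\<close>)
  then have "\<exists>\<^sub>F z in at b. remove_sings D z = 0" by (rule eventually_frequently[rotated]) simp
  from frequently_eq_meromorphic_imp_constant[OF this rD C(1,2) bC]
  have zero: "remove_sings D z = 0" if "z \<in> C" for z using that by blast
  have wC: "w \<in> C" using w WC by auto
  have "\<forall>\<^sub>F z in at w. z \<in> C" using C(1) wC by (simp add: eventually_at_in_open')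
  moreover have "\<forall>\<^sub>F z in at w. remove_sings D z = D z"
    by (rule eventually_remove_sings_eq_at[OF isoD[OF wC]])
  ultimately have ev: "\<forall>\<^sub>F z in at w. F1 z = F2 z"
    by eventually_elim (use zero in \<open>auto simp: D_def\<close>)
  moreover have "F1 w = F2 w"
    by (rule nicely_meromorphic_eq_at[OF _ _ ev])
       (use U1 U2 w in \<open>auto intro: nicely_meromorphic_on_subset\<close>)
  ultimately show ?thesis by (simp add: eventually_nhds_conv_at)
qed

lemma continuation_is_continuation:
  "is_continuation f A W F \<Longrightarrow> is_continuation f A W (continuation f A W)"
  unfolding continuation_def by (rule someI[of "is_continuation f A W"])

lemma connected_window:
  assumes "continuous_on UNIV S"
  shows "connected (window S)"
proof -
  have "window S = (\<lambda>z. z + of_real (S (Im z))) ` {z. 0 \<le> Re z}"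
  proof (intro equalityI subsetI)
    fix z assume "z \<in> window S"
    then show "z \<in> (\<lambda>z. z + of_real (S (Im z))) ` {z. 0 \<le> Re z}"
      by (intro image_eqI[of _ _ "z - of_real (S (Im z))"]) (auto simp: window_def)
  qed (auto simp: window_def)
  moreover have "connected ({z. 0 \<le> Re z} :: complex set)" 
    by (intro convex_connected convex_halfspace_Re_ge)
  moreover have "continuous_on {z. 0 \<le> Re z} (\<lambda>z. z + complex_of_real (S (Im z)))"
    by (intro continuous_intros continuous_on_compose2[OF assms]) auto
  ultimately show ?thesis using connected_continuous_image by metis
qed

lemma open_analytic_points: "open {z. f analytic_on {z}}"
proof (subst open_subopen, safe)
  fix z assume "f analytic_on {z}"
  then obtain T where T: "open T" "z \<in> T" "f holomorphic_on T" using analytic_at by blast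
  then have "T \<subseteq> {z. f analytic_on {z}}" using analytic_at by blast
  then show "\<exists>T. open T \<and> z \<in> T \<and> T \<subseteq> {z. f analytic_on {z}}" using T by blast
qed

lemma finite_poles_compact:
  assumes "F nicely_meromorphic_on U" "open U" "compact R" "R \<subseteq> U"
  shows "finite (R \<inter> {z. is_pole F z})"
proof (rule sparse_in_compact_finite[OF _ assms(3)])
  have "F meromorphic_on U" using assms(1) by (simp add: nicely_meromorphic_on_def)
  then have "isolated_singularity_at F z" if "z \<in> U" for z
    using meromorphic_on_isolated_singularity[OF meromorphic_on_subset] that by simp
  then have "{z. is_pole F z} sparse_in U"
    using assms(2) by (auto simp: sparse_in_open not_islimpt_poles)
  then show "{z. is_pole F z} sparse_in R" using assms(4) by (rule sparse_in_subset)
qed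

text \<open>
  In particular a pole cannot lie on a horizontal ray on which a languidness bound holds. The value
  at the pole itself says nothing, because a nicely meromorphic function is \<open>0\<close> there.
\<close>

lemma not_pole_if_bounded_right:
  assumes bd: "\<And>x'. x \<le> x' \<Longrightarrow> norm (F (Complex x' y)) \<le> B"
  shows "\<not> is_pole F (Complex x y)"
proof
  assume "is_pole F (Complex x y)"
  then have "\<forall>\<^sub>F z in at (Complex x y). B + 1 \<le> norm (F z)"
    unfolding is_pole_def filterlim_at_infinity_conv_norm_at_top filterlim_at_top by blast
  then obtain d where d: "d > 0" "\<And>z. z \<noteq> Complex x y \<Longrightarrow> dist z (Complex x y) < d \<Longrightarrow> B + 1 \<le> norm (F z)"
    unfolding eventually_at by auto
  have eq: "Complex (x + d / 2) y = Complex x y + of_real (d / 2)" by (simp add: complex_eq_iff)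
  have "B + 1 \<le> norm (F (Complex (x + d / 2) y))"
    by (rule d(2)) (use d(1) in \<open>auto simp: eq dist_norm\<close>)
  then show False using bd[of "x + d / 2"] d(1) by simp
qed

lemma residue_add_meromorphic:
  assumes "f meromorphic_on {z}" "g meromorphic_on {z}"
  shows "residue (\<lambda>s. f s + g s) z = residue f z + residue g z"
proof -
  obtain r1 where r1: "r1 > 0" "f analytic_on ball z r1 - {z}"
    using assms(1) unfolding meromorphic_at_iff isolated_singularity_at_def by blast
  obtain r2 where r2: "r2 > 0" "g analytic_on ball z r2 - {z}"
    using assms(2) unfolding meromorphic_at_iff isolated_singularity_at_def by blast
  have "f holomorphic_on ball z (min r1 r2) - {z}" "g holomorphic_on ball z (min r1 r2) - {z}"
    using r1 r2 by (auto intro!: analytic_imp_holomorphic elim!: analytic_on_subset)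
  then show ?thesis using r1 r2 by (intro residue_add[of "ball z (min r1 r2)"]) auto
qed

section \<open>The scaling zeta function\<close>

lemma norm_powr_diff_le:
  fixes w :: complex
  assumes "0 < x" "x \<le> y" "Re w > 0"
  shows "norm (of_real y powr w - of_real x powr w) \<le> norm w / Re w * (y powr Re w - x powr Re w)"
proof -
  define u v where "u = ln x" and "v = ln y"
  have uv: "u \<le> v" using assms by (simp add: u_def v_def)
  have 1: "((\<lambda>t. w * exp (w * of_real t)) has_integral (exp (w * of_real v) - exp (w * of_real u))) {u..v}"
  proof (rule fundamental_theorem_of_calculus[OF uv])
    fix t
    have "((\<lambda>z. exp (w * z)) has_field_derivative w * exp (w * of_real t)) (at (of_real t))"
      by (auto intro!: derivative_eq_intros)
    from has_vector_derivative_real_field[OF this]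
    show "((\<lambda>t. exp (w * of_real t)) has_vector_derivative w * exp (w * of_real t)) (at t within {u..v})"
      by (simp add: has_vector_derivative_at_within)
  qed
  have 2: "((\<lambda>t. norm w * exp (Re w * t)) has_integral (norm w / Re w * exp (Re w * v) - norm w / Re w * exp (Re w * u))) {u..v}"
  proof (rule fundamental_theorem_of_calculus[OF uv])
    fix t
    have "((\<lambda>t. norm w / Re w * exp (Re w * t)) has_real_derivative norm w * exp (Re w * t)) (at t)"
      using assms(3) by (auto intro!: derivative_eq_intros)
    then show "((\<lambda>t. norm w / Re w * exp (Re w * t)) has_vector_derivative norm w * exp (Re w * t)) (at t within {u..v})"
      by (simp add: has_real_derivative_iff_has_vector_derivative has_vector_derivative_at_within)
  qed
  have "norm (integral {u..v} (\<lambda>t. w * exp (w * of_real t))) \<le> integral {u..v} (\<lambda>t. norm w * exp (Re w * t))"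
    by (rule integral_norm_bound_integral) (use 1 2 in \<open>auto simp: norm_mult intro: has_integral_integrable\<close>)
  then have "norm (exp (w * of_real v) - exp (w * of_real u)) \<le> norm w / Re w * (exp (Re w * v) - exp (Re w * u))"
    using integral_unique[OF 1] integral_unique[OF 2] by (simp add: right_diff_distrib)
  then show ?thesis using assms
    by (simp add: powr_def u_def v_def Ln_of_real)
qed

text \<open>
  The abscissa of convergence refers to possibly conditional convergence at complex points.
  Partial summation against the sequence \<open>l j powr w\<close>, which has bounded variation for \<open>Re w > 0\<close>,
  bounds the partial sums of the positive series to the right of it.
\<close>

lemma summable_right_of_abscissa:
  assumes l: "fractal_string l" and \<sigma>: "abscissa l < ereal \<sigma>"
  shows "summable (\<lambda>j. l j powr \<sigma>)"
proof -
  have l_pos: "l j > 0" and ldec: "l (Suc j) \<le> l j" for j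
    using l by (auto simp: fractal_string_def decseq_Suc_iff)
  obtain s0 where s0: "summable (\<lambda>j. complex_of_real (l j) powr s0)" "Re s0 < \<sigma>"
    using \<sigma> unfolding abscissa_def INF_less_iff by auto
  define w where "w = of_real \<sigma> - s0"
  have w: "Re w > 0" using s0 by (simp add: w_def)
  define \<alpha> where "\<alpha> = (\<lambda>j. complex_of_real (l j) powr s0)"
  define \<beta> where "\<beta> = (\<lambda>j. complex_of_real (l j) powr w)"
  define P where "P = (\<lambda>n. \<Sum>j<n. \<alpha> j)"
  have "convergent P" using s0(1) by (simp add: P_def \<alpha>_def summable_iff_convergent)
  then obtain M where M: "\<And>n. norm (P n) \<le> M"
    by (meson BseqE convergent_imp_Bseq)
  have M0: "M \<ge> 0" using M[of 0] by (simp add: P_def)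
  have abel: "(\<Sum>j<n. \<alpha> j * \<beta> j) = P n * \<beta> n - (\<Sum>j<n. P (Suc j) * (\<beta> (Suc j) - \<beta> j))" for n
    by (induction n) (auto simp: P_def algebra_simps)
  have ab: "\<alpha> j * \<beta> j = of_real (l j powr \<sigma>)" for j
    using l_pos[of j] by (simp add: \<alpha>_def \<beta>_def w_def powr_add[symmetric] powr_of_real[symmetric])
  define c where "c = norm w / Re w"
  have c0: "c \<ge> 0" using w by (simp add: c_def)
  have diff: "norm (\<beta> (Suc j) - \<beta> j) \<le> c * (l j powr Re w - l (Suc j) powr Re w)" for j
    using norm_powr_diff_le[OF l_pos ldec w, of j] by (simp add: \<beta>_def c_def norm_minus_commute)
  have nb: "norm (\<beta> n) \<le> l 0 powr Re w" for n
  proof -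
    have "norm (\<beta> n) = l n powr Re w" using l_pos[of n] by (simp add: \<beta>_def norm_powr_real_powr)
    also have "\<dots> \<le> l 0 powr Re w" using l_pos[of n] l w
      by (intro powr_mono2) (auto simp: fractal_string_def decseq_def less_imp_le)
    finally show ?thesis .
  qed
  have bound: "(\<Sum>j<n. l j powr \<sigma>) \<le> M * l 0 powr Re w + M * (c * l 0 powr Re w)" for n
  proof -
    have "(\<Sum>j<n. l j powr \<sigma>) = norm (\<Sum>j<n. \<alpha> j * \<beta> j)"
      unfolding ab of_real_sum[symmetric] norm_of_real by (simp add: sum_nonneg)
    also have "\<dots> \<le> norm (P n * \<beta> n) + norm (\<Sum>j<n. P (Suc j) * (\<beta> (Suc j) - \<beta> j))"
      unfolding abel by (rule norm_triangle_ineq4)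
    also have "norm (P n * \<beta> n) \<le> M * l 0 powr Re w"
      unfolding norm_mult by (intro mult_mono M nb M0) auto
    also have "norm (\<Sum>j<n. P (Suc j) * (\<beta> (Suc j) - \<beta> j)) \<le> (\<Sum>j<n. M * (c * (l j powr Re w - l (Suc j) powr Re w)))"
      by (rule sum_norm_le) (unfold norm_mult, intro mult_mono M diff M0, auto)
    also have "\<dots> = M * (c * (l 0 powr Re w - l n powr Re w))"
      unfolding sum_distrib_left[symmetric] sum_lessThan_telescope'[of "\<lambda>j. l j powr Re w" n] by (rule refl)
    also have "\<dots> \<le> M * (c * l 0 powr Re w)"
      by (intro mult_left_mono M0 c0) auto
    finally show ?thesis by simp
  qed
  show ?thesis
    by (rule bounded_imp_summable[of _ "M * l 0 powr Re w + M * (c * l 0 powr Re w)"])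
       (use bound[of "Suc _"] in \<open>auto simp: lessThan_Suc_atMost\<close>)
qed

lemma fractal_string_le_1:
  assumes "fractal_string l" "l 0 = 1"
  shows "0 < l j" "l j \<le> 1"
  using assms by (auto simp: fractal_string_def decseq_def dest: spec[of _ 0] spec[of _ j])

lemma norm_scaling_term:
  assumes "fractal_string l"
  shows "norm (complex_of_real (l j) powr s) = l j powr Re s"
  using assms by (subst norm_powr_real_powr) (auto simp: fractal_string_def less_imp_le)

lemma scaling_series_bounds:
  assumes l: "fractal_string l" "l 0 = 1" and \<sigma>: "abscissa l < ereal \<sigma>" "\<sigma> \<le> Re s"
  shows summable_norm_scaling: "summable (\<lambda>j. norm (complex_of_real (l j) powr s))"
    and summable_scaling: "summable (\<lambda>j. complex_of_real (l j) powr s)"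
    and norm_scaling_series_le: "norm (scaling_series l s) \<le> (\<Sum>j. l j powr \<sigma>)"
proof -
  have le: "norm (complex_of_real (l j) powr s) \<le> l j powr \<sigma>" for j
    unfolding norm_scaling_term[OF l(1)]
    using fractal_string_le_1[OF l, of j] \<sigma> by (intro powr_mono') auto
  have summ: "summable (\<lambda>j. l j powr \<sigma>)" by (rule summable_right_of_abscissa[OF l(1) \<sigma>(1)])
  show 1: "summable (\<lambda>j. norm (complex_of_real (l j) powr s))"
    by (rule summable_comparison_test'[OF summ, of 0]) (use le in simp)
  then show "summable (\<lambda>j. complex_of_real (l j) powr s)" by (rule summable_norm_cancel)
  have "norm (scaling_series l s) \<le> (\<Sum>j. norm (complex_of_real (l j) powr s))"
    unfolding scaling_series_def by (rule summable_norm[OF 1])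
  also have "\<dots> \<le> (\<Sum>j. l j powr \<sigma>)" by (rule suminf_le[OF le 1 summ])
  finally show "norm (scaling_series l s) \<le> (\<Sum>j. l j powr \<sigma>)" .
qed

text \<open>
  There are no poles in the half-plane of convergence, because the series is locally bounded.
\<close>

lemma continuation_on_halfplane:
  assumes l: "fractal_string l" "l 0 = 1"
    and F: "is_continuation (scaling_series l) (scaling_halfplane l) W F" and W: "scaling_halfplane l \<subseteq> W"
    and s: "s \<in> scaling_halfplane l"
  shows continuation_not_pole: "\<not> is_pole F s" and continuation_analytic: "F analytic_on {s}"
    and continuation_eq_series: "F s = scaling_series l s"
proof -
  have eq: "F z = scaling_series l z" if "z \<in> scaling_halfplane l" for z
    using F that by (auto simp: is_continuation_def)
  then show "F s = scaling_series l s" using s by simp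
  \<comment> \<open>the series is bounded by its value at a real point between the abscissa and \<open>Re s\<close>\<close>
  obtain \<sigma> where \<sigma>: "abscissa l < ereal \<sigma>" "\<sigma> < Re s"
    using s ereal_dense2[of "abscissa l" "ereal (Re s)"] by (auto simp: scaling_halfplane_def)
  show np: "\<not> is_pole F s"
  proof
    assume "is_pole F s"
    then have "\<forall>\<^sub>F z in at s. (\<Sum>j. l j powr \<sigma>) + 1 \<le> norm (F z)"
      unfolding is_pole_def filterlim_at_infinity_conv_norm_at_top filterlim_at_top by blast
    moreover have "\<forall>\<^sub>F z in at s. \<sigma> < Re z"
      using \<sigma> by (intro order_tendstoD(1)[of _ "Re s"] tendsto_intros) auto
    ultimately have "\<forall>\<^sub>F z in at s. False"
    proof eventually_elim
      case (elim z)
      have "abscissa l < ereal (Re z)" using \<sigma>(1) elim(2) by (meson ereal_less(2) less_ereal.simps(1) order.strict_trans)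
      then have "z \<in> scaling_halfplane l" by (simp add: scaling_halfplane_def)
      then show ?case using eq norm_scaling_series_le[OF l \<sigma>(1), of z] elim by simp
    qed
    then show False by (simp add: eventually_False)
  qed
  show "F analytic_on {s}"
    using nicely_meromorphic_on_imp_analytic_at[OF is_continuation_nicely[OF F] _ np] s W by auto
qed

lemma halfplane_subset_window:
  assumes "\<And>t. ereal (S t) \<le> abscissa l"
  shows "scaling_halfplane l \<subseteq> window S"
proof
  fix s assume "s \<in> scaling_halfplane l"
  then have "abscissa l < ereal (Re s)" by (simp add: scaling_halfplane_def)
  with assms[of "Im s"] have "ereal (S (Im s)) < ereal (Re s)" by (rule order.strict_trans1)
  then show "s \<in> window S" by (simp add: window_def)
qed

section \<open>The kernel of the tube formula\<close>

text \<open>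
  The rational factor of the kernel, for general numerators \<open>c k\<close>.
\<close>

definition rational_kernel :: "nat \<Rightarrow> (nat \<Rightarrow> real) \<Rightarrow> complex \<Rightarrow> complex" where
  "rational_kernel d c s = (\<Sum>k<d. of_real (c k) / (s - of_nat k)) / (of_nat d - s)"

lemma norm_rational_kernel_le:
  assumes "\<And>k. k \<le> d \<Longrightarrow> m \<le> norm (s - of_nat k)" "m > 0"
  shows "norm (rational_kernel d c s) \<le> (\<Sum>k<d. \<bar>c k\<bar>) / m\<^sup>2"
proof -
  have "norm (\<Sum>k<d. of_real (c k) / (s - of_nat k)) \<le> (\<Sum>k<d. \<bar>c k\<bar> / m)"
    by (rule sum_norm_le) (use assms in \<open>auto simp: norm_divide intro!: divide_left_mono mult_pos_pos intro: less_le_trans\<close>)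
  also have "\<dots> = (\<Sum>k<d. \<bar>c k\<bar>) / m" by (simp add: sum_divide_distrib)
  finally have 1: "norm (\<Sum>k<d. of_real (c k) / (s - of_nat k)) \<le> (\<Sum>k<d. \<bar>c k\<bar>) / m" .
  have 2: "m \<le> norm (of_nat d - s)" using assms(1)[of d] by (simp add: norm_minus_commute)
  have "norm (rational_kernel d c s) \<le> ((\<Sum>k<d. \<bar>c k\<bar>) / m) / m"
    unfolding rational_kernel_def norm_divide
    using 1 2 assms(2) by (intro frac_le) (auto intro!: divide_nonneg_pos sum_nonneg)
  then show ?thesis by (simp add: power2_eq_square)
qed

lemma norm_diff_nat_ge_Im: "\<bar>Im s\<bar> \<le> norm (s - of_nat k)"
  using abs_Im_le_cmod[of "s - of_nat k"] by simp

lemma norm_diff_nat_ge_Re: "- Re s \<le> norm (s - of_nat k)"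
  using abs_Re_le_cmod[of "s - of_nat k"] by simp

lemma norm_diff_nat_ge_Re': "k \<le> d \<Longrightarrow> Re s - real d \<le> norm (s - of_nat k)"
  using abs_Re_le_cmod[of "s - of_nat k"] by simp

text \<open>
  The factor of the scaling zeta function in the density of the error term.
\<close>

definition tube_kernel :: "nat \<Rightarrow> real \<Rightarrow> real \<Rightarrow> (nat \<Rightarrow> real) \<Rightarrow> complex \<Rightarrow> complex" where
  "tube_kernel d \<epsilon> g \<kappa> s = of_real \<epsilon> powr (of_nat d - s) / (of_nat d - s) *
     (\<Sum>k<d. of_real g powr (s - of_nat k) / (s - of_nat k) * of_nat (d - k) * of_real (\<kappa> k))"

lemma tube_kernel_eq:
  assumes "\<epsilon> > 0" "g > 0"
  shows "tube_kernel d \<epsilon> g \<kappa> s =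
    of_real (\<epsilon> ^ d) * of_real (g / \<epsilon>) powr s * rational_kernel d (\<lambda>k. real (d - k) * \<kappa> k / g ^ k) s"
proof -
  have e: "complex_of_real \<epsilon> powr (of_nat d - s) = of_real (\<epsilon> ^ d) / of_real \<epsilon> powr s"
    using assms by (simp add: powr_diff powr_nat')
  have g: "complex_of_real g powr (s - of_nat k) = of_real g powr s / of_real (g ^ k)" for k
    using assms by (simp add: powr_diff powr_nat')
  have ge: "complex_of_real (g / \<epsilon>) powr s = of_real g powr s / of_real \<epsilon> powr s"
    using assms by (simp add: powr_def Ln_of_real ln_div exp_diff right_diff_distrib del: of_real_divide)
  show ?thesis unfolding tube_kernel_def rational_kernel_def e g ge
    by (simp add: sum_distrib_left sum_distrib_right sum_divide_distrib mult_ac)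
qed

lemma norm_tube_kernel:
  assumes "\<epsilon> > 0" "g > 0"
  shows "norm (tube_kernel d \<epsilon> g \<kappa> s) = \<epsilon> ^ d * (g / \<epsilon>) powr Re s * norm (rational_kernel d (\<lambda>k. real (d - k) * \<kappa> k / g ^ k) s)"
proof -
  have "norm (complex_of_real (g / \<epsilon>) powr s) = (g / \<epsilon>) powr Re s"
    using assms by (subst norm_powr_real_powr) auto
  then show ?thesis using assms by (simp only: tube_kernel_eq[OF assms] norm_mult norm_of_real) simp
qed

text \<open>
  With \<open>V\<close> the volume of the generator, the term belonging to \<open>\<lambda>(G)\<close> in the tubular zeta function
  cancels the term with \<open>k = d\<close> of the Steiner-like sum and distributes over the others.
\<close>

lemma tube_kernel_partial_fractions:
  assumes s: "s \<notin> of_nat ` {..d}" and V: "V = (\<Sum>k\<le>d. \<kappa> k * g ^ (d - k))" and g: "g > 0"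
  shows "tube_kernel d \<epsilon> g \<kappa> s = of_real \<epsilon> powr (of_nat d - s) *
    ((\<Sum>k\<le>d. of_real g powr (s - of_nat k) / (s - of_nat k) * of_real (\<kappa> k))
      - of_real g powr (s - of_nat d) / (s - of_nat d) * of_real V)"
proof -
  have ne: "s - of_nat k \<noteq> 0" if "k \<le> d" for k using s that by auto
  have gp: "complex_of_real g powr (s - of_nat d) * of_real (g ^ (d - k)) = of_real g powr (s - of_nat k)" if "k \<le> d" for k
  proof -
    have "complex_of_real (g ^ (d - k)) = of_real g powr of_nat (d - k)" using g by (simp add: powr_nat')
    then show ?thesis using g that by (simp add: powr_add[symmetric] of_nat_diff)
  qed
  have "of_real g powr (s - of_nat d) / (s - of_nat d) * of_real V
     = (\<Sum>k\<le>d. (of_real g powr (s - of_nat d) * of_real (g ^ (d - k))) / (s - of_nat d) * of_real (\<kappa> k))"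
    unfolding V of_real_sum sum_distrib_left by (intro sum.cong) (auto simp: field_simps)
  also have "\<dots> = (\<Sum>k\<le>d. of_real g powr (s - of_nat k) / (s - of_nat d) * of_real (\<kappa> k))"
    by (intro sum.cong) (auto simp: gp simp del: of_real_power)
  finally have "(\<Sum>k\<le>d. of_real g powr (s - of_nat k) / (s - of_nat k) * of_real (\<kappa> k))
      - of_real g powr (s - of_nat d) / (s - of_nat d) * of_real V
     = (\<Sum>k\<le>d. of_real g powr (s - of_nat k) * of_real (\<kappa> k) * (1 / (s - of_nat k) - 1 / (s - of_nat d)))"
    by (simp add: sum_subtractf[symmetric] algebra_simps)
  also have "\<dots> = (\<Sum>k<d. of_real g powr (s - of_nat k) * of_real (\<kappa> k) * (1 / (s - of_nat k) - 1 / (s - of_nat d)))"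
    by (simp add: lessThan_Suc_atMost[symmetric])
  also have "\<dots> = (\<Sum>k<d. of_real g powr (s - of_nat k) / (s - of_nat k) * of_nat (d - k) * of_real (\<kappa> k) / (of_nat d - s))"
  proof (rule sum.cong[OF refl])
    fix k assume "k \<in> {..<d}"
    then have k: "k \<le> d" by simp
    have "1 / (s - of_nat k) - 1 / (s - of_nat d) = of_nat (d - k) / ((s - of_nat k) * (of_nat d - s))"
    proof -
      have dn: "of_nat d - s \<noteq> 0" using ne[of d] by auto
      have 1: "1 / (s - of_nat d) = - 1 / (of_nat d - s)" by (metis minus_diff_eq minus_divide_left minus_divide_right)
      show ?thesis unfolding 1 using ne[OF k] dn k by (simp add: field_simps of_nat_diff)
    qed
    then show "of_real g powr (s - of_nat k) * of_real (\<kappa> k) * (1 / (s - of_nat k) - 1 / (s - of_nat d))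
      = of_real g powr (s - of_nat k) / (s - of_nat k) * of_nat (d - k) * of_real (\<kappa> k) / (of_nat d - s)" by simp
  qed
  finally have *: "(\<Sum>k\<le>d. of_real g powr (s - of_nat k) / (s - of_nat k) * of_real (\<kappa> k))
      - of_real g powr (s - of_nat d) / (s - of_nat d) * of_real V =
      (\<Sum>k<d. of_real g powr (s - of_nat k) / (s - of_nat k) * of_nat (d - k) * of_real (\<kappa> k) / (of_nat d - s))" .
  show ?thesis unfolding tube_kernel_def * sum_divide_distrib[symmetric] by simp
qed

lemma holomorphic_powr_const: "w \<noteq> 0 \<Longrightarrow> (\<lambda>s. w powr (a + b * s)) holomorphic_on A"
  by (auto simp: powr_def intro!: holomorphic_intros)

lemma tube_kernel_holomorphic:
  assumes "\<epsilon> > 0" "g > 0" "A \<inter> of_nat ` {..d} = {}"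
  shows "tube_kernel d \<epsilon> g \<kappa> holomorphic_on A"
proof -
  have "s - of_nat k \<noteq> 0" if "s \<in> A" "k \<le> d" for s k using assms(3) that by auto
  then have "rational_kernel d c holomorphic_on A" for c unfolding rational_kernel_def[abs_def]
    by (intro holomorphic_on_divide holomorphic_on_sum holomorphic_on_diff holomorphic_on_const holomorphic_on_ident) force+
  moreover have "(\<lambda>s. complex_of_real (g / \<epsilon>) powr s) holomorphic_on A"
    using holomorphic_powr_const[of "of_real (g / \<epsilon>)" 0 1] assms by simp
  ultimately have "(\<lambda>s. of_real (\<epsilon> ^ d) * of_real (g / \<epsilon>) powr s * rational_kernel d (\<lambda>k. real (d - k) * \<kappa> k / g ^ k) s) holomorphic_on A"
    by (intro holomorphic_on_mult holomorphic_on_const)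
  then show ?thesis using tube_kernel_eq[OF assms(1,2)] by (simp add: fun_eq_iff[symmetric] cong: holomorphic_cong)
qed

lemma tube_kernel_meromorphic:
  assumes "\<epsilon> > 0" "g > 0"
  shows "tube_kernel d \<epsilon> g \<kappa> meromorphic_on A"
proof -
  have h: "(\<lambda>s. complex_of_real (g / \<epsilon>) powr s) holomorphic_on UNIV"
    using holomorphic_powr_const[of "of_real (g / \<epsilon>)" 0 1] assms by simp
  have "(\<lambda>s. complex_of_real (g / \<epsilon>) powr s) meromorphic_on A"
    by (intro analytic_on_imp_meromorphic_on) (use h analytic_on_open[OF open_UNIV] analytic_on_subset in blast)
  then have "(\<lambda>s. of_real (\<epsilon> ^ d) * of_real (g / \<epsilon>) powr s * rational_kernel d (\<lambda>k. real (d - k) * \<kappa> k / g ^ k) s) meromorphic_on A"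
    unfolding rational_kernel_def by (intro meromorphic_intros)
  moreover have "tube_kernel d \<epsilon> g \<kappa> = (\<lambda>s. of_real (\<epsilon> ^ d) * of_real (g / \<epsilon>) powr s * rational_kernel d (\<lambda>k. real (d - k) * \<kappa> k / g ^ k) s)"
    using tube_kernel_eq[OF assms] by blast
  ultimately show ?thesis by simp
qed

lemma residue_simple_fractions:
  fixes q :: "nat \<Rightarrow> complex \<Rightarrow> complex"
  assumes q: "\<And>k. k \<le> d \<Longrightarrow> q k holomorphic_on UNIV"
  shows "m \<le> d \<Longrightarrow> residue (\<lambda>s. \<Sum>k\<le>d. q k s / (s - of_nat k)) (of_nat m) = q m (of_nat m)"
    and "z \<notin> of_nat ` {..d} \<Longrightarrow> residue (\<lambda>s. \<Sum>k\<le>d. q k s / (s - of_nat k)) z = 0"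
    and "(\<lambda>s. \<Sum>k\<le>d. q k s / (s - of_nat k)) holomorphic_on (- of_nat ` {..d})"
    and "(\<lambda>s. \<Sum>k\<le>d. q k s / (s - of_nat k)) meromorphic_on A"
proof -
  have h: "(\<lambda>s. \<Sum>k\<in>K. q k s / (s - of_nat k)) holomorphic_on (- of_nat ` K)" if "K \<subseteq> {..d}" for K
    using that by (intro holomorphic_on_sum holomorphic_on_divide holomorphic_on_diff holomorphic_on_const holomorphic_on_ident
      holomorphic_on_subset[OF q]) auto
  show holo: "(\<lambda>s. \<Sum>k\<le>d. q k s / (s - of_nat k)) holomorphic_on (- of_nat ` {..d})" by (rule h) simp
  have op: "open (- (of_nat ` K :: complex set))" if "finite K" for K :: "nat set"
    using that by (intro open_Compl finite_imp_closed) auto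
  show "z \<notin> of_nat ` {..d} \<Longrightarrow> residue (\<lambda>s. \<Sum>k\<le>d. q k s / (s - of_nat k)) z = 0"
    by (rule residue_holo[OF op _ holo]) auto
  show "(\<lambda>s. \<Sum>k\<le>d. q k s / (s - of_nat k)) meromorphic_on A"
  proof (intro meromorphic_on_sum meromorphic_on_divide meromorphic_on_diff meromorphic_on_const meromorphic_on_id)
    fix k assume "k \<in> {..d}"
    then have "q k analytic_on UNIV" using q analytic_on_open[OF open_UNIV] by blast
    then show "q k meromorphic_on A" by (intro analytic_on_imp_meromorphic_on) (rule analytic_on_subset, auto)
  qed
  assume m: "m \<le> d"
  have eq: "(\<lambda>s. \<Sum>k\<le>d. q k s / (s - of_nat k)) = (\<lambda>s. q m s / (s - of_nat m) + (\<Sum>k\<in>{..d} - {m}. q k s / (s - of_nat k)))"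
    using m by (auto simp: sum.remove[of "{..d}" m])
  let ?A = "- (of_nat ` ({..d} - {m}) :: complex set)"
  have A: "open ?A" "of_nat m \<in> ?A" by (rule op) auto
  have h2: "(\<lambda>s. \<Sum>k\<in>{..d} - {m}. q k s / (s - of_nat k)) holomorphic_on ?A" by (rule h) auto
  have h1: "(\<lambda>s. q m s / (s - of_nat m)) holomorphic_on ?A - {of_nat m}"
    by (intro holomorphic_on_divide holomorphic_on_diff holomorphic_on_const holomorphic_on_ident
      holomorphic_on_subset[OF q[OF m]]) auto
  show "residue (\<lambda>s. \<Sum>k\<le>d. q k s / (s - of_nat k)) (of_nat m) = q m (of_nat m)"
    unfolding eq using residue_add[OF A h1 holomorphic_on_subset[OF h2]] residue_holo[OF A h2]
      residue_simple[OF open_UNIV UNIV_I q[OF m]] by auto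
qed

section \<open>Growth estimates\<close>

lemma powr_le_exp: "x > 0 \<Longrightarrow> \<bar>y\<bar> \<le> B \<Longrightarrow> x powr y \<le> exp (\<bar>ln x\<bar> * B)" for x y B :: real
proof -
  assume "x > 0" "\<bar>y\<bar> \<le> B"
  have "y * ln x \<le> \<bar>y\<bar> * \<bar>ln x\<bar>" by (metis abs_ge_self abs_mult)
  also have "\<dots> \<le> B * \<bar>ln x\<bar>" using \<open>\<bar>y\<bar> \<le> B\<close> by (intro mult_right_mono) auto
  finally show ?thesis using \<open>x > 0\<close> by (simp add: powr_def mult.commute)
qed

lemma one_plus_le_double_powr:
  fixes t q :: real
  assumes "\<bar>t\<bar> \<ge> 1"
  shows "\<bar>t\<bar> powr q \<le> 2 powr \<bar>q\<bar> * (1 + \<bar>t\<bar>) powr q"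
proof (cases "q \<ge> 0")
  case True
  have "\<bar>t\<bar> powr q \<le> 1 * (1 + \<bar>t\<bar>) powr q" using True by (simp add: powr_mono2)
  also have "\<dots> \<le> 2 powr \<bar>q\<bar> * (1 + \<bar>t\<bar>) powr q" by (intro mult_right_mono ge_one_powr_ge_zero) auto
  finally show ?thesis .
next
  case False
  have "\<bar>t\<bar> powr q \<le> ((1 + \<bar>t\<bar>) / 2) powr q" using False assms by (intro powr_mono2') auto
  also have "\<dots> = 2 powr \<bar>q\<bar> * (1 + \<bar>t\<bar>) powr q" using False by (simp add: powr_divide powr_minus field_simps)
  finally show ?thesis .
qed

lemma inverse_square_le:
  fixes t :: real
  assumes "\<bar>t\<bar> \<ge> 1"
  shows "1 / t\<^sup>2 \<le> 4 * (1 + \<bar>t\<bar>) powr - 2"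
proof -
  have "(1 + \<bar>t\<bar>)\<^sup>2 \<le> (2 * \<bar>t\<bar>)\<^sup>2" using assms by (intro power_mono) auto
  then have "(1 + \<bar>t\<bar>)\<^sup>2 \<le> 4 * t\<^sup>2" by (simp add: power_mult_distrib)
  moreover have "t\<^sup>2 > 0" using assms by auto
  moreover have "(1 + \<bar>t\<bar>)\<^sup>2 > 0" by (rule zero_less_power) simp
  ultimately have "1 / t\<^sup>2 \<le> 4 * (1 / (1 + \<bar>t\<bar>)\<^sup>2)" by (simp add: divide_simps)
  moreover have "(1 + \<bar>t\<bar>) powr - 2 = 1 / (1 + \<bar>t\<bar>)\<^sup>2" by (simp add: powr_minus powr_numeral inverse_eq_divide)
  ultimately show ?thesis by simp
qed

text \<open>
  The size of the integrand at the height \<open>X n\<close>, up to a constant.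
\<close>

lemma tendsto_height_factor:
  fixes X :: "nat \<Rightarrow> real"
  assumes X: "filterlim (\<lambda>n. \<bar>X n\<bar>) at_top sequentially" and q: "q < 2"
  shows "(\<lambda>n. (\<bar>X n\<bar> + 1) powr q / (X n)\<^sup>2) \<longlonglongrightarrow> 0"
proof (rule Lim_null_comparison)
  show "\<forall>\<^sub>F n in sequentially. norm ((\<bar>X n\<bar> + 1) powr q / (X n)\<^sup>2) \<le> 4 * (1 + \<bar>X n\<bar>) powr (q - 2)"
  proof -
    have "\<forall>\<^sub>F n in sequentially. 1 \<le> \<bar>X n\<bar>" using X by (simp add: filterlim_at_top)
    then show ?thesis
    proof eventually_elim
      case (elim n)
      have "norm ((\<bar>X n\<bar> + 1) powr q / (X n)\<^sup>2) = (1 + \<bar>X n\<bar>) powr q * (1 / (X n)\<^sup>2)" by (simp add: add.commute)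
      also have "\<dots> \<le> (1 + \<bar>X n\<bar>) powr q * (4 * (1 + \<bar>X n\<bar>) powr - 2)" by (intro mult_left_mono inverse_square_le elim) auto
      also have "\<dots> = 4 * (1 + \<bar>X n\<bar>) powr (q - 2)" by (simp add: powr_add[symmetric])
      finally show ?case .
    qed
  qed
  have "((\<lambda>x::real. x powr (q - 2)) \<longlongrightarrow> 0) at_top" using q by (intro tendsto_neg_powr filterlim_ident) auto
  then have "(\<lambda>n. (1 + \<bar>X n\<bar>) powr (q - 2)) \<longlonglongrightarrow> 0"
    by (rule filterlim_compose) (rule filterlim_tendsto_add_at_top[OF tendsto_const X])
  then show "(\<lambda>n. 4 * (1 + \<bar>X n\<bar>) powr (q - 2)) \<longlonglongrightarrow> 0" by (rule tendsto_mult_right_zero)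
qed

lemma filterlim_heights:
  assumes "languid_heights T"
  shows "filterlim (\<lambda>n. \<bar>T (int n)\<bar>) at_top sequentially" "filterlim (\<lambda>n. \<bar>T (- int n)\<bar>) at_top sequentially"
proof -
  have 1: "filterlim (\<lambda>n. T (int n)) at_top sequentially" and 2: "filterlim (\<lambda>n. T (- int n)) at_bot sequentially"
    using assms by (auto simp: languid_heights_def)
  show "filterlim (\<lambda>n. \<bar>T (int n)\<bar>) at_top sequentially"
    by (rule filterlim_at_top_mono[OF 1]) (intro eventuallyI abs_ge_self)
  have "filterlim (\<lambda>n. - T (- int n)) at_top sequentially" using 2 by (simp add: filterlim_uminus_at_bot)
  then show "filterlim (\<lambda>n. \<bar>T (- int n)\<bar>) at_top sequentially"
    by (rule filterlim_at_top_mono) (intro eventuallyI, simp)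
qed

section \<open>Tubular zeta function and volume of a spray\<close>

text \<open>
  A fractal spray of a fractal string with greatest length \<open>1\<close>, whose generator has a Steiner-like
  representation, and whose abscissa of convergence lies below the dimension.
\<close>

locale fractal_tube =
  fixes l :: "nat \<Rightarrow> real" and G :: "'a::euclidean_space set" and Gs :: "nat \<Rightarrow> 'a set"
    and \<kappa> :: "nat \<Rightarrow> real \<Rightarrow> real"
  assumes spray: "fractal_spray l G Gs" and first: "l 0 = 1"
    and steiner: "steiner_like G \<kappa>" and abscissa: "abscissa l < ereal (real DIM('a))"

context fractal_tube
begin

abbreviation "g \<equiv> inradius G"
abbreviation "vol \<equiv> measure lebesgue G"
abbreviation "ext_coeff k x \<equiv> steiner_coeff G \<kappa> k x"
abbreviation "tkernel \<epsilon> \<equiv> tube_kernel DIM('a) \<epsilon> g (\<lambda>k. \<kappa> k g)"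

lemma string_l: "fractal_string l" and generator_G: "generator G"
  using spray by (auto simp: fractal_spray_def)

lemma l_pos: "0 < l j"
  using fractal_string_le_1[OF string_l first] by auto

lemma g_pos: "0 < g" by (rule inradius_pos[OF generator_G])

lemma vol_eq: "vol = (\<Sum>k\<le>DIM('a). \<kappa> k g * g ^ (DIM('a) - k))"
  using steiner g_pos parallel_volume_ge_inradius[OF generator_G, of g] unfolding steiner_like_def by force

lemma summable_power_dim: "summable (\<lambda>j. l j ^ DIM('a))"
  using summable_right_of_abscissa[OF string_l abscissa] l_pos by (simp add: powr_realpow)

text \<open>
  The pieces of inradius greater than \<open>\<epsilon>\<close>; the others coincide with their inner parallel sets.
\<close>

definition large :: "real \<Rightarrow> nat set" where "large \<epsilon> = {j. \<epsilon> < l j * g}"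

lemma finite_large: "\<epsilon> > 0 \<Longrightarrow> finite (large \<epsilon>)"
proof -
  assume "\<epsilon> > 0"
  have "l \<longlonglongrightarrow> 0" using string_l by (simp add: fractal_string_def)
  then have "\<forall>\<^sub>F j in sequentially. l j < \<epsilon> / g"
    by (rule order_tendstoD) (use g_pos \<open>\<epsilon> > 0\<close> in simp)
  then obtain N where "\<And>j. j \<ge> N \<Longrightarrow> l j < \<epsilon> / g" by (auto simp: eventually_sequentially)
  then have "large \<epsilon> \<subseteq> {..<N}" using g_pos by (auto simp: large_def field_simps) (meson not_less order_less_asym)
  then show ?thesis by (rule finite_subset) simp
qed

lemma ext_coeff_small: "j \<notin> large \<epsilon> \<Longrightarrow> ext_coeff k (\<epsilon> / l j) = \<kappa> k g"
proof -
  assume "j \<notin> large \<epsilon>"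
  then have "g \<le> \<epsilon> / l j" using l_pos[of j] by (simp add: large_def field_simps)
  then show ?thesis by (auto simp: steiner_coeff_def)
qed

lemma error_density_eq: "error_density l G \<kappa> W \<epsilon> s = tkernel \<epsilon> s * scaling_zeta l W s"
  by (simp add: error_density_def tube_kernel_def steiner_coeff_def sum_distrib_left field_simps)

text \<open>
  The part of the scaling zeta function that belongs to the large pieces.
\<close>

definition finite_zeta :: "real \<Rightarrow> complex \<Rightarrow> complex" where
  "finite_zeta \<epsilon> s = (\<Sum>j\<in>large \<epsilon>. of_real (l j) powr s)"

text \<open>
  The numerators of the partial fractions of \<open>correction\<close> below.
\<close>

definition correction_numerator :: "real \<Rightarrow> nat \<Rightarrow> complex \<Rightarrow> complex" where
  "correction_numerator \<epsilon> k s = of_real \<epsilon> powr (of_nat DIM('a) - s) *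
     (\<Sum>j\<in>large \<epsilon>. of_real (l j) powr s * (of_real g powr (s - of_nat k) * of_real (ext_coeff k (\<epsilon> / l j) - \<kappa> k g)))"

text \<open>
  The difference between the tubular zeta function and \<open>tkernel * \<zeta>\<close>. It collects, over the large
  pieces, the differences between the Steiner-like coefficients at \<open>\<epsilon> / l j\<close> and those at \<open>g\<close>.
\<close>

definition correction :: "real \<Rightarrow> complex \<Rightarrow> complex" where
  "correction \<epsilon> s = (\<Sum>k\<le>DIM('a). correction_numerator \<epsilon> k s / (s - of_nat k))"

lemma holomorphic_powr_real:
  assumes "x > 0"
  shows "(\<lambda>s. complex_of_real x powr s) holomorphic_on A" 
    and "(\<lambda>s. complex_of_real x powr (s - c)) holomorphic_on A" 
    and "(\<lambda>s. complex_of_real x powr (c - s)) holomorphic_on A"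
  using holomorphic_powr_const[of "of_real x" 0 1] holomorphic_powr_const[of "of_real x" "-c" 1]
    holomorphic_powr_const[of "of_real x" c "-1"] assms by auto

lemma correction_numerator_holomorphic: "\<epsilon> > 0 \<Longrightarrow> correction_numerator \<epsilon> k holomorphic_on A"
  unfolding correction_numerator_def[abs_def]
  by (intro holomorphic_on_mult holomorphic_on_sum holomorphic_powr_real l_pos g_pos holomorphic_on_const) auto

lemma residue_correction:
  assumes "\<epsilon> > 0"
  shows "m \<le> DIM('a) \<Longrightarrow> residue (correction \<epsilon>) (of_nat m) =
      (\<Sum>j\<in>large \<epsilon>. of_real ((ext_coeff m (\<epsilon> / l j) - \<kappa> m g) * \<epsilon> ^ (DIM('a) - m) * l j ^ m))"
    and "z \<notin> of_nat ` {..DIM('a)} \<Longrightarrow> residue (correction \<epsilon>) z = 0"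
    and "correction \<epsilon> meromorphic_on A"
    and "correction \<epsilon> holomorphic_on (- of_nat ` {..DIM('a)})"
proof -
  note r = residue_simple_fractions[where q="correction_numerator \<epsilon>" and d="DIM('a)", OF correction_numerator_holomorphic[OF assms]]
  show "z \<notin> of_nat ` {..DIM('a)} \<Longrightarrow> residue (correction \<epsilon>) z = 0" "correction \<epsilon> meromorphic_on A"
    "correction \<epsilon> holomorphic_on (- of_nat ` {..DIM('a)})"
    using r(2-4) unfolding correction_def[abs_def] by auto
  assume m: "m \<le> DIM('a)"
  have "residue (correction \<epsilon>) (of_nat m) = correction_numerator \<epsilon> m (of_nat m)"
    using r(1)[OF m] unfolding correction_def[abs_def] .
  also have "\<dots> = of_real (\<epsilon> ^ (DIM('a) - m)) * (\<Sum>j\<in>large \<epsilon>. of_real (l j ^ m) * of_real (ext_coeff m (\<epsilon> / l j) - \<kappa> m g))"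
  proof -
    have "complex_of_real \<epsilon> powr (of_nat DIM('a) - of_nat m) = of_real (\<epsilon> ^ (DIM('a) - m))"
      using assms m by (simp add: powr_nat' flip: of_nat_diff)
    moreover have "complex_of_real (l j) powr of_nat m = of_real (l j ^ m)" for j
      using l_pos[of j] by (simp add: powr_nat')
    ultimately show ?thesis using g_pos by (simp add: correction_numerator_def)
  qed
  also have "\<dots> = (\<Sum>j\<in>large \<epsilon>. of_real ((ext_coeff m (\<epsilon> / l j) - \<kappa> m g) * \<epsilon> ^ (DIM('a) - m) * l j ^ m))"
    unfolding sum_distrib_left by (intro sum.cong) (auto simp: mult_ac)
  finally show "residue (correction \<epsilon>) (of_nat m) =
      (\<Sum>j\<in>large \<epsilon>. of_real ((ext_coeff m (\<epsilon> / l j) - \<kappa> m g) * \<epsilon> ^ (DIM('a) - m) * l j ^ m))" .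
qed

lemma sum_residue_correction:
  assumes "\<epsilon> > 0" "finite P" "of_nat ` {..DIM('a)} \<subseteq> P"
  shows "(\<Sum>w\<in>P. residue (correction \<epsilon>) w) = (\<Sum>m\<le>DIM('a). residue (correction \<epsilon>) (of_nat m))"
proof -
  have "(\<Sum>w\<in>P. residue (correction \<epsilon>) w) = (\<Sum>w\<in>of_nat ` {..DIM('a)}. residue (correction \<epsilon>) w)"
    by (rule sum.mono_neutral_right) (use assms residue_correction(2) in auto)
  also have "\<dots> = (\<Sum>m\<le>DIM('a). residue (correction \<epsilon>) (of_nat m))"
    by (subst sum.reindex) (auto simp: inj_on_def)
  finally show ?thesis .
qed

lemma tubular_series_eq:
  assumes \<epsilon>: "\<epsilon> > 0" and s: "s \<in> scaling_halfplane l" "s \<notin> of_nat ` {..DIM('a)}"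
  shows "tubular_series l G \<kappa> \<epsilon> s = tkernel \<epsilon> s * scaling_series l s + correction \<epsilon> s"
proof -
  define h where "h = (\<Sum>k\<le>DIM('a). complex_of_real g powr (s - of_nat k) / (s - of_nat k) * of_real (\<kappa> k g))
      - of_real g powr (s - of_nat DIM('a)) / (s - of_nat DIM('a)) * of_real vol"
  define \<Delta> where "\<Delta> = (\<lambda>j. \<Sum>k\<le>DIM('a). complex_of_real g powr (s - of_nat k) / (s - of_nat k) * of_real (ext_coeff k (\<epsilon> / l j) - \<kappa> k g))"
  have \<Delta>0: "\<Delta> j = 0" if "j \<notin> large \<epsilon>" for j using ext_coeff_small[OF that] by (simp add: \<Delta>_def)
  have term_eq: "of_real (l j) powr s * ((\<Sum>k\<le>DIM('a). of_real g powr (s - of_nat k) / (s - of_nat k) * of_real (ext_coeff k (\<epsilon> / l j)))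
         - of_real g powr (s - of_nat DIM('a)) / (s - of_nat DIM('a)) * of_real vol)
      = of_real (l j) powr s * h + of_real (l j) powr s * \<Delta> j" for j
    unfolding h_def \<Delta>_def of_real_diff right_diff_distrib sum_subtractf by (simp add: algebra_simps)
  have summ: "summable (\<lambda>j. complex_of_real (l j) powr s)"
  proof -
    obtain \<sigma> where "abscissa l < ereal \<sigma>" "\<sigma> < Re s"
      using s ereal_dense2[of "abscissa l" "ereal (Re s)"] by (auto simp: scaling_halfplane_def)
    then show ?thesis using summable_scaling[OF string_l first] by auto
  qed
  have s2: "(\<lambda>j. of_real (l j) powr s * \<Delta> j) sums (\<Sum>j\<in>large \<epsilon>. of_real (l j) powr s * \<Delta> j)"
    by (rule sums_finite[OF finite_large[OF \<epsilon>]]) (use \<Delta>0 in auto)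
  have "(\<lambda>j. of_real (l j) powr s * h + of_real (l j) powr s * \<Delta> j) sums
     (scaling_series l s * h + (\<Sum>j\<in>large \<epsilon>. of_real (l j) powr s * \<Delta> j))"
    unfolding scaling_series_def by (intro sums_add s2 sums_mult2 summable_sums summ)
  then have "tubular_series l G \<kappa> \<epsilon> s = of_real \<epsilon> powr (of_nat DIM('a) - s) *
     (scaling_series l s * h + (\<Sum>j\<in>large \<epsilon>. of_real (l j) powr s * \<Delta> j))"
    unfolding tubular_series_def term_eq by (simp add: sums_unique[symmetric])
  moreover have "tkernel \<epsilon> s = of_real \<epsilon> powr (of_nat DIM('a) - s) * h"
    unfolding h_def by (rule tube_kernel_partial_fractions[OF s(2) vol_eq g_pos])
  moreover have "correction \<epsilon> s = of_real \<epsilon> powr (of_nat DIM('a) - s) * (\<Sum>j\<in>large \<epsilon>. of_real (l j) powr s * \<Delta> j)"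
    unfolding correction_def correction_numerator_def \<Delta>_def sum_distrib_left sum_divide_distrib
    by (subst sum.swap) (simp add: mult_ac)
  ultimately show ?thesis by (simp add: algebra_simps)
qed

lemma right_halfplane_subset: "{s. real DIM('a) \<le> Re s} \<subseteq> scaling_halfplane l"
  using abscissa by (auto simp: scaling_halfplane_def intro: less_le_trans)

lemma continuation_meromorphic_at:
  assumes F: "is_continuation (scaling_series l) (scaling_halfplane l) W F" and w: "w \<in> W"
  shows "F meromorphic_on {w}"
  using nicely_meromorphic_on_subset[OF is_continuation_nicely[OF F], of "{w}"] w by (auto simp: nicely_meromorphic_on_def)

text \<open>
  After removing singularities, \<open>tkernel * F + correction\<close> is itself a continuation of the tubular series,
  hence agrees with the chosen one near every point of \<open>W\<close>.
\<close>

lemma residue_tubular_zeta: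
  assumes \<epsilon>: "\<epsilon> > 0" and F: "is_continuation (scaling_series l) (scaling_halfplane l) W F"
    and W: "connected W" "scaling_halfplane l \<subseteq> W" and w: "w \<in> W"
  shows "residue (tubular_zeta l G \<kappa> W \<epsilon>) w = residue (\<lambda>s. tkernel \<epsilon> s * F s) w + residue (correction \<epsilon>) w"
proof -
  define M where "M = (\<lambda>s. tkernel \<epsilon> s * F s + correction \<epsilon> s)"
  let ?A = "scaling_halfplane l - of_nat ` {..DIM('a)}"
  obtain U where U: "open U" "connected U" "W \<subseteq> U" "F nicely_meromorphic_on U"
    using F unfolding is_continuation_def by blast
  have M: "M meromorphic_on U" unfolding M_def
    using U(4) by (intro meromorphic_on_add meromorphic_on_mult tube_kernel_meromorphic residue_correction \<epsilon> g_pos)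
      (auto simp: nicely_meromorphic_on_def)
  have an: "M analytic_on {s}" if s: "s \<in> ?A" for s
  proof -
    let ?B = "- (of_nat ` {..DIM('a)}) :: complex set"
    have op: "open ?B" by (intro open_Compl finite_imp_closed) auto
    have "tkernel \<epsilon> analytic_on {s}"
      using tube_kernel_holomorphic[OF \<epsilon> g_pos, of ?B "DIM('a)" "\<lambda>k. \<kappa> k g"] op s unfolding analytic_at by auto
    moreover have "correction \<epsilon> analytic_on {s}"
      using residue_correction(4)[OF \<epsilon>] op s unfolding analytic_at by auto
    moreover have "F analytic_on {s}" using continuation_analytic[OF string_l first F W(2)] s by auto
    ultimately show ?thesis unfolding M_def by (intro analytic_intros)
  qed
  have "is_continuation (tubular_series l G \<kappa> \<epsilon>) ?A W (remove_sings M)"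
    unfolding is_continuation_def
  proof (intro conjI exI ballI)
    show "remove_sings M nicely_meromorphic_on U" by (rule remove_sings_nicely_meromorphic[OF M])
    fix s assume s: "s \<in> ?A"
    have "remove_sings M s = M s" by (rule remove_sings_at_analytic[OF an[OF s]])
    also have "\<dots> = tubular_series l G \<kappa> \<epsilon> s"
      using tubular_series_eq[OF \<epsilon>, of s] s continuation_eq_series[OF string_l first F W(2), of s] by (auto simp: M_def)
    finally show "remove_sings M s = tubular_series l G \<kappa> \<epsilon> s" .
  qed (use U in auto)
  moreover from this have "is_continuation (tubular_series l G \<kappa> \<epsilon>) ?A W (tubular_zeta l G \<kappa> W \<epsilon>)"
    unfolding tubular_zeta_def by (rule continuation_is_continuation)
  ultimately have "\<forall>\<^sub>F z in nhds w. tubular_zeta l G \<kappa> W \<epsilon> z = remove_sings M z"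
  proof (intro continuation_unique[of "tubular_series l G \<kappa> \<epsilon>" ?A W _ _ "{s. real DIM('a) < Re s}" "of_nat (Suc DIM('a))"])
    show "{s. real DIM('a) < Re s} \<subseteq> ?A" using right_halfplane_subset by auto
    then show "{s. real DIM('a) < Re s} \<subseteq> W" using W by auto
  qed (use W w in \<open>auto intro: open_halfspace_Re_gt\<close>)
  then have "residue (tubular_zeta l G \<kappa> W \<epsilon>) w = residue (remove_sings M) w"
    by (intro residue_cong refl) (auto simp: eventually_nhds_conv_at)
  also have "\<dots> = residue M w" using M U(3) w
    by (intro residue_remove_sings) (use meromorphic_on_isolated_singularity[OF meromorphic_on_subset[OF M]] U(3) w in auto)
  also have "\<dots> = residue (\<lambda>s. tkernel \<epsilon> s * F s) w + residue (correction \<epsilon>) w"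
    unfolding M_def using continuation_meromorphic_at[OF F w]
    by (intro residue_add_meromorphic meromorphic_on_mult tube_kernel_meromorphic residue_correction \<epsilon> g_pos)
  finally show ?thesis .
qed

lemma parallel_volume_small:
  "\<epsilon> > 0 \<Longrightarrow> j \<notin> large \<epsilon> \<Longrightarrow> parallel_volume G (\<epsilon> / l j) = vol"
  using l_pos[of j] by (intro parallel_volume_ge_inradius generator_G) (simp add: large_def field_simps)

lemma parallel_volume_large:
  assumes "\<epsilon> > 0" "j \<in> large \<epsilon>"
  shows "l j ^ DIM('a) * parallel_volume G (\<epsilon> / l j) = (\<Sum>k\<le>DIM('a). ext_coeff k (\<epsilon> / l j) * \<epsilon> ^ (DIM('a) - k) * l j ^ k)"
proof -
  have 1: "0 < \<epsilon> / l j" "\<epsilon> / l j \<le> g" using assms l_pos[of j] by (auto simp: large_def field_simps)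
  then have "parallel_volume G (\<epsilon> / l j) = (\<Sum>k\<le>DIM('a). ext_coeff k (\<epsilon> / l j) * (\<epsilon> / l j) ^ (DIM('a) - k))"
    using steiner by (simp add: steiner_like_def steiner_coeff_def)
  also have "l j ^ DIM('a) * \<dots> = (\<Sum>k\<le>DIM('a). ext_coeff k (\<epsilon> / l j) * \<epsilon> ^ (DIM('a) - k) * l j ^ k)"
    unfolding sum_distrib_left
  proof (rule sum.cong[OF refl])
    fix k assume "k \<in> {..DIM('a)}"
    then have "l j ^ DIM('a) = l j ^ k * l j ^ (DIM('a) - k)" by (simp add: power_add[symmetric])
    then show "l j ^ DIM('a) * (ext_coeff k (\<epsilon> / l j) * (\<epsilon> / l j) ^ (DIM('a) - k)) = ext_coeff k (\<epsilon> / l j) * \<epsilon> ^ (DIM('a) - k) * l j ^ k"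
      using l_pos[of j] by (simp add: power_divide)
  qed
  finally show ?thesis .
qed

text \<open>
  The sum over the large pieces of the inner parallel volume as it would be with the Steiner-like
  coefficients at \<open>g\<close>, minus the volume of the piece.
\<close>

definition main_part :: "real \<Rightarrow> real" where
  "main_part \<epsilon> = (\<Sum>j\<in>large \<epsilon>. (\<Sum>k\<le>DIM('a). \<kappa> k g * \<epsilon> ^ (DIM('a) - k) * l j ^ k) - vol * l j ^ DIM('a))"

lemma volume_eq:
  assumes \<epsilon>: "\<epsilon> > 0"
  shows "complex_of_real (parallel_volume (\<Union>j. Gs j) \<epsilon>) =
     of_real (main_part \<epsilon>) + (\<Sum>m\<le>DIM('a). residue (correction \<epsilon>) (of_nat m)) + of_real (vol * (\<Sum>j. l j ^ DIM('a)))"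
proof -
  have 1: "(\<lambda>j. l j ^ DIM('a) * parallel_volume G (\<epsilon> / l j)) sums parallel_volume (\<Union>j. Gs j) \<epsilon>"
    by (rule parallel_volume_spray[OF spray summable_power_dim])
  have "(\<lambda>j. vol * l j ^ DIM('a) + (if j \<in> large \<epsilon> then l j ^ DIM('a) * parallel_volume G (\<epsilon> / l j) - vol * l j ^ DIM('a) else 0)) sums
     (vol * (\<Sum>j. l j ^ DIM('a)) + (\<Sum>j\<in>large \<epsilon>. l j ^ DIM('a) * parallel_volume G (\<epsilon> / l j) - vol * l j ^ DIM('a)))"
    by (intro sums_add sums_mult summable_sums summable_power_dim sums_If_finite_set finite_large \<epsilon>)
  moreover have "vol * l j ^ DIM('a) + (if j \<in> large \<epsilon> then l j ^ DIM('a) * parallel_volume G (\<epsilon> / l j) - vol * l j ^ DIM('a) else 0)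
      = l j ^ DIM('a) * parallel_volume G (\<epsilon> / l j)" for j
    using parallel_volume_small[OF \<epsilon>, of j] by auto
  ultimately have "parallel_volume (\<Union>j. Gs j) \<epsilon> = vol * (\<Sum>j. l j ^ DIM('a)) + (\<Sum>j\<in>large \<epsilon>. l j ^ DIM('a) * parallel_volume G (\<epsilon> / l j) - vol * l j ^ DIM('a))"
    using sums_unique2[OF 1] by simp
  also have "(\<Sum>j\<in>large \<epsilon>. l j ^ DIM('a) * parallel_volume G (\<epsilon> / l j) - vol * l j ^ DIM('a))
     = (\<Sum>j\<in>large \<epsilon>. (\<Sum>k\<le>DIM('a). \<kappa> k g * \<epsilon> ^ (DIM('a) - k) * l j ^ k) - vol * l j ^ DIM('a) + (\<Sum>k\<le>DIM('a). (ext_coeff k (\<epsilon> / l j) - \<kappa> k g) * \<epsilon> ^ (DIM('a) - k) * l j ^ k))"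
    by (intro sum.cong) (auto simp: parallel_volume_large[OF \<epsilon>] left_diff_distrib sum_subtractf)
  also have "\<dots> = main_part \<epsilon> + (\<Sum>k\<le>DIM('a). \<Sum>j\<in>large \<epsilon>. (ext_coeff k (\<epsilon> / l j) - \<kappa> k g) * \<epsilon> ^ (DIM('a) - k) * l j ^ k)"
    unfolding main_part_def sum.distrib by (subst sum.swap[of _ "{..DIM('a)}"]) simp
  finally have "parallel_volume (\<Union>j. Gs j) \<epsilon> = main_part \<epsilon> + (\<Sum>k\<le>DIM('a). \<Sum>j\<in>large \<epsilon>. (ext_coeff k (\<epsilon> / l j) - \<kappa> k g) * \<epsilon> ^ (DIM('a) - k) * l j ^ k) + vol * (\<Sum>j. l j ^ DIM('a))"
    by simp
  then show ?thesis using residue_correction(1)[OF \<epsilon>] by simp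
qed

section \<open>The integral over the line to the right of all poles\<close>

text \<open>
  The constant in the quadratic decay of the kernel.
\<close>

definition kernel_const :: real where "kernel_const = (\<Sum>k<DIM('a). \<bar>real (DIM('a) - k) * \<kappa> k g / g ^ k\<bar>)"

lemma kernel_const_nonneg: "kernel_const \<ge> 0" unfolding kernel_const_def by (rule sum_nonneg) simp

lemma kernel_bound:
  assumes "\<epsilon> > 0" "m > 0" "\<And>k. k \<le> DIM('a) \<Longrightarrow> m \<le> norm (s - of_nat k)"
  shows "norm (tkernel \<epsilon> s) \<le> \<epsilon> ^ DIM('a) * (g / \<epsilon>) powr Re s * (kernel_const / m\<^sup>2)"
  unfolding norm_tube_kernel[OF assms(1) g_pos] kernel_const_def
  by (intro mult_left_mono norm_rational_kernel_le assms) (use assms in auto)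

lemma kernel_bound':
  assumes "\<epsilon> > 0" "m > 0" "m \<le> \<bar>Im s\<bar> \<or> m \<le> - Re s \<or> m \<le> Re s - real DIM('a)"
  shows "norm (tkernel \<epsilon> s) \<le> \<epsilon> ^ DIM('a) * (g / \<epsilon>) powr Re s * (kernel_const / m\<^sup>2)"
  by (rule kernel_bound[OF assms(1,2)])
     (use assms(3) norm_diff_nat_ge_Im[of s] norm_diff_nat_ge_Re[of s] norm_diff_nat_ge_Re'[of _ "DIM('a)" s] in \<open>auto intro: order_trans\<close>)

lemma finite_zeta_holomorphic: "finite_zeta \<epsilon> holomorphic_on A"
  unfolding finite_zeta_def[abs_def] by (intro holomorphic_on_sum holomorphic_powr_real l_pos)

lemma residue_finite_part:
  assumes \<epsilon>: "\<epsilon> > 0" and m: "m \<le> DIM('a)"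
  shows "residue (\<lambda>s. tkernel \<epsilon> s * finite_zeta \<epsilon> s) (of_nat m) =
    of_real (\<epsilon> ^ (DIM('a) - m) * \<kappa> m g * (\<Sum>j\<in>large \<epsilon>. l j ^ m) - (if m = DIM('a) then vol * (\<Sum>j\<in>large \<epsilon>. l j ^ DIM('a)) else 0))"
proof -
  define q where "q = (\<lambda>k s. complex_of_real \<epsilon> powr (of_nat DIM('a) - s) * finite_zeta \<epsilon> s *
     (of_real g powr (s - of_nat k) * of_real (\<kappa> k g) - (if k = DIM('a) then of_real g powr (s - of_nat DIM('a)) * of_real vol else 0)))"
  have q: "q k holomorphic_on UNIV" for k
  proof (cases "k = DIM('a)")
    case True
    then show ?thesis unfolding q_def
      by (auto intro!: holomorphic_on_mult holomorphic_on_diff finite_zeta_holomorphic holomorphic_powr_real \<epsilon> g_pos)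
  next
    case False
    then show ?thesis unfolding q_def
      by (auto intro!: holomorphic_on_mult holomorphic_on_diff finite_zeta_holomorphic holomorphic_powr_real \<epsilon> g_pos)
  qed
  have eq: "tkernel \<epsilon> s * finite_zeta \<epsilon> s = (\<Sum>k\<le>DIM('a). q k s / (s - of_nat k))" if "s \<notin> (of_nat ` {..DIM('a)} :: complex set)" for s
  proof -
    have "(\<Sum>k\<le>DIM('a). q k s / (s - of_nat k)) = complex_of_real \<epsilon> powr (of_nat DIM('a) - s) * finite_zeta \<epsilon> s *
       (\<Sum>k\<le>DIM('a). of_real g powr (s - of_nat k) / (s - of_nat k) * of_real (\<kappa> k g) - (if k = DIM('a) then of_real g powr (s - of_nat DIM('a)) * of_real vol / (s - of_nat DIM('a)) else 0))"
      unfolding q_def sum_distrib_left by (intro sum.cong) (auto simp: diff_divide_distrib right_diff_distrib)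
    also have "\<dots> = complex_of_real \<epsilon> powr (of_nat DIM('a) - s) * finite_zeta \<epsilon> s *
       ((\<Sum>k\<le>DIM('a). of_real g powr (s - of_nat k) / (s - of_nat k) * of_real (\<kappa> k g)) - of_real g powr (s - of_nat DIM('a)) / (s - of_nat DIM('a)) * of_real vol)"
      unfolding sum_subtractf by simp
    also have "\<dots> = tkernel \<epsilon> s * finite_zeta \<epsilon> s"
      unfolding tube_kernel_partial_fractions[OF that vol_eq g_pos] by (simp add: mult_ac)
    finally show ?thesis by simp
  qed
  have "\<forall>\<^sub>F s in at (of_nat m). s \<notin> (of_nat ` {..DIM('a)} :: complex set)"
  proof -
    have "\<forall>\<^sub>F s in at (of_nat m). s \<in> - ((of_nat ` {..DIM('a)} :: complex set) - {of_nat m}) - {of_nat m}"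
      by (intro eventually_at_in_open open_Compl finite_imp_closed) auto
    then show ?thesis by eventually_elim auto
  qed
  then have "\<forall>\<^sub>F s in at (of_nat m). tkernel \<epsilon> s * finite_zeta \<epsilon> s = (\<Sum>k\<le>DIM('a). q k s / (s - of_nat k))"
    by eventually_elim (rule eq)
  then have "residue (\<lambda>s. tkernel \<epsilon> s * finite_zeta \<epsilon> s) (of_nat m) = residue (\<lambda>s. \<Sum>k\<le>DIM('a). q k s / (s - of_nat k)) (of_nat m)"
    by (rule residue_cong) simp
  also have "\<dots> = q m (of_nat m)" by (rule residue_simple_fractions(1)[OF q m])
  also have "\<dots> = of_real (\<epsilon> ^ (DIM('a) - m) * \<kappa> m g * (\<Sum>j\<in>large \<epsilon>. l j ^ m) - (if m = DIM('a) then vol * (\<Sum>j\<in>large \<epsilon>. l j ^ DIM('a)) else 0))"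
  proof -
    have "complex_of_real \<epsilon> powr (of_nat DIM('a) - of_nat m) = of_real (\<epsilon> ^ (DIM('a) - m))"
      using \<epsilon> m by (simp add: powr_nat' flip: of_nat_diff)
    moreover have "complex_of_real (l j) powr of_nat m = of_real (l j ^ m)" for j
      using l_pos[of j] by (simp add: powr_nat')
    ultimately show ?thesis using g_pos by (auto simp: q_def finite_zeta_def right_diff_distrib algebra_simps)
  qed
  finally show ?thesis .
qed

lemma sum_residue_finite_part:
  assumes \<epsilon>: "\<epsilon> > 0"
  shows "(\<Sum>p\<in>(of_nat ` {..DIM('a)} :: complex set). residue (\<lambda>s. tkernel \<epsilon> s * finite_zeta \<epsilon> s) p) = of_real (main_part \<epsilon>)"
proof -
  have "(\<Sum>p\<in>(of_nat ` {..DIM('a)} :: complex set). residue (\<lambda>s. tkernel \<epsilon> s * finite_zeta \<epsilon> s) p) = (\<Sum>m\<le>DIM('a). residue (\<lambda>s. tkernel \<epsilon> s * finite_zeta \<epsilon> s) (of_nat m))"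
    by (subst sum.reindex) (auto simp: inj_on_def)
  also have "\<dots> = of_real (\<Sum>m\<le>DIM('a). \<epsilon> ^ (DIM('a) - m) * \<kappa> m g * (\<Sum>j\<in>large \<epsilon>. l j ^ m) - (if m = DIM('a) then vol * (\<Sum>j\<in>large \<epsilon>. l j ^ DIM('a)) else 0))"
    unfolding of_real_sum by (intro sum.cong residue_finite_part \<epsilon>) auto
  also have "(\<Sum>m\<le>DIM('a). \<epsilon> ^ (DIM('a) - m) * \<kappa> m g * (\<Sum>j\<in>large \<epsilon>. l j ^ m) - (if m = DIM('a) then vol * (\<Sum>j\<in>large \<epsilon>. l j ^ DIM('a)) else 0))
     = main_part \<epsilon>"
    unfolding sum_subtractf main_part_def sum_distrib_left
    by (subst sum.swap) (simp add: mult_ac)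
  finally show ?thesis .
qed

text \<open>
  For the large pieces \<open>g * l j / \<epsilon> > 1\<close>, so that the integrand is dominated on the left of the line by its
  values on the line, up to the decay of the rational factor.
\<close>

lemma line_finite_part:
  assumes \<epsilon>: "\<epsilon> > 0"
  shows "(\<lambda>m::nat. integral {- real m..real m} (screen_integrand (\<lambda>_. real DIM('a) + 1) (\<lambda>s. tkernel \<epsilon> s * finite_zeta \<epsilon> s)))
     \<longlonglongrightarrow> 2 * of_real pi * \<i> * of_real (main_part \<epsilon>)"
proof -
  define c where "c = real DIM('a) + 1"
  define A where "A = (\<Sum>j\<in>large \<epsilon>. (g * l j / \<epsilon>) powr c)"
  have A0: "A \<ge> 0" unfolding A_def by (rule sum_nonneg) simp
  have "(\<lambda>m::nat. integral {- real m..real m} (screen_integrand (\<lambda>_. c) (\<lambda>s. tkernel \<epsilon> s * finite_zeta \<epsilon> s)))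
     \<longlonglongrightarrow> 2 * of_real pi * \<i> * (\<Sum>p\<in>(of_nat ` {..DIM('a)} :: complex set). residue (\<lambda>s. tkernel \<epsilon> s * finite_zeta \<epsilon> s) p)"
  proof (rule line_integral_shift_left[where M=1 and C="\<epsilon> ^ DIM('a) * kernel_const * A"])
    show "(\<lambda>s. tkernel \<epsilon> s * finite_zeta \<epsilon> s) holomorphic_on UNIV - (of_nat ` {..DIM('a)} :: complex set)"
      by (intro holomorphic_on_mult tube_kernel_holomorphic finite_zeta_holomorphic \<epsilon> g_pos) auto
    show "not_essential (\<lambda>s. tkernel \<epsilon> s * finite_zeta \<epsilon> s) p" for p
    proof -
      have "finite_zeta \<epsilon> analytic_on {p}" using finite_zeta_holomorphic[of \<epsilon> UNIV] analytic_at by blast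
      then have "(\<lambda>s. tkernel \<epsilon> s * finite_zeta \<epsilon> s) meromorphic_on {p}"
        by (intro meromorphic_on_mult tube_kernel_meromorphic \<epsilon> g_pos analytic_on_imp_meromorphic_on)
      then show ?thesis unfolding meromorphic_at_iff by simp
    qed
    show "0 \<le> \<epsilon> ^ DIM('a) * kernel_const * A" using \<epsilon> kernel_const_nonneg A0 by auto
    fix s and m :: real assume m: "1 \<le> m" "Re s \<le> c" "m \<le> \<bar>Im s\<bar> \<or> Re s \<le> - m"
    have "norm (tkernel \<epsilon> s * finite_zeta \<epsilon> s) \<le> (\<epsilon> ^ DIM('a) * (g / \<epsilon>) powr Re s * (kernel_const / m\<^sup>2)) * (\<Sum>j\<in>large \<epsilon>. l j powr Re s)"
      unfolding norm_mult
    proof (rule mult_mono)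
      show "norm (finite_zeta \<epsilon> s) \<le> (\<Sum>j\<in>large \<epsilon>. l j powr Re s)"
        unfolding finite_zeta_def by (rule sum_norm_le) (simp add: norm_scaling_term[OF string_l])
      show "norm (tkernel \<epsilon> s) \<le> \<epsilon> ^ DIM('a) * (g / \<epsilon>) powr Re s * (kernel_const / m\<^sup>2)"
        by (rule kernel_bound') (use m \<epsilon> in auto)
    qed (use \<epsilon> kernel_const_nonneg in auto)
    also have "\<dots> = \<epsilon> ^ DIM('a) * (kernel_const / m\<^sup>2) * (\<Sum>j\<in>large \<epsilon>. (g / \<epsilon>) powr Re s * l j powr Re s)"
      by (simp add: sum_distrib_left sum_divide_distrib mult_ac)
    also have "\<dots> \<le> \<epsilon> ^ DIM('a) * (kernel_const / m\<^sup>2) * A" unfolding A_def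
    proof (intro mult_left_mono sum_mono)
      fix j assume j: "j \<in> large \<epsilon>"
      have "(g / \<epsilon>) powr Re s * l j powr Re s = (g * l j / \<epsilon>) powr Re s"
        using g_pos \<epsilon> l_pos[of j] by (simp add: powr_mult[symmetric])
      also have "\<dots> \<le> (g * l j / \<epsilon>) powr c"
        using j \<epsilon> m by (intro powr_mono) (auto simp: large_def field_simps)
      finally show "(g / \<epsilon>) powr Re s * l j powr Re s \<le> (g * l j / \<epsilon>) powr c" .
    qed (use \<epsilon> kernel_const_nonneg in auto)
    finally show "norm (tkernel \<epsilon> s * finite_zeta \<epsilon> s) \<le> \<epsilon> ^ DIM('a) * kernel_const * A / m\<^sup>2" by (simp add: mult_ac)
  qed (auto simp: c_def)
  then show ?thesis unfolding c_def sum_residue_finite_part[OF \<epsilon>] .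
qed

lemma continuation_right_facts:
  assumes F: "is_continuation (scaling_series l) (scaling_halfplane l) W F" and W: "scaling_halfplane l \<subseteq> W"
    and s: "real DIM('a) \<le> Re s"
  shows continuation_analytic_right: "F analytic_on {s}" and continuation_not_pole_right: "\<not> is_pole F s"
    and continuation_eq_right: "F s = scaling_series l s" and norm_continuation_right_le: "norm (F s) \<le> (\<Sum>j. l j ^ DIM('a))"
proof -
  have h: "s \<in> scaling_halfplane l" using right_halfplane_subset s by auto
  note c = continuation_on_halfplane[OF string_l first F W h]
  show "F analytic_on {s}" "\<not> is_pole F s" and e: "F s = scaling_series l s" using c by auto
  show "norm (F s) \<le> (\<Sum>j. l j ^ DIM('a))"
    using norm_scaling_series_le[OF string_l first abscissa s] l_pos unfolding e by (simp add: powr_realpow)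
qed

lemma continuation_holomorphic_right:
  assumes F: "is_continuation (scaling_series l) (scaling_halfplane l) W F" and W: "scaling_halfplane l \<subseteq> W"
  shows "F holomorphic_on {s. real DIM('a) + 1 - 1/2 < Re s}"
proof -
  have "F analytic_on {s. real DIM('a) + 1 - 1/2 < Re s}"
    using continuation_analytic_right[OF F W] by (subst analytic_on_analytic_at) auto
  then show ?thesis by (rule analytic_imp_holomorphic)
qed

lemma kernel_holomorphic_right: "\<epsilon> > 0 \<Longrightarrow> tkernel \<epsilon> holomorphic_on {s. real DIM('a) + 1 - 1/2 < Re s}"
  by (rule tube_kernel_holomorphic) (use g_pos in auto)

text \<open>
  For the other pieces \<open>g * l j / \<epsilon> \<le> 1\<close>, so that the same holds on the right of the line. There are no poles
  there.
\<close>

lemma line_tail_part: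
  assumes F: "is_continuation (scaling_series l) (scaling_halfplane l) W F" and W: "scaling_halfplane l \<subseteq> W"
    and \<epsilon>: "\<epsilon> > 0"
  shows "(\<lambda>m::nat. integral {- real m..real m} (screen_integrand (\<lambda>_. real DIM('a) + 1) (\<lambda>s. tkernel \<epsilon> s * (F s - finite_zeta \<epsilon> s))))
     \<longlonglongrightarrow> 0"
proof -
  define c where "c = real DIM('a) + 1"
  define Z where "Z = (\<Sum>j. l j powr c)"
  have summc: "summable (\<lambda>j. l j powr c)"
    by (rule summable_right_of_abscissa[OF string_l]) (use abscissa in \<open>auto simp: c_def intro: less_trans\<close>)
  have Z0: "Z \<ge> 0" unfolding Z_def by (rule suminf_nonneg[OF summc]) simp
  have "(\<lambda>m::nat. integral {- real m..real m} (screen_integrand (\<lambda>_. c) (\<lambda>s. tkernel \<epsilon> s * (F s - finite_zeta \<epsilon> s))))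
     \<longlonglongrightarrow> 0"
  proof (rule line_integral_shift_right[where M=1 and C="\<epsilon> ^ DIM('a) * kernel_const * ((g / \<epsilon>) powr c * Z)" and \<delta>="1/2"])
    show "(\<lambda>s. tkernel \<epsilon> s * (F s - finite_zeta \<epsilon> s)) holomorphic_on {s. c - 1/2 < Re s}" unfolding c_def
      by (intro holomorphic_on_mult holomorphic_on_diff kernel_holomorphic_right continuation_holomorphic_right[OF F W] finite_zeta_holomorphic \<epsilon>)
    show "0 \<le> \<epsilon> ^ DIM('a) * kernel_const * ((g / \<epsilon>) powr c * Z)" using \<epsilon> kernel_const_nonneg Z0 by auto
    fix s and m :: real assume m: "1 \<le> m" "c \<le> Re s" "m \<le> \<bar>Im s\<bar> \<or> c + m \<le> Re s"
    have sd: "real DIM('a) \<le> Re s" using m by (simp add: c_def)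
    define r where "r = (\<lambda>j. if j \<in> large \<epsilon> then 0 else complex_of_real (l j) powr s)"
    have summ: "summable (\<lambda>j. complex_of_real (l j) powr s)" by (rule summable_scaling[OF string_l first abscissa sd])
    have "(\<lambda>j. complex_of_real (l j) powr s - (if j \<in> large \<epsilon> then complex_of_real (l j) powr s else 0)) sums (scaling_series l s - finite_zeta \<epsilon> s)"
      unfolding scaling_series_def finite_zeta_def by (intro sums_diff summable_sums summ sums_If_finite_set finite_large \<epsilon>)
    moreover have "complex_of_real (l j) powr s - (if j \<in> large \<epsilon> then complex_of_real (l j) powr s else 0) = r j" for j by (simp add: r_def)
    ultimately have r: "r sums (F s - finite_zeta \<epsilon> s)" using continuation_eq_right[OF F W sd] by simp
    have nr: "(g / \<epsilon>) powr Re s * norm (r j) \<le> (g / \<epsilon>) powr c * l j powr c" for j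
    proof (cases "j \<in> large \<epsilon>")
      case False
      have "(g / \<epsilon>) powr Re s * norm (r j) = (g * l j / \<epsilon>) powr Re s"
        using g_pos \<epsilon> l_pos[of j] False by (simp add: r_def norm_scaling_term[OF string_l] powr_mult[symmetric])
      also have "\<dots> \<le> (g * l j / \<epsilon>) powr c"
        using False \<epsilon> m g_pos l_pos[of j] by (intro powr_mono') (auto simp: large_def field_simps)
      also have "\<dots> = (g / \<epsilon>) powr c * l j powr c" using g_pos \<epsilon> l_pos[of j] by (simp add: powr_mult[symmetric])
      finally show ?thesis .
    qed (auto simp: r_def)
    have summ': "summable (\<lambda>j. (g / \<epsilon>) powr c * l j powr c)" by (intro summable_mult summc)
    have summn: "summable (\<lambda>j. norm (r j))"
      by (rule summable_comparison_test'[OF summable_norm_scaling[OF string_l first abscissa sd], of 0]) (auto simp: r_def)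
    have "(g / \<epsilon>) powr Re s * norm (F s - finite_zeta \<epsilon> s) \<le> (g / \<epsilon>) powr Re s * (\<Sum>j. norm (r j))"
      using r summable_norm[OF summn] by (intro mult_left_mono) (auto simp: sums_iff)
    also have "\<dots> = (\<Sum>j. (g / \<epsilon>) powr Re s * norm (r j))" by (rule suminf_mult[OF summn, symmetric])
    also have "\<dots> \<le> (\<Sum>j. (g / \<epsilon>) powr c * l j powr c)"
      by (rule suminf_le[OF nr summable_mult[OF summn] summ'])
    also have "\<dots> = (g / \<epsilon>) powr c * Z" unfolding Z_def by (rule suminf_mult[OF summc])
    finally have b: "(g / \<epsilon>) powr Re s * norm (F s - finite_zeta \<epsilon> s) \<le> (g / \<epsilon>) powr c * Z" .
    have "norm (tkernel \<epsilon> s * (F s - finite_zeta \<epsilon> s)) \<le> (\<epsilon> ^ DIM('a) * (g / \<epsilon>) powr Re s * (kernel_const / m\<^sup>2)) * norm (F s - finite_zeta \<epsilon> s)"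
      unfolding norm_mult by (intro mult_right_mono kernel_bound') (use m \<epsilon> in \<open>auto simp: c_def\<close>)
    also have "\<dots> = \<epsilon> ^ DIM('a) * (kernel_const / m\<^sup>2) * ((g / \<epsilon>) powr Re s * norm (F s - finite_zeta \<epsilon> s))" by (simp add: mult_ac)
    also have "\<dots> \<le> \<epsilon> ^ DIM('a) * (kernel_const / m\<^sup>2) * ((g / \<epsilon>) powr c * Z)"
      by (intro mult_left_mono b) (use \<epsilon> kernel_const_nonneg in auto)
    finally show "norm (tkernel \<epsilon> s * (F s - finite_zeta \<epsilon> s)) \<le> \<epsilon> ^ DIM('a) * kernel_const * ((g / \<epsilon>) powr c * Z) / m\<^sup>2" by (simp add: mult_ac)
  qed auto
  then show ?thesis unfolding c_def .
qed

lemma line_continuous: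
  assumes "f holomorphic_on {s. real DIM('a) + 1 - 1/2 < Re s}"
  shows "continuous_on A (screen_integrand (\<lambda>_. real DIM('a) + 1) f)"
proof -
  have "continuous_on {s. real DIM('a) + 1 - 1/2 < Re s} f" using assms by (rule holomorphic_on_imp_continuous_on)
  then have "continuous_on A (\<lambda>t. f (Complex (real DIM('a) + 1) t))"
    by (rule continuous_on_compose2) (auto simp: Complex_eq intro!: continuous_intros)
  then show ?thesis unfolding screen_integrand_const[abs_def] by (intro continuous_intros)
qed

lemma line_limit:
  assumes F: "is_continuation (scaling_series l) (scaling_halfplane l) W F" and W: "scaling_halfplane l \<subseteq> W"
    and \<epsilon>: "\<epsilon> > 0"
  shows "(\<lambda>m::nat. integral {- real m..real m} (screen_integrand (\<lambda>_. real DIM('a) + 1) (\<lambda>s. tkernel \<epsilon> s * F s)))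
     \<longlonglongrightarrow> 2 * of_real pi * \<i> * of_real (main_part \<epsilon>)"
proof -
  let ?c = "real DIM('a) + 1"
  let ?A = "screen_integrand (\<lambda>_. ?c) (\<lambda>s. tkernel \<epsilon> s * finite_zeta \<epsilon> s)"
  let ?B = "screen_integrand (\<lambda>_. ?c) (\<lambda>s. tkernel \<epsilon> s * (F s - finite_zeta \<epsilon> s))"
  have 1: "continuous_on I ?A" for I
    by (intro line_continuous holomorphic_on_mult kernel_holomorphic_right finite_zeta_holomorphic \<epsilon>)
  have 2: "continuous_on I ?B" for I
    by (intro line_continuous holomorphic_on_mult holomorphic_on_diff kernel_holomorphic_right
          continuation_holomorphic_right[OF F W] finite_zeta_holomorphic \<epsilon>)
  have "screen_integrand (\<lambda>_. ?c) (\<lambda>s. tkernel \<epsilon> s * F s) = (\<lambda>t. ?A t + ?B t)"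
    by (auto simp: screen_integrand_const algebra_simps)
  then have "integral {- real m..real m} (screen_integrand (\<lambda>_. ?c) (\<lambda>s. tkernel \<epsilon> s * F s)) =
      integral {- real m..real m} ?A + integral {- real m..real m} ?B" for m
    using integral_add[OF integrable_continuous_real[OF 1] integrable_continuous_real[OF 2]] by simp
  then show ?thesis using tendsto_add[OF line_finite_part[OF \<epsilon>] line_tail_part[OF F W \<epsilon>]] by simp
qed

lemma line_integrable:
  assumes F: "is_continuation (scaling_series l) (scaling_halfplane l) W F" and W: "scaling_halfplane l \<subseteq> W"
    and \<epsilon>: "\<epsilon> > 0"
  shows "integrable lebesgue (screen_integrand (\<lambda>_. real DIM('a) + 1) (\<lambda>s. tkernel \<epsilon> s * F s))"
proof (rule integrable_lebesgue_powr_bound[where p="-2" and C="\<epsilon> ^ DIM('a) * (g / \<epsilon>) powr (real DIM('a) + 1) * (4 * kernel_const) * (\<Sum>j. l j ^ DIM('a))"])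
  have "continuous_on UNIV (screen_integrand (\<lambda>_. real DIM('a) + 1) (\<lambda>s. tkernel \<epsilon> s * F s))"
    by (intro line_continuous holomorphic_on_mult kernel_holomorphic_right continuation_holomorphic_right[OF F W] \<epsilon>)
  then show "screen_integrand (\<lambda>_. real DIM('a) + 1) (\<lambda>s. tkernel \<epsilon> s * F s) \<in> borel_measurable lebesgue"
    using borel_measurable_continuous_onI by (intro measurable_completion) simp
  show "AE t in lebesgue. norm (screen_integrand (\<lambda>_. real DIM('a) + 1) (\<lambda>s. tkernel \<epsilon> s * F s) t)
     \<le> \<epsilon> ^ DIM('a) * (g / \<epsilon>) powr (real DIM('a) + 1) * (4 * kernel_const) * (\<Sum>j. l j ^ DIM('a)) * (1 + \<bar>t\<bar>) powr - 2"
  proof (rule AE_I2)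
    fix t :: real
    let ?s = "Complex (real DIM('a) + 1) t" and ?m = "(1 + \<bar>t\<bar>) / 2"
    have "norm (tkernel \<epsilon> ?s) \<le> \<epsilon> ^ DIM('a) * (g / \<epsilon>) powr Re ?s * (kernel_const / ?m\<^sup>2)"
    proof (rule kernel_bound[OF \<epsilon>])
      show "?m \<le> norm (?s - of_nat k)" if "k \<le> DIM('a)" for k
        using norm_diff_nat_ge_Im[of ?s k] norm_diff_nat_ge_Re'[OF that, of ?s] by simp
    qed auto
    also have "kernel_const / ?m\<^sup>2 = 4 * kernel_const * (1 + \<bar>t\<bar>) powr - 2"
      by (simp add: powr_minus powr_numeral field_simps power2_eq_square)
    finally have k: "norm (tkernel \<epsilon> ?s) \<le> \<epsilon> ^ DIM('a) * (g / \<epsilon>) powr (real DIM('a) + 1) * (4 * kernel_const * (1 + \<bar>t\<bar>) powr - 2)" by simp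
    have "norm (screen_integrand (\<lambda>_. real DIM('a) + 1) (\<lambda>s. tkernel \<epsilon> s * F s) t) = norm (tkernel \<epsilon> ?s) * norm (F ?s)"
      by (simp add: screen_integrand_const norm_mult)
    also have "\<dots> \<le> (\<epsilon> ^ DIM('a) * (g / \<epsilon>) powr (real DIM('a) + 1) * (4 * kernel_const * (1 + \<bar>t\<bar>) powr - 2)) * (\<Sum>j. l j ^ DIM('a))"
      by (intro mult_mono k norm_continuation_right_le[OF F W]) (use \<epsilon> kernel_const_nonneg in auto)
    finally show "norm (screen_integrand (\<lambda>_. real DIM('a) + 1) (\<lambda>s. tkernel \<epsilon> s * F s) t)
     \<le> \<epsilon> ^ DIM('a) * (g / \<epsilon>) powr (real DIM('a) + 1) * (4 * kernel_const) * (\<Sum>j. l j ^ DIM('a)) * (1 + \<bar>t\<bar>) powr - 2"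
      by (simp add: mult_ac)
  qed
qed simp

lemma line_limit_heights:
  assumes F: "is_continuation (scaling_series l) (scaling_halfplane l) W F" and W: "scaling_halfplane l \<subseteq> W"
    and \<epsilon>: "\<epsilon> > 0" and a: "filterlim a at_bot sequentially" and b: "filterlim b at_top sequentially"
  shows "(\<lambda>n. integral {a n..b n} (screen_integrand (\<lambda>_. real DIM('a) + 1) (\<lambda>s. tkernel \<epsilon> s * F s)))
     \<longlonglongrightarrow> 2 * of_real pi * \<i> * of_real (main_part \<epsilon>)"
proof -
  note i = line_integrable[OF F W \<epsilon>]
  have "(\<lambda>m. integral {- real m..real m} (screen_integrand (\<lambda>_. real DIM('a) + 1) (\<lambda>s. tkernel \<epsilon> s * F s)))
     \<longlonglongrightarrow> (LINT t|lebesgue. screen_integrand (\<lambda>_. real DIM('a) + 1) (\<lambda>s. tkernel \<epsilon> s * F s) t)"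
    by (rule integral_exhaust_line[OF i])
       (auto simp: filterlim_uminus_at_bot filterlim_real_sequentially)
  then have "(LINT t|lebesgue. screen_integrand (\<lambda>_. real DIM('a) + 1) (\<lambda>s. tkernel \<epsilon> s * F s) t) = 2 * of_real pi * \<i> * of_real (main_part \<epsilon>)"
    using line_limit[OF F W \<epsilon>] LIMSEQ_unique by blast
  then show ?thesis using integral_exhaust_line[OF i a b] by simp
qed

section \<open>The tube formula with error term\<close>

text \<open>
  The residue theorem for \<open>tkernel * F\<close> between a screen and the line \<open>Re s = d + 1\<close>. The set \<open>P\<close> may contain
  points where the function is holomorphic; their residue is \<open>0\<close>.
\<close>

lemma residue_theorem_strip:
  assumes \<epsilon>: "\<epsilon> > 0" and S: "K-lipschitz_on UNIV S" and Sle: "\<And>t. ereal (S t) \<le> abscissa l"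
    and F: "is_continuation (scaling_series l) (scaling_halfplane l) (window S) F"
    and np: "\<And>t. \<not> is_pole F (Complex (S t) t)" and S0: "S 0 < 0" and ab: "a < 0" "0 < b"
    and npa: "\<And>x. S a \<le> x \<Longrightarrow> \<not> is_pole F (Complex x a)" and npb: "\<And>x. S b \<le> x \<Longrightarrow> \<not> is_pole F (Complex x b)"
    and P_def: "P = {w \<in> window S. (is_pole F w \<or> w \<in> of_nat ` {..DIM('a)}) \<and> a < Im w \<and> Im w < b}"
  shows "finite P"
    and "has_boundary_integral a b (real DIM('a) + 1) S (\<lambda>s. tkernel \<epsilon> s * F s)
      (2 * of_real pi * \<i> * (\<Sum>w\<in>P. residue (\<lambda>s. tkernel \<epsilon> s * F s) w))"
proof -
  let ?ints = "of_nat ` {..DIM('a)} :: complex set"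
  have W: "scaling_halfplane l \<subseteq> window S" by (rule halfplane_subset_window[OF Sle])
  have Sdim: "S t < real DIM('a)" for t
    using order.strict_trans1[OF Sle abscissa, of t] by simp
  obtain U where U: "open U" "window S \<subseteq> U" "F nicely_meromorphic_on U"
    using F unfolding is_continuation_def by blast
  have mero: "F meromorphic_on {z}" if "z \<in> U" for z
    using U(3) that unfolding nicely_meromorphic_on_def by (blast intro: meromorphic_on_subset)
  let ?R = "{z. a \<le> Im z \<and> Im z \<le> b \<and> S (Im z) \<le> Re z \<and> Re z \<le> real DIM('a)}"
  have "finite (?R \<inter> {z. is_pole F z})"
    by (rule finite_poles_compact[OF U(3,1) compact_screen_region[OF S]]) (use U(2) in \<open>auto simp: window_def\<close>)
  moreover have "P \<subseteq> (?R \<inter> {z. is_pole F z}) \<union> ?ints"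
    using continuation_not_pole_right[OF F W] unfolding P_def window_def by (auto simp: not_le[symmetric] intro: less_imp_le)
  ultimately show fin: "finite P" by (meson finite_Un finite_atMost finite_imageI finite_subset)
  \<comment> \<open>the points where the integrand is holomorphic; adding the points of \<open>P\<close> keeps the set open\<close>
  define V where "V = U \<inter> {z. F analytic_on {z}} \<inter> - ?ints"
  have opi: "open (- ?ints)" by (intro open_Compl finite_imp_closed) auto
  have opV: "open V" unfolding V_def using U(1) opi open_analytic_points by (intro open_Int)
  have PU: "P \<subseteq> U" using U(2) by (auto simp: P_def)
  have op: "open (V \<union> P)"
  proof (subst open_subopen, rule ballI)
    fix x assume x: "x \<in> V \<union> P"
    show "\<exists>T. open T \<and> x \<in> T \<and> T \<subseteq> V \<union> P"
    proof (cases "x \<in> V")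
      case False
      then have xP: "x \<in> P" using x by simp
      have "\<forall>\<^sub>F z in at x. F analytic_on {z}"
        using mero[of x] xP PU unfolding meromorphic_at_iff isolated_singularity_at_altdef by blast
      moreover have "\<forall>\<^sub>F z in at x. z \<in> U" using U(1) xP PU by (intro eventually_at_in_open') auto
      moreover have "\<forall>\<^sub>F z in at x. z \<in> - (?ints - {x}) - {x}"
        by (intro eventually_at_in_open open_Compl finite_imp_closed) auto
      ultimately have "\<forall>\<^sub>F z in at x. z \<in> V" by eventually_elim (auto simp: V_def)
      then obtain T where T: "open T" "x \<in> T" "\<And>z. z \<in> T \<Longrightarrow> z \<noteq> x \<Longrightarrow> z \<in> V" unfolding eventually_at_topological by auto
      then show ?thesis using xP by (intro exI[of _ T]) auto
    qed (use opV in blast)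
  qed
  have inV: "z \<in> V" if "z \<in> window S" "\<not> is_pole F z" "z \<notin> ?ints" for z
    using continuation_analytic_at[OF F that(1,2)] that U(2) by (auto simp: V_def)
  have int_props: "Im z = 0 \<and> 0 \<le> Re z \<and> Re z \<le> real DIM('a)" if "z \<in> ?ints" for z using that by auto
  show "has_boundary_integral a b (real DIM('a) + 1) S (\<lambda>s. tkernel \<epsilon> s * F s)
      (2 * of_real pi * \<i> * (\<Sum>w\<in>P. residue (\<lambda>s. tkernel \<epsilon> s * F s) w))"
  proof (rule screen_residue_theorem[OF fin S _ op])
    show "{z. a \<le> Im z \<and> Im z \<le> b \<and> S (Im z) \<le> Re z} \<subseteq> V \<union> P"
    proof
      fix z assume z: "z \<in> {z. a \<le> Im z \<and> Im z \<le> b \<and> S (Im z) \<le> Re z}"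
      then have zW: "z \<in> window S" by (simp add: window_def)
      show "z \<in> V \<union> P"
      proof (cases "is_pole F z \<or> z \<in> ?ints")
        case True
        have "Im z \<noteq> a" "Im z \<noteq> b"
          using True npa[of "Re z"] npb[of "Re z"] z int_props[of z] ab by auto
        then show ?thesis using True z zW by (auto simp: P_def)
      qed (use inV[OF zW] in auto)
    qed
    show "{z. real DIM('a) + 1 \<le> Re z} \<subseteq> V \<union> P"
    proof
      fix z :: complex assume z: "z \<in> {z. real DIM('a) + 1 \<le> Re z}"
      then have "z \<in> window S" using Sdim[of "Im z"] by (auto simp: window_def)
      moreover have "\<not> is_pole F z" using continuation_not_pole_right[OF F W, of z] z by auto
      moreover have "z \<notin> ?ints" using int_props[of z] z by auto
      ultimately show "z \<in> V \<union> P" using inV by auto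
    qed
    show "S t \<le> real DIM('a) + 1" for t using Sdim[of t] by simp
    show "a < Im p \<and> Im p < b \<and> S (Im p) < Re p \<and> Re p < real DIM('a) + 1" if p: "p \<in> P" for p
    proof -
      have 1: "a < Im p" "Im p < b" "S (Im p) \<le> Re p" "is_pole F p \<or> p \<in> ?ints" using p by (auto simp: P_def window_def)
      have "S (Im p) \<noteq> Re p"
      proof
        assume eq: "S (Im p) = Re p"
        then have "p = Complex (S (Im p)) (Im p)" by (simp add: complex_eq_iff)
        then have "p \<in> ?ints" using np[of "Im p"] 1 by auto
        then show False using int_props[of p] S0 eq by auto
      qed
      moreover have "Re p < real DIM('a) + 1"
        using 1(4) continuation_not_pole_right[OF F W, of p] int_props[of p] by (cases "real DIM('a) \<le> Re p") auto
      ultimately show ?thesis using 1 by auto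
    qed
    have "F holomorphic_on V"
      by (rule analytic_imp_holomorphic) (subst analytic_on_analytic_at, auto simp: V_def)
    moreover have "tkernel \<epsilon> holomorphic_on V"
      by (rule tube_kernel_holomorphic[OF \<epsilon> g_pos]) (auto simp: V_def)
    ultimately have "(\<lambda>s. tkernel \<epsilon> s * F s) holomorphic_on V" by (intro holomorphic_on_mult)
    then show "(\<lambda>s. tkernel \<epsilon> s * F s) holomorphic_on V \<union> P - P" by (rule holomorphic_on_subset) auto
    show "not_essential (\<lambda>s. tkernel \<epsilon> s * F s) p" if "p \<in> P" for p
    proof -
      have "(\<lambda>s. tkernel \<epsilon> s * F s) meromorphic_on {p}"
        using mero[of p] that PU by (intro meromorphic_on_mult tube_kernel_meromorphic \<epsilon> g_pos) auto
      then show ?thesis unfolding meromorphic_at_iff by simp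
    qed
  qed (use ab in auto)
qed

text \<open>
  Comparison with the kernel for \<open>\<epsilon> = g\<close> separates \<open>\<epsilon>\<close> from the dependence on the height.
\<close>

lemma kernel_scale:
  assumes "\<epsilon> > 0"
  shows "norm (tkernel \<epsilon> s) = (\<epsilon> / g) ^ DIM('a) * (g / \<epsilon>) powr Re s * norm (tkernel g s)"
  using g_pos unfolding norm_tube_kernel[OF assms g_pos] norm_tube_kernel[OF g_pos g_pos] by (simp add: power_divide)

lemma horizontal_bound:
  assumes \<epsilon>: "\<epsilon> > 0" and t: "t \<noteq> 0" and Fb: "norm (F (Complex x t)) \<le> c1 * (\<bar>t\<bar> + 1) powr q"
  shows "norm (tkernel \<epsilon> (Complex x t) * F (Complex x t)) \<le> \<epsilon> ^ DIM('a) * (kernel_const * c1) * ((\<bar>t\<bar> + 1) powr q / t\<^sup>2) * (g / \<epsilon>) powr x"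
proof -
  have "norm (tkernel \<epsilon> (Complex x t)) \<le> \<epsilon> ^ DIM('a) * (g / \<epsilon>) powr Re (Complex x t) * (kernel_const / \<bar>t\<bar>\<^sup>2)"
    by (rule kernel_bound'[OF \<epsilon>]) (use t in auto)
  then have "norm (tkernel \<epsilon> (Complex x t) * F (Complex x t)) \<le> (\<epsilon> ^ DIM('a) * (g / \<epsilon>) powr x * (kernel_const / t\<^sup>2)) * (c1 * (\<bar>t\<bar> + 1) powr q)"
    unfolding norm_mult by (intro mult_mono Fb) (use \<epsilon> kernel_const_nonneg in auto)
  then show ?thesis by (simp add: mult_ac)
qed

lemma screen_continuous:
  assumes \<epsilon>: "\<epsilon> > 0" and F: "is_continuation (scaling_series l) (scaling_halfplane l) (window S) F"
    and np: "\<And>t. \<not> is_pole F (Complex (S t) t)" and S0: "S 0 < 0"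
  shows "continuous_on (range (edge S)) (\<lambda>s. tkernel \<epsilon> s * F s)"
proof -
  have an: "F analytic_on range (edge S)"
    by (subst analytic_on_analytic_at) (use continuation_analytic_at[OF F] np in \<open>auto simp: edge_def window_def\<close>)
  have "range (edge S) \<inter> of_nat ` {..DIM('a)} = {}"
    using S0 by (auto simp: edge_def complex_eq_iff)
  then have "tkernel \<epsilon> holomorphic_on range (edge S)" by (rule tube_kernel_holomorphic[OF \<epsilon> g_pos])
  then show ?thesis
    using an by (intro continuous_on_mult holomorphic_on_imp_continuous_on) (auto intro: analytic_imp_holomorphic)
qed

lemma screen_kernel_bound:
  assumes S: "K-lipschitz_on UNIV S"
    and F: "is_continuation (scaling_series l) (scaling_halfplane l) (window S) F"
    and np: "\<And>t. \<not> is_pole F (Complex (S t) t)" and S0: "S 0 < 0" and q: "q < 2"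
    and L2: "\<And>t. 1 \<le> \<bar>t\<bar> \<Longrightarrow> norm (F (Complex (S t) t)) \<le> c * \<bar>t\<bar> powr q" and c: "c > 0"
  obtains C1 where "C1 \<ge> 0" "\<And>t. norm (tkernel g (Complex (S t) t) * F (Complex (S t) t)) \<le> C1 * (1 + \<bar>t\<bar>) powr (q - 2)"
proof -
  let ?f = "\<lambda>s. tkernel g s * F s"
  from screen_continuous[OF g_pos F np S0] have "continuous_on {-1..1} (\<lambda>t. ?f (edge S t))"
    by (rule continuous_on_compose2[OF _ lipschitz_on_continuous_on[OF edge_lipschitz[OF S]]]) auto
  then have "bounded ((\<lambda>t. ?f (edge S t)) ` {-1..1})"
    by (intro compact_imp_bounded compact_continuous_image) auto
  then obtain M where M: "\<And>t. t \<in> {-1..1} \<Longrightarrow> norm (?f (edge S t)) \<le> M" unfolding bounded_iff by blast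
  have M0: "M \<ge> 0" using order_trans[OF norm_ge_zero M[of 0]] by simp
  \<comment> \<open>the first summand serves for \<open>1 \<le> \<bar>t\<bar>\<close>, the second one near the real axis\<close>
  define C1 where "C1 = g ^ DIM('a) * kernel_const * 4 * (c * 2 powr \<bar>q\<bar>) + M * 2 powr (2 - q)"
  have parts: "0 \<le> g ^ DIM('a) * kernel_const * 4 * (c * 2 powr \<bar>q\<bar>)" "0 \<le> M * 2 powr (2 - q)"
    using g_pos kernel_const_nonneg c M0 by auto
  show thesis
  proof (rule that[of C1])
    show "C1 \<ge> 0" using parts by (simp add: C1_def)
    fix t
    show "norm (?f (Complex (S t) t)) \<le> C1 * (1 + \<bar>t\<bar>) powr (q - 2)"
    proof (cases "\<bar>t\<bar> \<ge> 1")
      case True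
      have "norm (tkernel g (Complex (S t) t)) \<le> g ^ DIM('a) * (g / g) powr Re (Complex (S t) t) * (kernel_const / \<bar>t\<bar>\<^sup>2)"
        by (rule kernel_bound'[OF g_pos]) (use True in auto)
      also have "\<dots> = g ^ DIM('a) * kernel_const * (1 / t\<^sup>2)" using g_pos by simp
      also have "\<dots> \<le> g ^ DIM('a) * kernel_const * (4 * (1 + \<bar>t\<bar>) powr - 2)"
        by (intro mult_left_mono inverse_square_le True) (use g_pos kernel_const_nonneg in auto)
      finally have 1: "norm (tkernel g (Complex (S t) t)) \<le> g ^ DIM('a) * kernel_const * (4 * (1 + \<bar>t\<bar>) powr - 2)" .
      have "norm (F (Complex (S t) t)) \<le> c * \<bar>t\<bar> powr q" by (rule L2[OF True])
      also have "\<dots> \<le> c * (2 powr \<bar>q\<bar> * (1 + \<bar>t\<bar>) powr q)"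
        by (intro mult_left_mono one_plus_le_double_powr True) (use c in auto)
      finally have "norm (?f (Complex (S t) t)) \<le> (g ^ DIM('a) * kernel_const * (4 * (1 + \<bar>t\<bar>) powr - 2)) * (c * (2 powr \<bar>q\<bar> * (1 + \<bar>t\<bar>) powr q))"
        unfolding norm_mult by (intro mult_mono 1) (use g_pos kernel_const_nonneg in auto)
      also have "\<dots> = g ^ DIM('a) * kernel_const * 4 * (c * 2 powr \<bar>q\<bar>) * (1 + \<bar>t\<bar>) powr (q - 2)"
        by (simp add: powr_diff powr_minus field_simps)
      also have "\<dots> \<le> C1 * (1 + \<bar>t\<bar>) powr (q - 2)"
        unfolding C1_def using parts by (intro mult_right_mono) auto
      finally show ?thesis .
    next
      case False
      then have "t \<in> {-1..1}" by (simp add: abs_if split: if_splits)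
      then have "norm (?f (Complex (S t) t)) \<le> M * 1" using M[of t] by (simp add: edge_def)
      also have "1 = (2::real) powr (2 - q) * 2 powr (q - 2)" by (simp flip: powr_add)
      also have "M * (2 powr (2 - q) * 2 powr (q - 2)) \<le> M * (2 powr (2 - q) * (1 + \<bar>t\<bar>) powr (q - 2))"
        using False q by (intro mult_left_mono powr_mono2' M0) auto
      also have "\<dots> \<le> C1 * (1 + \<bar>t\<bar>) powr (q - 2)"
        unfolding C1_def using parts by (simp add: mult_right_mono flip: mult.assoc)
      finally show ?thesis .
    qed
  qed
qed

lemma screen_integral_bound:
  assumes \<epsilon>: "\<epsilon> > 0" and S: "K-lipschitz_on UNIV S" and q: "q < 1" and C1: "C1 \<ge> 0"
    and F: "is_continuation (scaling_series l) (scaling_halfplane l) (window S) F"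
    and np: "\<And>t. \<not> is_pole F (Complex (S t) t)" and S0: "S 0 < 0"
    and bd: "\<And>t. norm (tkernel g (Complex (S t) t) * F (Complex (S t) t)) \<le> C1 * (1 + \<bar>t\<bar>) powr (q - 2)"
    and E: "\<And>t. (\<epsilon> / g) ^ DIM('a) * (g / \<epsilon>) powr S t \<le> E"
  shows "integrable lebesgue (screen_integrand S (\<lambda>s. tkernel \<epsilon> s * F s))"
    and "norm (screen_integral S (\<lambda>s. tkernel \<epsilon> s * F s)) \<le> E * (C1 * (K + 1) * (LINT t|lborel. (1 + \<bar>t\<bar>) powr (q - 2)))"
proof -
  let ?f = "\<lambda>s. tkernel \<epsilon> s * F s"
  have E0: "E \<ge> 0" using \<epsilon> g_pos order_trans[OF _ E[of 0]] by simp
  have K0: "K \<ge> 0" by (rule lipschitz_on_nonneg[OF S])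
  have nf: "norm (?f (Complex (S t) t)) \<le> E * (C1 * (1 + \<bar>t\<bar>) powr (q - 2))" for t
  proof -
    have "norm (?f (Complex (S t) t)) = (\<epsilon> / g) ^ DIM('a) * (g / \<epsilon>) powr S t * norm (tkernel g (Complex (S t) t) * F (Complex (S t) t))"
      unfolding norm_mult kernel_scale[OF \<epsilon>] by (simp add: mult_ac)
    also have "\<dots> \<le> E * (C1 * (1 + \<bar>t\<bar>) powr (q - 2))"
      by (intro mult_mono E bd) (use E0 in auto)
    finally show ?thesis .
  qed
  have "AE t in lebesgue. norm (screen_integrand S ?f t) \<le> norm (?f (Complex (S t) t)) * (K + 1)"
    by (rule AE_norm_screen_integrand_le[OF S])
  then have ae: "AE t in lebesgue. norm (screen_integrand S ?f t) \<le> E * C1 * (K + 1) * (1 + \<bar>t\<bar>) powr (q - 2)"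
  proof eventually_elim
    case (elim t)
    also have "norm (?f (Complex (S t) t)) * (K + 1) \<le> E * (C1 * (1 + \<bar>t\<bar>) powr (q - 2)) * (K + 1)"
      by (intro mult_right_mono nf) (use K0 in auto)
    finally show ?case by (simp add: mult_ac)
  qed
  from screen_continuous[OF \<epsilon> F np S0] have "screen_integrand S ?f \<in> borel_measurable lebesgue" by (rule screen_integrand_measurable[OF S])
  then show int: "integrable lebesgue (screen_integrand S ?f)"
    by (rule integrable_lebesgue_powr_bound[rotated, OF _ ae]) (use q in simp)
  have intp: "integrable lborel (\<lambda>t. (1 + \<bar>t\<bar>) powr (q - 2))" by (rule integrable_powr_tails) (use q in simp)
  then have intp': "integrable lebesgue (\<lambda>t. (1 + \<bar>t\<bar>) powr (q - 2))"
    by (subst integrable_completion) auto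
  have "norm (screen_integral S ?f) \<le> (LINT t|lebesgue. norm (screen_integrand S ?f t))"
    unfolding screen_integral_def by (rule integral_norm_bound)
  also have "\<dots> \<le> (LINT t|lebesgue. E * C1 * (K + 1) * (1 + \<bar>t\<bar>) powr (q - 2))"
    by (rule integral_mono_AE) (use int intp' ae in auto)
  also have "\<dots> = E * (C1 * (K + 1) * (LINT t|lebesgue. (1 + \<bar>t\<bar>) powr (q - 2)))" by (simp add: mult_ac)
  also have "(LINT t|lebesgue. (1 + \<bar>t\<bar>) powr (q - 2)) = (LINT t|lborel. (1 + \<bar>t\<bar>) powr (q - 2))"
    by (rule integral_completion) simp
  finally show "norm (screen_integral S ?f) \<le> E * (C1 * (K + 1) * (LINT t|lborel. (1 + \<bar>t\<bar>) powr (q - 2)))" .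
qed

lemma dims_between_eq:
  assumes "\<And>w. w \<in> W \<Longrightarrow> is_pole (scaling_zeta l W) w \<longleftrightarrow> is_pole F w"
  shows "dims_between T (tubular_dims l DIM('a) W) n
    = {w \<in> W. (is_pole F w \<or> w \<in> of_nat ` {..DIM('a)}) \<and> T (- int n) < Im w \<and> Im w < T (int n)}"
  using assms by (auto simp: dims_between_def tubular_dims_def scaling_dims_def)

lemma continuation_at_dim:
  assumes "is_continuation (scaling_series l) (scaling_halfplane l) W F"
  shows "F (of_nat DIM('a)) = of_real (\<Sum>j. l j ^ DIM('a))"
proof -
  have "of_nat DIM('a) \<in> scaling_halfplane l" using right_halfplane_subset by auto
  then have "F (of_nat DIM('a)) = scaling_series l (of_nat DIM('a))" using assms unfolding is_continuation_def by blast
  also have "\<dots> = (\<Sum>j. complex_of_real (l j ^ DIM('a)))"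
    unfolding scaling_series_def using l_pos by (intro suminf_cong) (simp add: powr_nat')
  also have "\<dots> = of_real (\<Sum>j. l j ^ DIM('a))" by (rule suminf_of_real[OF summable_power_dim, symmetric])
  finally show ?thesis .
qed

theorem tube_formula_with_error:
  assumes scr: "screen l S" and S0: "S 0 < 0" and q: "q < 1" and lang: "languid l S T q"
  shows "\<epsilon> > 0 \<Longrightarrow> integrable lebesgue (screen_integrand S (error_density l G \<kappa> (window S) \<epsilon>)) \<and>
           (\<exists>L. has_dims_sum T (tubular_dims l DIM('a) (window S)) (residue (tubular_zeta l G \<kappa> (window S) \<epsilon>)) L \<and>
                complex_of_real (parallel_volume (\<Union>j. Gs j) \<epsilon>) =
                  L + of_real vol * scaling_zeta l (window S) (of_nat DIM('a)) + error_term l G \<kappa> S \<epsilon>)"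
    and "(\<lambda>\<epsilon>. norm (error_term l G \<kappa> S \<epsilon>)) \<in> O[at_right 0](\<lambda>\<epsilon>. \<epsilon> powr (real DIM('a) - (SUP t. S t)))"
proof -
  define F where "F = scaling_zeta l (window S)"
  obtain K where S: "K-lipschitz_on UNIV S" using scr by (auto simp: screen_def)
  have Sle: "ereal (S t) \<le> abscissa l" for t using scr by (auto simp: screen_def)
  have np: "\<not> is_pole F (Complex (S t) t)" for t using scr by (auto simp: screen_def F_def)
  have F: "is_continuation (scaling_series l) (scaling_halfplane l) (window S) F"
    using scr unfolding screen_def scaling_zeta_extends_def F_def scaling_zeta_def
    by (auto intro: continuation_is_continuation)
  have W: "scaling_halfplane l \<subseteq> window S" by (rule halfplane_subset_window[OF Sle])
  have conn: "connected (window S)" by (rule connected_window[OF lipschitz_on_continuous_on[OF S]])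
  obtain c where c: "c > 0" "languid_L1 l S T q c" "\<And>t. 1 \<le> \<bar>t\<bar> \<Longrightarrow> norm (F (Complex (S t) t)) \<le> c * \<bar>t\<bar> powr q"
    and T: "languid_heights T" using lang unfolding languid_def F_def by blast
  have L1: "norm (F (Complex x (T n))) \<le> c * (\<bar>T n\<bar> + 1) powr q" if "S (T n) \<le> x" for n x
    using c(2) that by (simp add: languid_L1_def F_def)
  have hp: "\<not> is_pole F (Complex x (T n))" if "S (T n) \<le> x" for n x
    by (rule not_pole_if_bounded_right[where B="c * (\<bar>T n\<bar> + 1) powr q"]) (use L1 that in auto)
  obtain B0 where B0: "\<And>t. \<bar>S t\<bar> \<le> B0" using scr unfolding screen_def bounded_iff real_norm_def by auto
  have q2: "q < 2" using q by simp
  obtain C1 where C1: "C1 \<ge> 0" "\<And>t. norm (tkernel g (Complex (S t) t) * F (Complex (S t) t)) \<le> C1 * (1 + \<bar>t\<bar>) powr (q - 2)"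
    using screen_kernel_bound[OF S F np S0 q2 c(3,1)] by blast
  have ed: "error_density l G \<kappa> (window S) \<epsilon> = (\<lambda>s. tkernel \<epsilon> s * F s)" for \<epsilon>
    by (auto simp: error_density_eq F_def)
  note bound = screen_integral_bound[OF _ S q C1(1) F np S0 C1(2)]
  have E1: "(\<epsilon> / g) ^ DIM('a) * (g / \<epsilon>) powr S t \<le> (\<epsilon> / g) ^ DIM('a) * exp (\<bar>ln (g / \<epsilon>)\<bar> * B0)" if "\<epsilon> > 0" for \<epsilon> t
    by (intro mult_left_mono powr_le_exp B0) (use that g_pos in auto)
  have Tpm: "T (- int n) < 0" "0 < T (int n)" if "n \<ge> 1" for n using T that by (auto simp: languid_heights_def)
  show "integrable lebesgue (screen_integrand S (error_density l G \<kappa> (window S) \<epsilon>)) \<and>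
           (\<exists>L. has_dims_sum T (tubular_dims l DIM('a) (window S)) (residue (tubular_zeta l G \<kappa> (window S) \<epsilon>)) L \<and>
                complex_of_real (parallel_volume (\<Union>j. Gs j) \<epsilon>) =
                  L + of_real vol * scaling_zeta l (window S) (of_nat DIM('a)) + error_term l G \<kappa> S \<epsilon>)" if \<epsilon>: "\<epsilon> > 0" for \<epsilon>
  proof
    let ?f = "\<lambda>s. tkernel \<epsilon> s * F s"
    show int: "integrable lebesgue (screen_integrand S (error_density l G \<kappa> (window S) \<epsilon>))"
      unfolding ed by (rule bound(1)[OF \<epsilon> E1[OF \<epsilon>]])
    define P where "P = (\<lambda>n. dims_between T (tubular_dims l DIM('a) (window S)) n)"
    have P: "P n = {w \<in> window S. (is_pole F w \<or> w \<in> of_nat ` {..DIM('a)}) \<and> T (- int n) < Im w \<and> Im w < T (int n)}" for n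
      unfolding P_def by (rule dims_between_eq) (simp add: F_def)
    have strip: "finite (P n)" "has_boundary_integral (T (- int n)) (T (int n)) (real DIM('a) + 1) S ?f
      (2 * of_real pi * \<i> * (\<Sum>w\<in>P n. residue ?f w))" if n: "n \<ge> 1" for n
    proof -
      note s = residue_theorem_strip[OF \<epsilon> S Sle F np S0 Tpm[OF n] hp hp P]
      show "finite (P n)" by (rule s(1))
      show "has_boundary_integral (T (- int n)) (T (int n)) (real DIM('a) + 1) S ?f
        (2 * of_real pi * \<i> * (\<Sum>w\<in>P n. residue ?f w))" by (rule s(2))
    qed
    define a b where "a = (\<lambda>n. T (- int n))" and "b = (\<lambda>n. T (int n))"
    define I where "I = (\<lambda>y. integral {S y..real DIM('a) + 1} (\<lambda>x. ?f (Complex x y)))"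
    have eq: "2 * of_real pi * \<i> * (\<Sum>w\<in>P n. residue ?f w) = I (a n) + integral {a n..b n} (screen_integrand (\<lambda>_. real DIM('a) + 1) ?f)
        - I (b n) - integral {a n..b n} (screen_integrand S ?f)"
      and Ii: "((\<lambda>x. ?f (Complex x (a n))) has_integral I (a n)) {S (a n)..real DIM('a) + 1}"
        "((\<lambda>x. ?f (Complex x (b n))) has_integral I (b n)) {S (b n)..real DIM('a) + 1}" if n: "n \<ge> 1" for n
    proof -
      obtain i1 i2 i3 i4 where i: "((\<lambda>x. ?f (Complex x (a n))) has_integral i1) {S (a n)..real DIM('a) + 1}"
       "(screen_integrand (\<lambda>_. real DIM('a) + 1) ?f has_integral i2) {a n..b n}"
       "((\<lambda>x. ?f (Complex x (b n))) has_integral i3) {S (b n)..real DIM('a) + 1}"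
       "(screen_integrand S ?f has_integral i4) {a n..b n}" 
       "2 * of_real pi * \<i> * (\<Sum>w\<in>P n. residue ?f w) = i1 + i2 - i3 - i4"
        using strip(2)[OF n] unfolding has_boundary_integral_def a_def b_def by blast
      show "2 * of_real pi * \<i> * (\<Sum>w\<in>P n. residue ?f w) = I (a n) + integral {a n..b n} (screen_integrand (\<lambda>_. real DIM('a) + 1) ?f)
        - I (b n) - integral {a n..b n} (screen_integrand S ?f)"
        using i(5) integral_unique[OF i(1)] integral_unique[OF i(2)] integral_unique[OF i(3)] integral_unique[OF i(4)]
        by (simp add: I_def)
      show "((\<lambda>x. ?f (Complex x (a n))) has_integral I (a n)) {S (a n)..real DIM('a) + 1}"
        "((\<lambda>x. ?f (Complex x (b n))) has_integral I (b n)) {S (b n)..real DIM('a) + 1}"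
        using i(1,3) integral_unique[OF i(1)] integral_unique[OF i(3)] by (auto simp: I_def)
    qed
    have a_lim: "filterlim a at_bot sequentially" and b_lim: "filterlim b at_top sequentially"
      using T by (auto simp: languid_heights_def a_def b_def)
    define B1 where "B1 = B0 + (real DIM('a) + 1)"
    have B00: "B0 \<ge> 0" using B0[of 0] by simp
    define E where "E = \<epsilon> ^ DIM('a) * (kernel_const * c) * exp (\<bar>ln (g / \<epsilon>)\<bar> * B1) * B1"
    have In: "norm (I (T n)) \<le> E * ((\<bar>T n\<bar> + 1) powr q / (T n)\<^sup>2)"
      if n: "T n \<noteq> 0" "((\<lambda>x. ?f (Complex x (T n))) has_integral I (T n)) {S (T n)..real DIM('a) + 1}" for n
    proof -
      define h where "h = \<epsilon> ^ DIM('a) * (kernel_const * c) * ((\<bar>T n\<bar> + 1) powr q / (T n)\<^sup>2)"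
      have h0: "h \<ge> 0" unfolding h_def using \<epsilon> kernel_const_nonneg c(1) by auto
      have le: "S (T n) \<le> real DIM('a) + 1" using B0[of "T n"] order.strict_trans1[OF Sle abscissa, of "T n"] by simp
      have "norm (I (T n)) \<le> (h * exp (\<bar>ln (g / \<epsilon>)\<bar> * B1)) * (real DIM('a) + 1 - S (T n))"
      proof (rule has_integral_norm_bound_AE[OF n(2) le])
        show "AE x in lebesgue. x \<in> {S (T n)..real DIM('a) + 1} \<longrightarrow> norm (?f (Complex x (T n))) \<le> h * exp (\<bar>ln (g / \<epsilon>)\<bar> * B1)"
        proof (rule AE_I2, rule impI)
          fix x assume x: "x \<in> {S (T n)..real DIM('a) + 1}"
          then have "\<bar>x\<bar> \<le> B1" using B0[of "T n"] B00 by (auto simp: B1_def)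
          have "norm (?f (Complex x (T n))) \<le> h * (g / \<epsilon>) powr x"
            unfolding h_def by (rule horizontal_bound[OF \<epsilon> n(1)]) (use L1 x in auto)
          also have "\<dots> \<le> h * exp (\<bar>ln (g / \<epsilon>)\<bar> * B1)"
            by (intro mult_left_mono powr_le_exp h0 \<open>\<bar>x\<bar> \<le> B1\<close>) (use \<epsilon> g_pos in auto)
          finally show "norm (?f (Complex x (T n))) \<le> h * exp (\<bar>ln (g / \<epsilon>)\<bar> * B1)" .
        qed
      qed (use h0 in auto)
      also have "\<dots> \<le> (h * exp (\<bar>ln (g / \<epsilon>)\<bar> * B1)) * B1"
        by (rule mult_left_mono) (use h0 B0[of "T n"] in \<open>auto simp: B1_def abs_le_iff\<close>)
      finally show ?thesis by (simp add: E_def h_def mult_ac)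
    qed
    have Ia: "(\<lambda>n. I (a n)) \<longlonglongrightarrow> 0"
    proof (rule Lim_null_comparison)
      show "(\<lambda>n. E * ((\<bar>a n\<bar> + 1) powr q / (a n)\<^sup>2)) \<longlonglongrightarrow> 0"
        using tendsto_height_factor[OF filterlim_heights(2)[OF T] q2] by (intro tendsto_mult_right_zero) (simp add: a_def)
      show "\<forall>\<^sub>F n in sequentially. norm (I (a n)) \<le> E * ((\<bar>a n\<bar> + 1) powr q / (a n)\<^sup>2)"
        using eventually_ge_at_top[of 1]
      proof eventually_elim
        case (elim n)
        then show ?case using In[of "- int n", OF _ Ii(1)[OF elim, unfolded a_def]] Tpm(1)[OF elim] unfolding a_def by simp
      qed
    qed
    have Ib: "(\<lambda>n. I (b n)) \<longlonglongrightarrow> 0"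
    proof (rule Lim_null_comparison)
      show "(\<lambda>n. E * ((\<bar>b n\<bar> + 1) powr q / (b n)\<^sup>2)) \<longlonglongrightarrow> 0"
        using tendsto_height_factor[OF filterlim_heights(1)[OF T] q2] by (intro tendsto_mult_right_zero) (simp add: b_def)
      show "\<forall>\<^sub>F n in sequentially. norm (I (b n)) \<le> E * ((\<bar>b n\<bar> + 1) powr q / (b n)\<^sup>2)"
        using eventually_ge_at_top[of 1]
      proof eventually_elim
        case (elim n)
        then show ?case using In[of "int n", OF _ Ii(2)[OF elim, unfolded b_def]] Tpm(2)[OF elim] unfolding b_def by simp
      qed
    qed
    have "(\<lambda>n. I (a n) + integral {a n..b n} (screen_integrand (\<lambda>_. real DIM('a) + 1) ?f) - I (b n) - integral {a n..b n} (screen_integrand S ?f))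
      \<longlonglongrightarrow> 0 + 2 * of_real pi * \<i> * of_real (main_part \<epsilon>) - 0 - screen_integral S ?f"
      unfolding screen_integral_def
      by (intro tendsto_diff tendsto_add Ia Ib line_limit_heights[OF F W \<epsilon> a_lim b_lim] integral_exhaust_line a_lim b_lim)
         (use int ed in simp)
    then have "(\<lambda>n. 2 * of_real pi * \<i> * (\<Sum>w\<in>P n. residue ?f w)) \<longlonglongrightarrow> 0 + 2 * of_real pi * \<i> * of_real (main_part \<epsilon>) - 0 - screen_integral S ?f"
      by (rule Lim_transform_eventually) (use eq in \<open>auto simp: eventually_sequentially intro!: exI[of _ 1]\<close>)
    then have "(\<lambda>n. 2 * of_real pi * \<i> * (\<Sum>w\<in>P n. residue ?f w)) \<longlonglongrightarrow> 2 * of_real pi * \<i> * of_real (main_part \<epsilon>) - screen_integral S ?f"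
      by (simp only: add_0_left diff_zero)
    then have "(\<lambda>n. 2 * of_real pi * \<i> * (\<Sum>w\<in>P n. residue ?f w) / (2 * of_real pi * \<i>)) \<longlonglongrightarrow> (2 * of_real pi * \<i> * of_real (main_part \<epsilon>) - screen_integral S ?f) / (2 * of_real pi * \<i>)"
      by (rule tendsto_divide[OF _ tendsto_const]) simp
    then have "(\<lambda>n. \<Sum>w\<in>P n. residue ?f w) \<longlonglongrightarrow> (2 * of_real pi * \<i> * of_real (main_part \<epsilon>) - screen_integral S ?f) / (2 * of_real pi * \<i>)"
      by simp
    moreover have "(2 * of_real pi * \<i> * of_real (main_part \<epsilon>) - screen_integral S ?f) / (2 * of_real pi * \<i>) = of_real (main_part \<epsilon>) - error_term l G \<kappa> S \<epsilon>"
      unfolding error_term_def ed by (simp add: diff_divide_distrib)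
    ultimately have lim1: "(\<lambda>n. \<Sum>w\<in>P n. residue ?f w) \<longlonglongrightarrow> of_real (main_part \<epsilon>) - error_term l G \<kappa> S \<epsilon>" by simp
    define L where "L = of_real (main_part \<epsilon>) - error_term l G \<kappa> S \<epsilon> + (\<Sum>m\<le>DIM('a). residue (correction \<epsilon>) (of_nat m))"
    have limL: "(\<lambda>n. (\<Sum>w\<in>P n. residue ?f w) + (\<Sum>m\<le>DIM('a). residue (correction \<epsilon>) (of_nat m))) \<longlonglongrightarrow> L"
      unfolding L_def by (intro tendsto_add lim1 tendsto_const)
    have split: "(\<Sum>w\<in>P n. residue (tubular_zeta l G \<kappa> (window S) \<epsilon>) w) = (\<Sum>w\<in>P n. residue ?f w) + (\<Sum>m\<le>DIM('a). residue (correction \<epsilon>) (of_nat m))"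
      if n: "n \<ge> 1" for n
    proof -
      have "(\<Sum>w\<in>P n. residue (tubular_zeta l G \<kappa> (window S) \<epsilon>) w) = (\<Sum>w\<in>P n. residue ?f w + residue (correction \<epsilon>) w)"
        by (intro sum.cong refl residue_tubular_zeta[OF \<epsilon> F conn W]) (auto simp: P)
      moreover have "of_nat ` {..DIM('a)} \<subseteq> P n" using Tpm[OF n] S0 by (auto simp: P window_def)
      ultimately show ?thesis using sum_residue_correction[OF \<epsilon> strip(1)[OF n]] by (simp add: sum.distrib)
    qed
    have "has_dims_sum T (tubular_dims l DIM('a) (window S)) (residue (tubular_zeta l G \<kappa> (window S) \<epsilon>)) L"
      unfolding has_dims_sum_def P_def[symmetric]
      by (rule Lim_transform_eventually[OF limL]) (use split in \<open>auto simp: eventually_sequentially intro!: exI[of _ 1]\<close>)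
    moreover have "complex_of_real (parallel_volume (\<Union>j. Gs j) \<epsilon>) =
                  L + of_real vol * scaling_zeta l (window S) (of_nat DIM('a)) + error_term l G \<kappa> S \<epsilon>"
      using volume_eq[OF \<epsilon>] continuation_at_dim[OF F] by (simp add: L_def F_def)
    ultimately show "\<exists>L. has_dims_sum T (tubular_dims l DIM('a) (window S)) (residue (tubular_zeta l G \<kappa> (window S) \<epsilon>)) L \<and>
                complex_of_real (parallel_volume (\<Union>j. Gs j) \<epsilon>) =
                  L + of_real vol * scaling_zeta l (window S) (of_nat DIM('a)) + error_term l G \<kappa> S \<epsilon>" by blast
  qed
  show "(\<lambda>\<epsilon>. norm (error_term l G \<kappa> S \<epsilon>)) \<in> O[at_right 0](\<lambda>\<epsilon>. \<epsilon> powr (real DIM('a) - (SUP t. S t)))"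
  proof -
    define \<sigma> where "\<sigma> = (SUP t. S t)"
    have S\<sigma>: "S t \<le> \<sigma>" for t unfolding \<sigma>_def
      using scr by (intro cSUP_upper bounded_imp_bdd_above) (auto simp: screen_def)
    define E where "E = exp (\<bar>ln g\<bar> * (B0 + real DIM('a)))"
    define Q where "Q = C1 * (K + 1) * (LINT t|lborel. (1 + \<bar>t\<bar>) powr (q - 2))"
    have b: "norm (error_term l G \<kappa> S \<epsilon>) \<le> (E * Q / (2 * pi)) * norm (\<epsilon> powr (real DIM('a) - \<sigma>))" if \<epsilon>: "0 < \<epsilon>" "\<epsilon> < 1" for \<epsilon>
    proof -
      have EE: "(\<epsilon> / g) ^ DIM('a) * (g / \<epsilon>) powr S t \<le> E * \<epsilon> powr (real DIM('a) - \<sigma>)" for t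
      proof -
        have "(\<epsilon> / g) ^ DIM('a) * (g / \<epsilon>) powr S t = g powr (S t - real DIM('a)) * \<epsilon> powr (real DIM('a) - S t)"
          using \<epsilon> g_pos by (simp add: powr_diff powr_divide powr_realpow power_divide field_simps)
        also have "\<dots> \<le> E * \<epsilon> powr (real DIM('a) - \<sigma>)"
          unfolding E_def using \<epsilon> g_pos S\<sigma>[of t] B0[of t] by (intro mult_mono powr_le_exp powr_mono') auto
        finally show ?thesis .
      qed
      have "norm (screen_integral S (error_density l G \<kappa> (window S) \<epsilon>)) \<le> (E * \<epsilon> powr (real DIM('a) - \<sigma>)) * Q"
        unfolding ed Q_def by (rule bound(2)[OF \<epsilon>(1) EE])
      then show ?thesis unfolding error_term_def by (simp add: norm_mult norm_divide divide_simps mult_ac)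
    qed
    show ?thesis unfolding \<sigma>_def[symmetric]
    proof (rule bigoI[of _ "E * Q / (2 * pi)"])
      have "\<forall>\<^sub>F \<epsilon> in at_right (0::real). 0 < \<epsilon> \<and> \<epsilon> < 1"
        using eventually_at_right_real[of 0 "1::real"] by simp
      then show "\<forall>\<^sub>F \<epsilon> in at_right 0. norm (norm (error_term l G \<kappa> S \<epsilon>)) \<le> E * Q / (2 * pi) * norm (\<epsilon> powr (real DIM('a) - \<sigma>))"
        by eventually_elim (use b in auto)
    qed
  qed
qed

section \<open>The tube formula without error term\<close>

lemma continuations_agree:
  assumes F1: "is_continuation (scaling_series l) (scaling_halfplane l) W F1"
    and F2: "is_continuation (scaling_series l) (scaling_halfplane l) W F2"
    and W: "connected W" "scaling_halfplane l \<subseteq> W" and w: "w \<in> W"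
  shows "\<forall>\<^sub>F z in nhds w. F1 z = F2 z"
proof (rule continuation_unique[OF F1 F2 W(1), of "{s. real DIM('a) < Re s}" "of_nat (Suc DIM('a))"])
  show "{s. real DIM('a) < Re s} \<subseteq> scaling_halfplane l" using right_halfplane_subset by auto
  then show "{s. real DIM('a) < Re s} \<subseteq> W" using W by auto
qed (use w in \<open>auto intro: open_halfspace_Re_gt\<close>)

text \<open>
  The continuations to the windows of the exhausting screens agree where two of them are defined, and
  are glued together.
\<close>

lemma continuation_to_plane:
  assumes scr: "\<And>m. screen l (S m)" and lim: "filterlim (\<lambda>m. SUP t. S m t) at_bot sequentially"
  shows "scaling_zeta_extends l UNIV"
proof -
  define \<sigma> where "\<sigma> = (\<lambda>m. SUP t. S m t)"
  have S\<sigma>: "S m t \<le> \<sigma> m" for m t unfolding \<sigma>_def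
    using scr[of m] by (intro cSUP_upper bounded_imp_bdd_above) (auto simp: screen_def)
  define Fm where "Fm = (\<lambda>m. scaling_zeta l (window (S m)))"
  have cont: "continuous_on UNIV (S m)" for m
    using scr[of m] lipschitz_on_continuous_on by (auto simp: screen_def)
  have Sle: "ereal (S m t) \<le> abscissa l" for m t using scr[of m] by (auto simp: screen_def)
  have Fm: "is_continuation (scaling_series l) (scaling_halfplane l) (window (S m)) (Fm m)" for m
    using scr[of m] unfolding screen_def scaling_zeta_extends_def Fm_def scaling_zeta_def
    by (auto intro: continuation_is_continuation)
  have agree: "Fm m z = Fm m' z" if "z \<in> window (S m)" "z \<in> window (S m')" for m m' z
  proof -
    let ?W = "window (\<lambda>t. max (S m t) (S m' t))"
    have W: "?W \<subseteq> window (S m)" "?W \<subseteq> window (S m')" "z \<in> ?W" using that by (auto simp: window_def)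
    have "connected ?W" by (intro connected_window continuous_on_max cont)
    moreover have "scaling_halfplane l \<subseteq> ?W" by (rule halfplane_subset_window) (use Sle in \<open>auto simp: max_def\<close>)
    ultimately have "\<forall>\<^sub>F w in nhds z. Fm m w = Fm m' w"
      using continuations_agree[OF is_continuation_subset[OF Fm W(1)] is_continuation_subset[OF Fm W(2)] _ _ W(3)] by blast
    then show ?thesis by (rule eventually_nhds_x_imp_x)
  qed
  \<comment> \<open>a screen that runs at distance at least \<open>1\<close> to the left of \<open>z\<close>\<close>
  define M where "M = (\<lambda>z. SOME m. \<sigma> m < Re z - 1)"
  have M: "\<sigma> (M z) < Re z - 1" for z
  proof -
    have "\<forall>\<^sub>F m in sequentially. \<sigma> m < Re z - 1" using lim unfolding \<sigma>_def[symmetric] by (simp add: filterlim_at_bot_dense)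
    then obtain m where "\<sigma> m < Re z - 1" by (auto simp: eventually_sequentially)
    then show ?thesis unfolding M_def by (rule someI)
  qed
  define F where "F = (\<lambda>z. Fm (M z) z)"
  have in_window: "w \<in> window (S (M z))" if "Re z - 1 \<le> Re w" for w z
    using S\<sigma>[of "M z" "Im w"] M[of z] that by (simp add: window_def)
  have F_eq: "F z = Fm m z" if "z \<in> window (S m)" for m z
    unfolding F_def by (rule agree[OF in_window that]) simp
  have near: "\<forall>\<^sub>F w in nhds z. F w = Fm (M z) w" for z
  proof -
    have "\<forall>\<^sub>F w in nhds z. Re z - 1 < Re w"
      using eventually_nhds_in_open[OF open_halfspace_Re_gt[of "Re z - 1"], of z] by simp
    then show ?thesis by eventually_elim (use F_eq in_window in \<open>auto intro: less_imp_le\<close>)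
  qed
  have "F nicely_meromorphic_on UNIV"
    unfolding nicely_meromorphic_on_def
  proof (intro conjI ballI)
    have at: "\<forall>\<^sub>F w in at z. F w = Fm (M z) w" for z using near[of z] by (simp add: eventually_nhds_conv_at)
    have n: "Fm (M z) nicely_meromorphic_on {z}" for z
      by (rule nicely_meromorphic_on_subset[OF is_continuation_nicely[OF Fm]]) (use in_window[of z z] in auto)
    show "F meromorphic_on UNIV"
    proof (subst meromorphic_on_meromorphic_at, rule ballI)
      fix z
      have "Fm (M z) meromorphic_on {z}" using n by (simp add: nicely_meromorphic_on_def)
      then show "F meromorphic_on {z}"
        using at[of z] by (subst meromorphic_on_cong[of _ _ "Fm (M z)"]) auto
    qed
    fix z :: complex
    have "is_pole (Fm (M z)) z \<and> Fm (M z) z = 0 \<or> Fm (M z) \<midarrow>z\<rightarrow> Fm (M z) z" using n[of z] by (simp add: nicely_meromorphic_on_def)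
    moreover have "F z = Fm (M z) z" by (simp add: F_def)
    ultimately show "is_pole F z \<and> F z = 0 \<or> F \<midarrow>z\<rightarrow> F z"
      using is_pole_cong[OF at[of z] refl] tendsto_cong[OF at[of z]] by simp
  qed
  moreover have "F s = scaling_series l s" if "s \<in> scaling_halfplane l" for s
    using Fm[of "M s"] that by (simp add: F_def is_continuation_def)
  ultimately have "is_continuation (scaling_series l) (scaling_halfplane l) UNIV F"
    unfolding is_continuation_def by (intro conjI exI[of _ UNIV]) auto
  then show ?thesis unfolding scaling_zeta_extends_def by blast
qed

text \<open>
  Between two fixed heights the residue theorem is applied to every screen \<open>S m\<close>. As \<open>m\<close> grows, the horizontal
  integrals converge to integrals over rays, since \<open>(g / \<epsilon>) powr Re s\<close> decays exponentially to the left for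
  \<open>\<epsilon> < g\<close>, and the integral over the screen tends to \<open>0\<close>, since \<open>A * \<epsilon> / g < 1\<close>.
\<close>

theorem tube_formula_exact:
  assumes A: "A > 0" and q: "q < 2" and sl: "strongly_languid l S T q A"
    and \<epsilon>: "0 < \<epsilon>" "\<epsilon> < min g (inverse A * g)"
  shows "\<exists>L. has_full_dims_sum (\<lambda>m. window (S m)) T (tubular_dims l DIM('a) UNIV) (residue (tubular_zeta l G \<kappa> UNIV \<epsilon>)) L \<and>
     complex_of_real (parallel_volume (\<Union>j. Gs j) \<epsilon>) = L + of_real vol * scaling_zeta l UNIV (of_nat DIM('a))"
proof -
  define F where "F = scaling_zeta l UNIV"
  define \<sigma> where "\<sigma> = (\<lambda>m. SUP t. S m t)"
  have T: "languid_heights T" and scr: "\<And>m. screen l (S m)" and \<sigma>lim: "filterlim \<sigma> at_bot sequentially"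
    using sl by (auto simp: strongly_languid_def \<sigma>_def)
  obtain K where S: "\<And>m. K-lipschitz_on UNIV (S m)" using sl by (auto simp: strongly_languid_def)
  obtain c where c: "c > 0" "\<And>m. languid_L1 l (S m) T q c"
    "\<And>m t. norm (scaling_zeta l (window (S m)) (Complex (S m t) t)) \<le> c * A powr \<bar>S m t\<bar> * (\<bar>t\<bar> + 1) powr q"
    using sl unfolding strongly_languid_def by blast
  have S\<sigma>: "S m t \<le> \<sigma> m" for m t unfolding \<sigma>_def
    using scr[of m] by (intro cSUP_upper bounded_imp_bdd_above) (auto simp: screen_def)
  have cont: "continuous_on UNIV (S m)" for m using S lipschitz_on_continuous_on by blast
  have Sle: "ereal (S m t) \<le> abscissa l" for m t using scr[of m] by (auto simp: screen_def)
  have W: "scaling_halfplane l \<subseteq> window (S m)" for m by (rule halfplane_subset_window[OF Sle])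
  have FU: "is_continuation (scaling_series l) (scaling_halfplane l) UNIV F"
    using continuation_to_plane[OF scr \<sigma>lim[unfolded \<sigma>_def]] unfolding scaling_zeta_extends_def F_def scaling_zeta_def
    by (auto intro: continuation_is_continuation)
  have F: "is_continuation (scaling_series l) (scaling_halfplane l) (window (S m)) F" for m
    by (rule is_continuation_subset[OF FU]) simp
  have ev: "\<forall>\<^sub>F z in nhds w. scaling_zeta l (window (S m)) z = F z" if "w \<in> window (S m)" for m w
  proof (rule continuations_agree[OF _ F _ W that])
    show "is_continuation (scaling_series l) (scaling_halfplane l) (window (S m)) (scaling_zeta l (window (S m)))"
      unfolding scaling_zeta_def by (rule continuation_is_continuation[OF F])
    show "connected (window (S m))" by (rule connected_window[OF cont])
  qed
  have eqF: "scaling_zeta l (window (S m)) w = F w" if "w \<in> window (S m)" for m w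
    using eventually_nhds_x_imp_x[OF ev[OF that]] .
  have np: "\<not> is_pole F (Complex (S m t) t)" for m t
  proof -
    have "Complex (S m t) t \<in> window (S m)" by (simp add: window_def)
    then have "\<forall>\<^sub>F z in at (Complex (S m t) t). scaling_zeta l (window (S m)) z = F z"
      using ev by (simp add: eventually_nhds_conv_at)
    from is_pole_cong[OF this refl] show ?thesis using scr[of m] by (auto simp: screen_def)
  qed
  have \<sigma>ev: "\<forall>\<^sub>F m in sequentially. \<sigma> m \<le> x" for x using \<sigma>lim by (simp add: filterlim_at_bot)
  have L1: "norm (F (Complex x (T n))) \<le> c * (\<bar>T n\<bar> + 1) powr q" for n x
  proof -
    obtain m where "\<sigma> m \<le> x" using \<sigma>ev[of x] by (auto simp: eventually_sequentially)
    then have "S m (T n) \<le> x" using S\<sigma>[of m "T n"] by simp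
    then show ?thesis using c(2)[of m] eqF[of "Complex x (T n)" m] unfolding languid_L1_def
      by (metis complex.sel mem_Collect_eq window_def)
  qed
  have hp: "\<not> is_pole F (Complex x (T n))" for n x
    by (rule not_pole_if_bounded_right[where B="c * (\<bar>T n\<bar> + 1) powr q"]) (use L1 in auto)
  have L2: "norm (F (Complex (S m t) t)) \<le> c * A powr \<bar>S m t\<bar> * (\<bar>t\<bar> + 1) powr q" for m t
    using c(3)[of m t] eqF[of "Complex (S m t) t" m] by (simp add: window_def)
  have Tpm: "T (- int n) < 0" "0 < T (int n)" if "n \<ge> 1" for n using T that by (auto simp: languid_heights_def)
  define \<gamma> where "\<gamma> = ln (g / \<epsilon>)"
  have \<gamma>: "\<gamma> > 0" using \<epsilon> by (simp add: \<gamma>_def)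
  have gexp: "(g / \<epsilon>) powr x = exp (\<gamma> * x)" for x using \<epsilon> g_pos by (simp add: powr_def \<gamma>_def mult.commute)
  define \<theta> where "\<theta> = A * \<epsilon> / g"
  have \<theta>: "0 < \<theta>" "\<theta> < 1" using \<epsilon> A g_pos by (auto simp: \<theta>_def field_simps)
  let ?f = "\<lambda>s. tkernel \<epsilon> s * F s"
  let ?c = "real DIM('a) + 1"
  define \<Omega> where "\<Omega> = (\<lambda>n. dims_between T (tubular_dims l DIM('a) UNIV) n)"
  have \<Omega>: "\<Omega> n = {w. (is_pole F w \<or> w \<in> of_nat ` {..DIM('a)}) \<and> T (- int n) < Im w \<and> Im w < T (int n)}" for n
    using dims_between_eq[of UNIV F] by (auto simp: \<Omega>_def F_def)
  have P: "\<Omega> n \<inter> window (S m) = {w \<in> window (S m). (is_pole F w \<or> w \<in> of_nat ` {..DIM('a)}) \<and> T (- int n) < Im w \<and> Im w < T (int n)}" for n m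
    unfolding \<Omega> by auto
  \<comment> \<open>from the index \<open>M\<close> on, the windows contain \<open>0, ..., d\<close> and the screens keep distance \<open>1\<close> from these\<close>
  obtain M where M: "\<And>m. m \<ge> M \<Longrightarrow> \<sigma> m \<le> -1" using \<sigma>ev[of "-1"] by (auto simp: eventually_sequentially)
  have S1: "S m t \<le> -1" if "m \<ge> M" for m t using S\<sigma>[of m t] M[OF that] by simp
  have strip: "finite (\<Omega> n \<inter> window (S m))" "has_boundary_integral (T (- int n)) (T (int n)) ?c (S m) ?f
      (2 * of_real pi * \<i> * (\<Sum>w\<in>\<Omega> n \<inter> window (S m). residue ?f w))" if n: "n \<ge> 1" and m: "m \<ge> M" for n m
  proof -
    have S0: "S m 0 < 0" using S1[OF m, of 0] by simp
    note s = residue_theorem_strip[OF \<epsilon>(1) S Sle F np S0 Tpm[OF n] hp hp P]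
    show "finite (\<Omega> n \<inter> window (S m))" by (rule s(1))
    show "has_boundary_integral (T (- int n)) (T (int n)) ?c (S m) ?f
      (2 * of_real pi * \<i> * (\<Sum>w\<in>\<Omega> n \<inter> window (S m). residue ?f w))" by (rule s(2))
  qed
  define a b where "a = (\<lambda>n. T (- int n))" and "b = (\<lambda>n. T (int n))"
  define ray where "ray = (\<lambda>m y. integral {S m y..?c} (\<lambda>x. ?f (Complex x y)))"
  have eq: "2 * of_real pi * \<i> * (\<Sum>w\<in>\<Omega> n \<inter> window (S m). residue ?f w) = ray m (a n) + integral {a n..b n} (screen_integrand (\<lambda>_. ?c) ?f)
        - ray m (b n) - integral {a n..b n} (screen_integrand (S m) ?f)"
    and Ii: "(\<lambda>x. ?f (Complex x (a n))) integrable_on {S m (a n)..?c}"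
        "(\<lambda>x. ?f (Complex x (b n))) integrable_on {S m (b n)..?c}" 
    and Is: "(screen_integrand (S m) ?f) integrable_on {a n..b n}" if n: "n \<ge> 1" and m: "m \<ge> M" for n m
  proof -
    obtain i1 i2 i3 i4 where i: "((\<lambda>x. ?f (Complex x (a n))) has_integral i1) {S m (a n)..?c}"
       "(screen_integrand (\<lambda>_. ?c) ?f has_integral i2) {a n..b n}"
       "((\<lambda>x. ?f (Complex x (b n))) has_integral i3) {S m (b n)..?c}"
       "(screen_integrand (S m) ?f has_integral i4) {a n..b n}" 
       "2 * of_real pi * \<i> * (\<Sum>w\<in>\<Omega> n \<inter> window (S m). residue ?f w) = i1 + i2 - i3 - i4"
      using strip(2)[OF n m] unfolding has_boundary_integral_def a_def b_def by blast
    show "2 * of_real pi * \<i> * (\<Sum>w\<in>\<Omega> n \<inter> window (S m). residue ?f w) = ray m (a n) + integral {a n..b n} (screen_integrand (\<lambda>_. ?c) ?f)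
        - ray m (b n) - integral {a n..b n} (screen_integrand (S m) ?f)"
      using i(5) integral_unique[OF i(1)] integral_unique[OF i(2)] integral_unique[OF i(3)] integral_unique[OF i(4)]
      by (simp add: ray_def)
    show "(\<lambda>x. ?f (Complex x (a n))) integrable_on {S m (a n)..?c}"
        "(\<lambda>x. ?f (Complex x (b n))) integrable_on {S m (b n)..?c}" "(screen_integrand (S m) ?f) integrable_on {a n..b n}"
      using i by (auto intro: has_integral_integrable)
  qed
  define I where "I = (\<lambda>y. lim (\<lambda>m. ray m y))"
  define E where "E = \<epsilon> ^ DIM('a) * (kernel_const * c) * exp (\<gamma> * ?c) / \<gamma>"
  have ray_lim: "(\<lambda>m. ray m (T k)) \<longlonglongrightarrow> I (T k) \<and> norm (I (T k)) \<le> E * ((\<bar>T k\<bar> + 1) powr q / (T k)\<^sup>2)"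
    if Tk: "T k \<noteq> 0" and int: "\<And>m. m \<ge> M \<Longrightarrow> (\<lambda>x. ?f (Complex x (T k))) integrable_on {S m (T k)..?c}" for k
  proof -
    define h where "h = \<epsilon> ^ DIM('a) * (kernel_const * c) * ((\<bar>T k\<bar> + 1) powr q / (T k)\<^sup>2)"
    have h0: "h \<ge> 0" unfolding h_def using \<epsilon> kernel_const_nonneg c(1) by auto
    obtain L where L: "(\<lambda>m. integral {S m (T k)..?c} (\<lambda>x. ?f (Complex x (T k)))) \<longlonglongrightarrow> L" "norm L \<le> h * exp (\<gamma> * ?c) / \<gamma>"
    proof (rule left_ray_limit[OF \<gamma> h0])
      show "filterlim (\<lambda>m. S m (T k)) at_bot sequentially"
        unfolding filterlim_at_bot
      proof
        fix x show "\<forall>\<^sub>F m in sequentially. S m (T k) \<le> x"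
          using \<sigma>ev[of x] by eventually_elim (use S\<sigma> order_trans in blast)
      qed
      show "S m (T k) \<le> ?c \<and> (\<lambda>x. ?f (Complex x (T k))) integrable_on {S m (T k)..?c}" if "M \<le> m" for m
        using int[OF that] S1[OF that, of "T k"] by simp
      show "norm (?f (Complex x (T k))) \<le> h * exp (\<gamma> * x)" for x
        using horizontal_bound[where F=F and x=x and t="T k", OF \<epsilon>(1) Tk L1] by (simp only: h_def gexp)
    qed
    then have "(\<lambda>m. ray m (T k)) \<longlonglongrightarrow> L" by (simp add: ray_def)
    moreover from this have "I (T k) = L" unfolding I_def by (rule limI)
    ultimately show ?thesis using L(2) by (simp add: E_def h_def mult_ac)
  qed
  have ray_a: "(\<lambda>m. ray m (a n)) \<longlonglongrightarrow> I (a n)" "norm (I (a n)) \<le> E * ((\<bar>a n\<bar> + 1) powr q / (a n)\<^sup>2)"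
    and ray_b: "(\<lambda>m. ray m (b n)) \<longlonglongrightarrow> I (b n)" "norm (I (b n)) \<le> E * ((\<bar>b n\<bar> + 1) powr q / (b n)\<^sup>2)" if n: "n \<ge> 1" for n
    using ray_lim[of "- int n"] ray_lim[of "int n"] Ii[OF n] Tpm[OF n] unfolding a_def b_def by auto
  have screen_lim: "(\<lambda>m. integral {a n..b n} (screen_integrand (S m) ?f)) \<longlonglongrightarrow> 0" if n: "n \<ge> 1" for n
  proof (rule Lim_null_comparison)
    define R where "R = (\<bar>a n\<bar> + \<bar>b n\<bar> + 1) powr \<bar>q\<bar>"
    define Q where "Q = \<epsilon> ^ DIM('a) * kernel_const * (c * R) * (K + 1) * (b n - a n)"
    have ab: "a n \<le> b n" using Tpm[OF n] by (simp add: a_def b_def)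
    have K0: "K \<ge> 0" by (rule lipschitz_on_nonneg[OF S])
    have "filterlim (\<lambda>m. - ln \<theta> * \<sigma> m) at_bot sequentially"
      using \<theta> by (intro filterlim_tendsto_pos_mult_at_bot[OF tendsto_const _ \<sigma>lim]) simp
    then have "(\<lambda>m. exp (- ln \<theta> * \<sigma> m)) \<longlonglongrightarrow> 0" by (rule filterlim_compose[OF exp_at_bot])
    moreover have "exp (- ln \<theta> * \<sigma> m) = \<theta> powr (- \<sigma> m)" for m using \<theta> by (simp add: powr_def mult.commute)
    ultimately have "(\<lambda>m. \<theta> powr (- \<sigma> m)) \<longlonglongrightarrow> 0" by simp
    then show "(\<lambda>m. Q * \<theta> powr (- \<sigma> m)) \<longlonglongrightarrow> 0" by (rule tendsto_mult_right_zero)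
    show "\<forall>\<^sub>F m in sequentially. norm (integral {a n..b n} (screen_integrand (S m) ?f)) \<le> Q * \<theta> powr (- \<sigma> m)"
      using eventually_ge_at_top[of M]
    proof eventually_elim
      case (elim m)
      have pt: "norm (?f (Complex (S m t) t)) \<le> \<epsilon> ^ DIM('a) * kernel_const * (c * R) * \<theta> powr (- \<sigma> m)" if t: "t \<in> {a n..b n}" for t
      proof -
        have s1: "S m t \<le> -1" by (rule S1[OF elim])
        have "norm (tkernel \<epsilon> (Complex (S m t) t)) \<le> \<epsilon> ^ DIM('a) * (g / \<epsilon>) powr Re (Complex (S m t) t) * (kernel_const / 1\<^sup>2)"
          by (rule kernel_bound'[OF \<epsilon>(1)]) (use s1 in auto)
        then have k: "norm (tkernel \<epsilon> (Complex (S m t) t)) \<le> \<epsilon> ^ DIM('a) * (g / \<epsilon>) powr (S m t) * kernel_const" by simp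
        have "(\<bar>t\<bar> + 1) powr q \<le> (\<bar>t\<bar> + 1) powr \<bar>q\<bar>" by (intro powr_mono) auto
        also have "\<dots> \<le> R" unfolding R_def using t by (intro powr_mono2) auto
        finally have R: "(\<bar>t\<bar> + 1) powr q \<le> R" .
        have "norm (F (Complex (S m t) t)) \<le> c * A powr \<bar>S m t\<bar> * (\<bar>t\<bar> + 1) powr q" by (rule L2)
        also have "\<dots> \<le> c * A powr \<bar>S m t\<bar> * R" by (intro mult_left_mono R) (use c(1) in auto)
        finally have "norm (?f (Complex (S m t) t)) \<le> (\<epsilon> ^ DIM('a) * (g / \<epsilon>) powr (S m t) * kernel_const) * (c * A powr \<bar>S m t\<bar> * R)"
          unfolding norm_mult by (intro mult_mono k) (use \<epsilon> kernel_const_nonneg in auto)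
        also have "\<dots> = \<epsilon> ^ DIM('a) * kernel_const * (c * R) * ((g / \<epsilon>) powr (S m t) * A powr \<bar>S m t\<bar>)" by (simp add: mult_ac)
        also have "(g / \<epsilon>) powr (S m t) * A powr \<bar>S m t\<bar> = \<theta> powr (- S m t)"
        proof -
          have "(g / \<epsilon>) powr (S m t) = (\<epsilon> / g) powr (- S m t)" using \<epsilon> g_pos by (simp add: powr_minus powr_divide field_simps)
          moreover have "\<bar>S m t\<bar> = - S m t" using s1 by simp
          ultimately show ?thesis using \<epsilon> g_pos A by (simp add: \<theta>_def powr_mult[symmetric] mult.commute)
        qed
        also have "\<epsilon> ^ DIM('a) * kernel_const * (c * R) * \<theta> powr (- S m t) \<le> \<epsilon> ^ DIM('a) * kernel_const * (c * R) * \<theta> powr (- \<sigma> m)"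
          using \<theta> S\<sigma>[of m t] by (intro mult_left_mono powr_mono') (use \<epsilon> kernel_const_nonneg c(1) in \<open>auto simp: R_def\<close>)
        finally show ?thesis .
      qed
      have "AE t in lebesgue. norm (screen_integrand (S m) ?f t) \<le> norm (?f (Complex (S m t) t)) * (K + 1)"
        by (rule AE_norm_screen_integrand_le[OF S])
      then have "AE t in lebesgue. t \<in> {a n..b n} \<longrightarrow> norm (screen_integrand (S m) ?f t) \<le> \<epsilon> ^ DIM('a) * kernel_const * (c * R) * \<theta> powr (- \<sigma> m) * (K + 1)"
      proof eventually_elim
        case (elim t)
        show ?case
        proof
          assume "t \<in> {a n..b n}"
          from mult_right_mono[OF pt[OF this], of "K + 1"] elim K0
          show "norm (screen_integrand (S m) ?f t) \<le> \<epsilon> ^ DIM('a) * kernel_const * (c * R) * \<theta> powr (- \<sigma> m) * (K + 1)" by linarith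
        qed
      qed
      then have "norm (integral {a n..b n} (screen_integrand (S m) ?f)) \<le> \<epsilon> ^ DIM('a) * kernel_const * (c * R) * \<theta> powr (- \<sigma> m) * (K + 1) * (b n - a n)"
        by (intro has_integral_norm_bound_AE[OF integrable_integral[OF Is[OF n elim]] ab])
           (use \<epsilon> kernel_const_nonneg c(1) K0 in \<open>auto simp: R_def\<close>)
      then show ?case by (simp add: Q_def mult_ac)
    qed
  qed
  define line where "line = (\<lambda>n. integral {a n..b n} (screen_integrand (\<lambda>_. ?c) ?f))"
  define corr where "corr = (\<Sum>m\<le>DIM('a). residue (correction \<epsilon>) (of_nat m))"
  define strip_sum where "strip_sum = (\<lambda>n. (I (a n) + line n - I (b n) - 0) / (2 * of_real pi * \<i>) + corr)"
  have win: "(\<lambda>m. \<Sum>w\<in>\<Omega> n \<inter> window (S m). residue (tubular_zeta l G \<kappa> UNIV \<epsilon>) w) \<longlonglongrightarrow> strip_sum n" if n: "n \<ge> 1" for n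
  proof -
    have "(\<lambda>m. (ray m (a n) + line n - ray m (b n) - integral {a n..b n} (screen_integrand (S m) ?f)) / (2 * of_real pi * \<i>) + corr) \<longlonglongrightarrow> strip_sum n"
      unfolding strip_sum_def by (intro tendsto_intros ray_a(1)[OF n] ray_b(1)[OF n] screen_lim[OF n]) simp
    moreover have "(ray m (a n) + line n - ray m (b n) - integral {a n..b n} (screen_integrand (S m) ?f)) / (2 * of_real pi * \<i>) + corr
       = (\<Sum>w\<in>\<Omega> n \<inter> window (S m). residue (tubular_zeta l G \<kappa> UNIV \<epsilon>) w)" if m: "m \<ge> M" for m
    proof -
      have "(\<Sum>w\<in>\<Omega> n \<inter> window (S m). residue (tubular_zeta l G \<kappa> UNIV \<epsilon>) w) = (\<Sum>w\<in>\<Omega> n \<inter> window (S m). residue ?f w + residue (correction \<epsilon>) w)"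
        by (intro sum.cong refl residue_tubular_zeta[OF \<epsilon>(1) FU]) auto
      moreover have "of_nat ` {..DIM('a)} \<subseteq> \<Omega> n \<inter> window (S m)" using Tpm[OF n] S1[OF m, of 0] unfolding P by (auto simp: window_def)
      moreover have "(\<Sum>w\<in>\<Omega> n \<inter> window (S m). residue ?f w) = (ray m (a n) + line n - ray m (b n) - integral {a n..b n} (screen_integrand (S m) ?f)) / (2 * of_real pi * \<i>)"
        using eq[OF n m] by (simp add: line_def field_simps)
      ultimately show ?thesis using sum_residue_correction[OF \<epsilon>(1) strip(1)[OF n m]] by (simp add: sum.distrib corr_def)
    qed
    ultimately show ?thesis by (elim Lim_transform_eventually) (auto simp: eventually_sequentially)
  qed
  have strip_sums: "has_strip_sum (\<lambda>m. window (S m)) (\<Omega> n) (residue (tubular_zeta l G \<kappa> UNIV \<epsilon>)) (strip_sum n)" if n: "n \<ge> 1" for n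
  proof (cases "finite (\<Omega> n)")
    case True
    have "\<forall>\<^sub>F m in sequentially. \<Omega> n \<inter> window (S m) = \<Omega> n"
    proof -
      obtain x where x: "\<And>w. w \<in> \<Omega> n \<Longrightarrow> norm w \<le> x" using finite_imp_bounded[OF True] bounded_iff by blast
      show ?thesis using \<sigma>ev[of "- x"]
      proof eventually_elim
        case (elim m)
        have "S m (Im w) \<le> Re w" if "w \<in> \<Omega> n" for w
          using S\<sigma>[of m "Im w"] elim x[OF that] abs_Re_le_cmod[of w] by linarith
        then show ?case by (auto simp: window_def)
      qed
    qed
    then have "\<forall>\<^sub>F m in sequentially. (\<Sum>w\<in>\<Omega> n. residue (tubular_zeta l G \<kappa> UNIV \<epsilon>) w) = (\<Sum>w\<in>\<Omega> n \<inter> window (S m). residue (tubular_zeta l G \<kappa> UNIV \<epsilon>) w)"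
      by eventually_elim simp
    then have "(\<lambda>m. \<Sum>w\<in>\<Omega> n \<inter> window (S m). residue (tubular_zeta l G \<kappa> UNIV \<epsilon>) w) \<longlonglongrightarrow> (\<Sum>w\<in>\<Omega> n. residue (tubular_zeta l G \<kappa> UNIV \<epsilon>) w)"
      by (rule Lim_transform_eventually[OF tendsto_const])
    then show ?thesis using win[OF n] LIMSEQ_unique True by (auto simp: has_strip_sum_def)
  qed (use win[OF n] in \<open>simp add: has_strip_sum_def\<close>)
  have a_lim: "filterlim a at_bot sequentially" and b_lim: "filterlim b at_top sequentially"
    using T by (auto simp: languid_heights_def a_def b_def)
  have Ia: "(\<lambda>n. I (a n)) \<longlonglongrightarrow> 0"
  proof (rule Lim_null_comparison)
    show "(\<lambda>n. E * ((\<bar>a n\<bar> + 1) powr q / (a n)\<^sup>2)) \<longlonglongrightarrow> 0"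
      using tendsto_height_factor[OF filterlim_heights(2)[OF T] q] by (intro tendsto_mult_right_zero) (simp add: a_def)
    show "\<forall>\<^sub>F n in sequentially. norm (I (a n)) \<le> E * ((\<bar>a n\<bar> + 1) powr q / (a n)\<^sup>2)"
      using eventually_ge_at_top[of 1] by eventually_elim (rule ray_a(2))
  qed
  have Ib: "(\<lambda>n. I (b n)) \<longlonglongrightarrow> 0"
  proof (rule Lim_null_comparison)
    show "(\<lambda>n. E * ((\<bar>b n\<bar> + 1) powr q / (b n)\<^sup>2)) \<longlonglongrightarrow> 0"
      using tendsto_height_factor[OF filterlim_heights(1)[OF T] q] by (intro tendsto_mult_right_zero) (simp add: b_def)
    show "\<forall>\<^sub>F n in sequentially. norm (I (b n)) \<le> E * ((\<bar>b n\<bar> + 1) powr q / (b n)\<^sup>2)"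
      using eventually_ge_at_top[of 1] by eventually_elim (rule ray_b(2))
  qed
  have "strip_sum \<longlonglongrightarrow> (0 + 2 * of_real pi * \<i> * of_real (main_part \<epsilon>) - 0 - 0) / (2 * of_real pi * \<i>) + corr"
    unfolding strip_sum_def line_def
    by (intro tendsto_intros Ia Ib line_limit_heights[OF FU _ \<epsilon>(1) a_lim b_lim]) auto
  then have "strip_sum \<longlonglongrightarrow> of_real (main_part \<epsilon>) + corr" by simp
  then have "has_full_dims_sum (\<lambda>m. window (S m)) T (tubular_dims l DIM('a) UNIV) (residue (tubular_zeta l G \<kappa> UNIV \<epsilon>)) (of_real (main_part \<epsilon>) + corr)"
    unfolding has_full_dims_sum_def using strip_sums by (auto simp: \<Omega>_def)
  moreover have "complex_of_real (parallel_volume (\<Union>j. Gs j) \<epsilon>) = of_real (main_part \<epsilon>) + corr + of_real vol * scaling_zeta l UNIV (of_nat DIM('a))"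
    using volume_eq[OF \<epsilon>(1)] continuation_at_dim[OF FU] by (simp add: corr_def F_def)
  ultimately show ?thesis by blast
qed

end

theorem theorem4p1:
  fixes l :: "nat \<Rightarrow> real"
    and G :: "'a::euclidean_space set"
    and Gs :: "nat \<Rightarrow> 'a set"
    and \<kappa> :: "nat \<Rightarrow> real \<Rightarrow> real"
  assumes spray: "fractal_spray l G Gs"
    and first: "l 0 = 1"
    and steiner: "steiner_like G \<kappa>"
    and abscissa: "abscissa l < ereal (real DIM('a))"
  shows
    "(\<forall>S T q. screen l S \<longrightarrow> S 0 < 0 \<longrightarrow> q < 1 \<longrightarrow> languid l S T q \<longrightarrow>
        (\<forall>\<epsilon>>0.
           integrable lebesgue (screen_integrand S (error_density l G \<kappa> (window S) \<epsilon>)) \<and>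
           (\<exists>L. has_dims_sum T (tubular_dims l DIM('a) (window S))
                   (residue (tubular_zeta l G \<kappa> (window S) \<epsilon>)) L \<and>
                complex_of_real (parallel_volume (\<Union>j. Gs j) \<epsilon>) =
                  L + of_real (measure lebesgue G) * scaling_zeta l (window S) (of_nat DIM('a))
                    + error_term l G \<kappa> S \<epsilon>)) \<and>
        (\<lambda>\<epsilon>. norm (error_term l G \<kappa> S \<epsilon>))
          \<in> O[at_right 0](\<lambda>\<epsilon>. \<epsilon> powr (real DIM('a) - (SUP t. S t)))) \<and>
     (\<forall>S T q A. 0 < A \<longrightarrow> q < 2 \<longrightarrow> strongly_languid l S T q A \<longrightarrow>
        scaling_zeta_extends l UNIV \<and>
        (\<forall>\<epsilon>. 0 < \<epsilon> \<and> \<epsilon> < min (inradius G) (inverse A * inradius G) \<longrightarrow>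
           (\<exists>L. has_full_dims_sum (\<lambda>m. window (S m)) T (tubular_dims l DIM('a) UNIV)
                   (residue (tubular_zeta l G \<kappa> UNIV \<epsilon>)) L \<and>
                complex_of_real (parallel_volume (\<Union>j. Gs j) \<epsilon>) =
                  L + of_real (measure lebesgue G) * scaling_zeta l UNIV (of_nat DIM('a)))))"
proof -
  interpret fractal_tube l G Gs \<kappa>
    using spray first steiner abscissa by unfold_locales
  show ?thesis
  proof (intro conjI allI impI)
    fix S :: "real \<Rightarrow> real" and T q and \<epsilon> :: real
    assume *: "screen l S" "S 0 < 0" "q < 1" "languid l S T q" and "0 < \<epsilon>"
    from tube_formula_with_error(1)[OF * \<open>0 < \<epsilon>\<close>]
    show "integrable lebesgue (screen_integrand S (error_density l G \<kappa> (window S) \<epsilon>))"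
      "\<exists>L. has_dims_sum T (tubular_dims l DIM('a) (window S)) (residue (tubular_zeta l G \<kappa> (window S) \<epsilon>)) L \<and>
           complex_of_real (parallel_volume (\<Union>j. Gs j) \<epsilon>) =
             L + of_real (measure lebesgue G) * scaling_zeta l (window S) (of_nat DIM('a)) + error_term l G \<kappa> S \<epsilon>"
      by blast+
  next
    fix S :: "real \<Rightarrow> real" and T q
    assume "screen l S" "S 0 < 0" "q < 1" "languid l S T q"
    then show "(\<lambda>\<epsilon>. norm (error_term l G \<kappa> S \<epsilon>)) \<in> O[at_right 0](\<lambda>\<epsilon>. \<epsilon> powr (real DIM('a) - (SUP t. S t)))"
      by (rule tube_formula_with_error(2))
  next
    fix S T q A
    assume "strongly_languid l S T q A"
    then show "scaling_zeta_extends l UNIV"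
      unfolding strongly_languid_def by (intro continuation_to_plane[of S]) auto
  next
    fix S T q A and \<epsilon> :: real
    assume "0 < A" "q < 2" "strongly_languid l S T q A" "0 < \<epsilon> \<and> \<epsilon> < min (inradius G) (inverse A * inradius G)"
    then show "\<exists>L. has_full_dims_sum (\<lambda>m. window (S m)) T (tubular_dims l DIM('a) UNIV)
                   (residue (tubular_zeta l G \<kappa> UNIV \<epsilon>)) L \<and>
                complex_of_real (parallel_volume (\<Union>j. Gs j) \<epsilon>) =
                  L + of_real (measure lebesgue G) * scaling_zeta l UNIV (of_nat DIM('a))"
      using tube_formula_exact by blast
  qed
qed

end
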